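(* Let $\Psi^I=\Phi_0\cup\bigcup_{j=0}^\infty\Psi_j$ be the system on $[0,1]$ constructed in the context, with $\Phi_0=\{\phi_{0,k}:k=1,\dots,6\}$ and $\Psi_j=\{\psi_{j,k}:1\le k\le6\cdot2^j\}$. Then: a) All functions in $\Psi^I$ are cubic splines belonging to $C^1(0,1)$. b) The functions of $\Psi^I$ satisfy, with the $L^2(0,1)$ inner product, $\langle\phi_{0,k},\phi_{0,l}\rangle=\delta_{k,l}$, $\langle\psi_{i,k},\psi_{j,l}\rangle=\delta_{i,j}\delta_{k,l}$, $\langle\phi_{0,k},\psi_{j,l}\rangle=0$ for all admissible indices. c) The inner wavelets $\psi_{j,k}$, $k=3,\dots,6\cdot2^j-2$, have four vanishing moments (they are orthogonal to all polynomials of degree less than $4$). d) $\Psi^I$ is an orthogonal basis of $L^2(0,1)$. f) $\operatorname{diam}\operatorname{supp}\phi_{0,k}\le2$ and $\operatorname{diam}\operatorname{supp}\psi_{j,k}\le2^{1-j}$.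
   Context: Real line construction. $\langle\cdot,\cdot\rangle$, $\|\cdot\|$ are the inner product and norm of real $L^2$; $\mathcal X\ominus\mathcal Y$ is the $L^2$-orthogonal complement of $\mathcal Y$ in $\mathcal X$. $\xi_1(x)=(x+1)^2(1-2x)$ on $[-1,0]$, $(1-x)^2(1+2x)$ on $[0,1]$, $0$ otherwise; $\xi_2(x)=(x+1)^2x$ on $[-1,0]$, $(1-x)^2x$ on $[0,1]$, $0$ otherwise; $\xi_{j,2k+l-1}(x)=2^{j/2}\xi_l(2^jx-k)$, $l=1,2$. $\phi_1=\xi_{1,2}/\|\xi_{1,2}\|$, $\phi_2=\xi_{1,3}/\|\xi_{1,3}\|$. $\mathcal A_0=\operatorname{span}\{\xi_{1,2},\xi_{1,3}\}$, $\mathcal A_1=\operatorname{span}\{\xi_{2,k}:k=2,\dots,7\}$, $\mathcal B_0=\operatorname{span}(\{\xi_{1,0}\chi_{[0,1]},\xi_{1,1}\chi_{[0,1]}\}\cup\mathcal A_0)$, $\mathcal B_1=\operatorname{span}(\{\xi_{1,4}\chi_{[0,1]},\xi_{1,5}\chi_{[0,1]}\}\cup\mathcal A_0)$, $\mathcal C_h=\mathcal B_h\ominus\mathcal A_0$. $\phi_3,\phi_4$ form an orthonormal basis of a two-dimensional subspace $W\subset\mathcal A_1\ominus\mathcal A_0$ with $(I-P_W)\mathcal C_0\perp(I-P_W)\mathcal C_1$ ($P_W$ orthogonal projection). $g_5=\xi_{1,0}-\sum_{j=1}^4\langle\xi_{1,0},\phi_j\rangle\phi_j-\sum_{j=1}^4\langle\xi_{1,0},\phi_j(\cdot+1)\rangle\phi_j(\cdot+1)$,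 $\phi_5=g_5/\|g_5\|$; $g_6=\xi_{1,1}-\sum_{j=1}^5\langle\xi_{1,1},\phi_j\rangle\phi_j-\sum_{j=1}^5\langle\xi_{1,1},\phi_j(\cdot+1)\rangle\phi_j(\cdot+1)$, $\phi_6=g_6/\|g_6\|$. Write $\phi^{\mathbb R}_{j,6k+l}(x)=2^{j/2}\phi_l(2^jx-k)$ for $l=1,\dots,4$ and $\phi^{\mathbb R}_{j,6k+l}(x)=2^{j/2}\phi_l(2^jx-k-1)$ for $l=5,6$. Wavelet generators: $\psi_1,\psi_2$ form an orthonormal basis of the space of all $f\in\operatorname{span}\{\phi_k(2\cdot),k=1,\dots,4;\ \phi_k(2\cdot-1),k=1,\dots,6\}$ orthogonal to $\phi_1,\dots,\phi_6,\phi_5(\cdot-1),\phi_6(\cdot-1)$ (taken to be two-dimensional). With $h_i=\phi_{i+4}(2\cdot)-\langle\phi_{i+4}(2\cdot),\phi_5\rangle\phi_5-\langle\phi_{i+4}(2\cdot),\phi_6\rangle\phi_6$, $i=1,2$, the functions $\psi_3,\psi_4$ are obtained from $h_1,h_2$ by Gram--Schmidt orthonormalization. $\psi_5,\psi_6$ form an orthonormal basis of the (two-dimensional) space of all $f\in\operatorname{span}\{\phi^{\mathbb R}_{1,k}:k=-11,\dots,10\}$ orthogonal to $\phi^{\mathbb R}_{0,k}$ ($k=-7,\dots,6$), $\psi_1(\cdot+1),\psi_2(\cdot+1)$, $\psi_1,\dots,\psi_4$. Write $\psi^{\mathbb R}_{j,6k+l}(x)=2^{j/2}\psi_l(2^jx-k)$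 for $l=1,2$ and $\psi^{\mathbb R}_{j,6k+l}(x)=2^{j/2}\psi_l(2^jx-k-1)$ for $l=3,\dots,6$. Interval construction. $\phi_L$ is the $L^2$-normalization of $(\phi_6(0)\phi_5-\phi_5(0)\phi_6)\chi_{[0,1]}$ and $\phi_R$ that of $(\phi_6(0)\phi_5(\cdot-1)-\phi_5(0)\phi_6(\cdot-1))\chi_{[0,1]}$. $\psi_{L_1},\psi_{L_2}$ form an orthonormal basis of the space of functions $g=\sum_{j=1}^4b_j\psi_{j+2}\chi_{[0,1]}$ with $\sum_jb_j\psi_{j+2}(0)=0$ and $\langle\phi_L,g\rangle=0$; $\psi_{R_1},\psi_{R_2}$ form an orthonormal basis of the space of functions $g=\sum_{j=1}^4c_j\psi_{j+2}(\cdot-1)\chi_{[0,1]}$ with $\sum_jc_j\psi_{j+2}(0)=0$ and $\langle\phi_R,g\rangle=0$; both spaces are taken to be two-dimensional in the construction. Set $\phi_{0,1}=\phi_L$, $\phi_{0,6}=\phi_R$, $\phi_{0,k}=\phi_{k-1}$ for $k=2,\dots,5$. For $j\ge0$: boundary wavelets $\psi_{j,i}=2^{j/2}\psi_{L_i}(2^j\cdot)$ and $\psi_{j,6\cdot2^j+i-2}=2^{j/2}\psi_{R_i}(2^j\cdot-2^j+1)$, $i=1,2$; inner wavelets $\psi_{j,n+2}=\psi^{\mathbb R}_{j,n}$ for $1\le n\le6\cdot2^j-4$ (exactly the real-line wavelets of level $j$ supported in $[0,1]$). All functions are considered on $[0,1]$. *)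

theory Defs
  imports "HOL-Analysis.Analysis" "HOL-Library.Function_Algebras"
    "HOL-Computational_Algebra.Polynomial"
begin

(* The library has no real_vector instance for functions, so the vector space of all functions
   from real to real is obtained by interpreting the locale; fun_vs.span is the linear span. *)

definition fscale :: "real \<Rightarrow> (real \<Rightarrow> real) \<Rightarrow> real \<Rightarrow> real" where
  "fscale c f = (\<lambda>x. c * f x)"

global_interpretation fun_vs: vector_space fscale
  by unfold_locales (auto simp: fscale_def fun_eq_iff algebra_simps)

(* Functions are not identified almost everywhere: an element of L2(S) is represented by a
   function on the whole line, of which only the values on S are relevant. *)

definition L2_on :: "real set \<Rightarrow> (real \<Rightarrow> real) set" where
  "L2_on S = {f. set_borel_measurable lborel S f \<and> set_integrable lborel S (\<lambda>x. (f x)\<^sup>2)}"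

definition inner_on :: "real set \<Rightarrow> (real \<Rightarrow> real) \<Rightarrow> (real \<Rightarrow> real) \<Rightarrow> real" where
  "inner_on S f g = (LINT x:S|lborel. f x * g x)"

definition norm_on :: "real set \<Rightarrow> (real \<Rightarrow> real) \<Rightarrow> real" where
  "norm_on S f = sqrt (inner_on S f f)"

abbreviation ip :: "(real \<Rightarrow> real) \<Rightarrow> (real \<Rightarrow> real) \<Rightarrow> real" where
  "ip \<equiv> inner_on UNIV"

definition normalize_fun :: "(real \<Rightarrow> real) \<Rightarrow> real \<Rightarrow> real" where
  "normalize_fun f = (\<lambda>x. f x / norm_on UNIV f)"

definition ominus :: "(real \<Rightarrow> real) set \<Rightarrow> (real \<Rightarrow> real) set \<Rightarrow> (real \<Rightarrow> real) set" where
  "ominus X Y = {f \<in> X. \<forall>g\<in>Y. ip f g = 0}"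

(* The choice of p is unique on spans of continuous functions, the only spaces it is used for. *)

definition orth_proj :: "(real \<Rightarrow> real) set \<Rightarrow> (real \<Rightarrow> real) \<Rightarrow> real \<Rightarrow> real" where
  "orth_proj W f = (THE p. p \<in> W \<and> (\<forall>w\<in>W. ip (f - p) w = 0))"

definition orthonormal_basis2 ::
    "(real \<Rightarrow> real) \<Rightarrow> (real \<Rightarrow> real) \<Rightarrow> (real \<Rightarrow> real) set \<Rightarrow> bool" where
  "orthonormal_basis2 f g V \<longleftrightarrow>
     ip f f = 1 \<and> ip g g = 1 \<and> ip f g = 0 \<and> fun_vs.span {f, g} = V"

definition orthogonal_basis_on :: "real set \<Rightarrow> (real \<Rightarrow> real) set \<Rightarrow> bool" where
  "orthogonal_basis_on S B \<longleftrightarrow>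
     B \<subseteq> L2_on S \<and> (\<forall>f\<in>B. norm_on S f \<noteq> 0) \<and>
     (\<forall>f\<in>B. \<forall>g\<in>B. f \<noteq> g \<longrightarrow> inner_on S f g = 0) \<and>
     (\<forall>f\<in>L2_on S. \<forall>\<epsilon>>0. \<exists>g\<in>fun_vs.span B. norm_on S (f - g) < \<epsilon>)"

(* The pieces are closed intervals, so continuity on [a, b] is included. *)

definition cubic_spline_on :: "real \<Rightarrow> real \<Rightarrow> (real \<Rightarrow> real) \<Rightarrow> bool" where
  "cubic_spline_on a b f \<longleftrightarrow>
     (\<exists>n (t :: nat \<Rightarrow> real). t 0 = a \<and> t n = b \<and>
        (\<forall>i<n. t i < t (Suc i) \<and>
           (\<exists>p :: real poly. degree p \<le> 3 \<and> (\<forall>x\<in>{t i..t (Suc i)}. f x = poly p x))))"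

definition cut01 :: "(real \<Rightarrow> real) \<Rightarrow> real \<Rightarrow> real" where
  "cut01 f = (\<lambda>x. f x * indicator {0..1} x)"

definition dil :: "nat \<Rightarrow> int \<Rightarrow> (real \<Rightarrow> real) \<Rightarrow> real \<Rightarrow> real" where
  "dil j k f = (\<lambda>x. 2 powr (real j / 2) * f (2 ^ j * x - of_int k))"

definition \<xi>\<^sub>1 :: "real \<Rightarrow> real" where
  "\<xi>\<^sub>1 x = (if -1 \<le> x \<and> x \<le> 0 then (x + 1)\<^sup>2 * (1 - 2 * x)
          else if 0 \<le> x \<and> x \<le> 1 then (1 - x)\<^sup>2 * (1 + 2 * x) else 0)"

definition \<xi>\<^sub>2 :: "real \<Rightarrow> real" where
  "\<xi>\<^sub>2 x = (if -1 \<le> x \<and> x \<le> 0 then (x + 1)\<^sup>2 * x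
          else if 0 \<le> x \<and> x \<le> 1 then (1 - x)\<^sup>2 * x else 0)"

(* For n = 2 k + l - 1 with l = 1, 2 this is the shift by k of the l-th generator. *)

definition \<xi> :: "nat \<Rightarrow> int \<Rightarrow> real \<Rightarrow> real" where
  "\<xi> j n = dil j (n div 2) (if even n then \<xi>\<^sub>1 else \<xi>\<^sub>2)"

definition A0 :: "(real \<Rightarrow> real) set" where
  "A0 = fun_vs.span {\<xi> 1 2, \<xi> 1 3}"

definition A1 :: "(real \<Rightarrow> real) set" where
  "A1 = fun_vs.span (\<xi> 2 ` {2..7})"

definition B0 :: "(real \<Rightarrow> real) set" where
  "B0 = fun_vs.span ({cut01 (\<xi> 1 0), cut01 (\<xi> 1 1)} \<union> A0)"

definition B1 :: "(real \<Rightarrow> real) set" where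
  "B1 = fun_vs.span ({cut01 (\<xi> 1 4), cut01 (\<xi> 1 5)} \<union> A0)"

definition C0 :: "(real \<Rightarrow> real) set" where "C0 = ominus B0 A0"
definition C1 :: "(real \<Rightarrow> real) set" where "C1 = ominus B1 A0"

(* For (m, f) = (4, \<xi> 1 0) and (5, \<xi> 1 1) these are the functions g_5 and g_6. *)

definition sub_components :: "(nat \<Rightarrow> real \<Rightarrow> real) \<Rightarrow> nat \<Rightarrow> (real \<Rightarrow> real) \<Rightarrow> real \<Rightarrow> real" where
  "sub_components \<phi> m f = (\<lambda>x. f x - (\<Sum>i=1..m. ip f (\<phi> i) * \<phi> i x)
     - (\<Sum>i=1..m. ip f (\<lambda>y. \<phi> i (y + 1)) * \<phi> i (x + 1)))"

definition scaling_generators :: "(nat \<Rightarrow> real \<Rightarrow> real) \<Rightarrow> bool" where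
  "scaling_generators \<phi> \<longleftrightarrow>
     \<phi> 1 = normalize_fun (\<xi> 1 2) \<and>
     \<phi> 2 = normalize_fun (\<xi> 1 3) \<and>
     (\<exists>W. W \<subseteq> ominus A1 A0 \<and> orthonormal_basis2 (\<phi> 3) (\<phi> 4) W \<and>
        (\<forall>f\<in>C0. \<forall>g\<in>C1. ip (f - orth_proj W f) (g - orth_proj W g) = 0)) \<and>
     \<phi> 5 = normalize_fun (sub_components \<phi> 4 (\<xi> 1 0)) \<and>
     \<phi> 6 = normalize_fun (sub_components \<phi> 5 (\<xi> 1 1))"

(* In both real-line families the index is n = 6 k + l with l = 1, ..., 6. *)

definition \<phi>R :: "(nat \<Rightarrow> real \<Rightarrow> real) \<Rightarrow> nat \<Rightarrow> int \<Rightarrow> real \<Rightarrow> real" where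
  "\<phi>R \<phi> j n = (let k = (n - 1) div 6; l = nat ((n - 1) mod 6 + 1)
     in dil j (if l \<le> 4 then k else k + 1) (\<phi> l))"

definition \<psi>R :: "(nat \<Rightarrow> real \<Rightarrow> real) \<Rightarrow> nat \<Rightarrow> int \<Rightarrow> real \<Rightarrow> real" where
  "\<psi>R \<psi> j n = (let k = (n - 1) div 6; l = nat ((n - 1) mod 6 + 1)
     in dil j (if l \<le> 2 then k else k + 1) (\<psi> l))"

definition wavelet_h :: "(nat \<Rightarrow> real \<Rightarrow> real) \<Rightarrow> nat \<Rightarrow> real \<Rightarrow> real" where
  "wavelet_h \<phi> i = (let f = (\<lambda>x. \<phi> (i + 4) (2 * x))
     in (\<lambda>x. f x - ip f (\<phi> 5) * \<phi> 5 x - ip f (\<phi> 6) * \<phi> 6 x))"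

definition wavelet_generators ::
    "(nat \<Rightarrow> real \<Rightarrow> real) \<Rightarrow> (nat \<Rightarrow> real \<Rightarrow> real) \<Rightarrow> bool" where
  "wavelet_generators \<phi> \<psi> \<longleftrightarrow>
     orthonormal_basis2 (\<psi> 1) (\<psi> 2)
       (ominus (fun_vs.span ((\<lambda>k x. \<phi> k (2 * x)) ` {1..4} \<union> (\<lambda>k x. \<phi> k (2 * x - 1)) ` {1..6}))
          (\<phi> ` {1..6} \<union> {\<lambda>x. \<phi> 5 (x - 1), \<lambda>x. \<phi> 6 (x - 1)})) \<and>
     \<psi> 3 = normalize_fun (wavelet_h \<phi> 1) \<and>
     \<psi> 4 = normalize_fun (\<lambda>x. wavelet_h \<phi> 2 x - ip (wavelet_h \<phi> 2) (\<psi> 3) * \<psi> 3 x) \<and>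
     orthonormal_basis2 (\<psi> 5) (\<psi> 6)
       (ominus (fun_vs.span (\<phi>R \<phi> 1 ` {-11..10}))
          (\<phi>R \<phi> 0 ` {-7..6} \<union> {\<lambda>x. \<psi> 1 (x + 1), \<lambda>x. \<psi> 2 (x + 1)} \<union> \<psi> ` {1..4}))"

definition \<phi>L :: "(nat \<Rightarrow> real \<Rightarrow> real) \<Rightarrow> real \<Rightarrow> real" where
  "\<phi>L \<phi> = normalize_fun (cut01 (\<lambda>x. \<phi> 6 0 * \<phi> 5 x - \<phi> 5 0 * \<phi> 6 x))"

definition \<phi>Rt :: "(nat \<Rightarrow> real \<Rightarrow> real) \<Rightarrow> real \<Rightarrow> real" where
  "\<phi>Rt \<phi> = normalize_fun (cut01 (\<lambda>x. \<phi> 6 0 * \<phi> 5 (x - 1) - \<phi> 5 0 * \<phi> 6 (x - 1)))"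

definition boundary_generators ::
    "(nat \<Rightarrow> real \<Rightarrow> real) \<Rightarrow> (nat \<Rightarrow> real \<Rightarrow> real) \<Rightarrow>
     (nat \<Rightarrow> real \<Rightarrow> real) \<Rightarrow> (nat \<Rightarrow> real \<Rightarrow> real) \<Rightarrow> bool" where
  "boundary_generators \<phi> \<psi> \<psi>L \<psi>Rt \<longleftrightarrow>
     orthonormal_basis2 (\<psi>L 1) (\<psi>L 2)
       {g. \<exists>b :: nat \<Rightarrow> real. g = cut01 (\<lambda>x. \<Sum>j=1..4. b j * \<psi> (j + 2) x) \<and>
          (\<Sum>j=1..4. b j * \<psi> (j + 2) 0) = 0 \<and> ip (\<phi>L \<phi>) g = 0} \<and>
     orthonormal_basis2 (\<psi>Rt 1) (\<psi>Rt 2)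
       {g. \<exists>c :: nat \<Rightarrow> real. g = cut01 (\<lambda>x. \<Sum>j=1..4. c j * \<psi> (j + 2) (x - 1)) \<and>
          (\<Sum>j=1..4. c j * \<psi> (j + 2) 0) = 0 \<and> ip (\<phi>Rt \<phi>) g = 0}"

definition \<phi>I :: "(nat \<Rightarrow> real \<Rightarrow> real) \<Rightarrow> nat \<Rightarrow> real \<Rightarrow> real" where
  "\<phi>I \<phi> k = (if k = 1 then \<phi>L \<phi> else if k = 6 then \<phi>Rt \<phi> else \<phi> (k - 1))"

definition \<psi>I ::
    "(nat \<Rightarrow> real \<Rightarrow> real) \<Rightarrow> (nat \<Rightarrow> real \<Rightarrow> real) \<Rightarrow> (nat \<Rightarrow> real \<Rightarrow> real) \<Rightarrow>
     nat \<Rightarrow> nat \<Rightarrow> real \<Rightarrow> real" where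
  "\<psi>I \<psi> \<psi>L \<psi>Rt j k =
     (if k \<le> 2 then dil j 0 (\<psi>L k)
      else if k \<le> 6 * 2 ^ j - 2 then \<psi>R \<psi> j (int k - 2)
      else dil j (2 ^ j - 1) (\<psi>Rt (k + 2 - 6 * 2 ^ j)))"

definition \<Psi>I ::
    "(nat \<Rightarrow> real \<Rightarrow> real) \<Rightarrow> (nat \<Rightarrow> real \<Rightarrow> real) \<Rightarrow>
     (nat \<Rightarrow> real \<Rightarrow> real) \<Rightarrow> (nat \<Rightarrow> real \<Rightarrow> real) \<Rightarrow> (real \<Rightarrow> real) set" where
  "\<Psi>I \<phi> \<psi> \<psi>L \<psi>Rt =
     \<phi>I \<phi> ` {1..6} \<union> (\<Union>j. \<psi>I \<psi> \<psi>L \<psi>Rt j ` {1..6 * 2 ^ j})"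

definition supp01 :: "(real \<Rightarrow> real) \<Rightarrow> real set" where
  "supp01 f = closure {x \<in> {0..1}. f x \<noteq> 0}"

end

theory Submission
  imports Defs
begin

text \<open>Let \<open>V\<^sub>0\<close> be the span of the integer translates of \<open>\<phi> 1, \<dots>, \<phi> 6\<close>. The condition on \<open>W\<close> makes
  the restrictions of \<open>\<phi> 5, \<phi> 6\<close> to \<open>[0, 1]\<close> orthogonal to those of their translates by one, so
  that the translates are orthonormal. Since \<open>V\<^sub>0\<close> contains the Hermite splines with knots in
  \<open>\<int>/2\<close> and consists of splines with knots in \<open>\<int>/4\<close>, it lies in its dilate \<open>V\<^sub>1\<close>. The wavelets
  are orthogonal to \<open>V\<^sub>0\<close>, and a cubic polynomial agrees on \<open>[-1, 1]\<close> with its Hermite interpolant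
  in \<open>V\<^sub>0\<close>, whence the vanishing moments.

  On the interval, cutting off at an end point does not change an inner product with a function
  supported on the right side of it, so the orthogonality relations carry over from the line.
  The functions of \<open>\<Psi>\<^sup>I\<close> below level \<open>j\<close> form an orthonormal set of \<open>6\<cdot>2\<^sup>j\<close> elements in a space
  spanned by \<open>6\<cdot>2\<^sup>j\<close> scaling functions, hence span it. This space contains the translates of
  \<open>\<xi>\<^sub>1(2\<^sup>j\<^sup>+\<^sup>1 x)\<close> supported in \<open>[0, 1]\<close>, whose sums approximate indicators of intervals.\<close>

text \<open>Otherwise the simplifier rewrites the index in \<open>\<phi> 1\<close> and \<open>dil 1\<close> to \<open>Suc 0\<close>.\<close>
declare One_nat_def [simp del]

subsection \<open>Bounded functions with compact support\<close>

text \<open>The functions \<open>\<phi> 3\<close> and \<open>\<phi> 4\<close> are known only through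
  the orthogonality condition on \<open>W\<close>, so nothing beyond Hermite splines can be computed
  explicitly. The difficulty is non-degeneracy: \<open>normalize_fun\<close> sends a function of
  norm zero to zero, and every claimed norm one needs an argument. Two devices supply it. The first
  is the pair of value and derivative at 0. The translates of \<open>\<phi> 1\<close>, ...,
  \<open>\<phi> 4\<close> contribute nothing to it, so \<open>\<phi> 5\<close> gets a nonzero value
  and derivative zero from \<open>\<xi> 1 0\<close>, and \<open>\<phi> 6\<close> gets a nonzero
  derivative from \<open>\<xi> 1 1\<close>. The second is the invertible matrix of inner products of
  Hermite functions at neighbouring knots, with which knots are removed from a spline one by one; it
  yields the independence behind \<open>\<psi> 3\<close> and \<open>\<psi> 4\<close>. The least
  direct relation is the orthogonality of \<open>\<psi> 5\<close>, \<open>\<psi> 6\<close> to their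
  translates by one, which is not part of their definition. At the end points, a combination of
  \<open>\<phi> 5\<close> and \<open>\<phi> 6\<close> that vanishes at 0 is a multiple of a single
  function, and this makes the cut functions refinable.\<close>

lemma fscale_apply [simp]: "fscale c f x = c * f x"
  by (simp add: fscale_def)

lemma span_map:
  assumes "f \<in> fun_vs.span S"
    and add: "\<And>f g. L (f + g) = L f + L g" and sc: "\<And>c f. L (fscale c f) = fscale c (L f)"
  shows "L f \<in> fun_vs.span (L ` S)"
proof -
  have zero: "L 0 = 0"
    using sc[of 0 0] by (simp add: fun_eq_iff)
  have "fun_vs.subspace {f. L f \<in> fun_vs.span (L ` S)}"
    by (auto simp: fun_vs.subspace_def add sc zero fun_vs.span_zero
        intro: fun_vs.span_add fun_vs.span_scale)
  then have "fun_vs.span S \<subseteq> {f. L f \<in> fun_vs.span (L ` S)}"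
    by (intro fun_vs.span_minimal) (auto intro: fun_vs.span_base)
  then show ?thesis
    using assms(1) by blast
qed

lemma span_map_subset:
  assumes "f \<in> fun_vs.span S"
    and "\<And>f g. L (f + g) = L f + L g" "\<And>c f. L (fscale c f) = fscale c (L f)"
    and "\<And>s. s \<in> S \<Longrightarrow> L s \<in> fun_vs.span R"
  shows "L f \<in> fun_vs.span R"
proof -
  have "fun_vs.span (L ` S) \<subseteq> fun_vs.span R"
    by (intro fun_vs.span_minimal) (use assms in auto)
  then show ?thesis
    using span_map[OF assms(1-3)] by blast
qed

lemma span_in_subspace: "f \<in> fun_vs.span S \<Longrightarrow> S \<subseteq> V \<Longrightarrow> fun_vs.subspace V \<Longrightarrow> f \<in> V"
  using fun_vs.span_minimal by blast

lemma span_trans_subset: "f \<in> fun_vs.span S \<Longrightarrow> (\<And>s. s \<in> S \<Longrightarrow> s \<in> fun_vs.span R) \<Longrightarrow> f \<in> fun_vs.span R"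
  by (rule span_in_subspace[of f S]) auto

lemma span_superset_mono: "f \<in> fun_vs.span S \<Longrightarrow> S \<subseteq> R \<Longrightarrow> f \<in> fun_vs.span R"
  using fun_vs.span_mono by blast

lemma sum_fun_apply: "(\<Sum>i\<in>A. f i) x = (\<Sum>i\<in>A. f i x)" for f :: "'i \<Rightarrow> real \<Rightarrow> real"
  by (induction A rule: infinite_finite_induct) auto

lemma fun_span_insert: "f \<in> fun_vs.span (insert a S) \<longleftrightarrow> (\<exists>c. f - fscale c a \<in> fun_vs.span S)"
  by (rule fun_vs.span_breakdown_eq)

lemma span2_iff: "f \<in> fun_vs.span {u, v} \<longleftrightarrow> (\<exists>a b. f = fscale a u + fscale b v)"
proof
  assume "f \<in> fun_vs.span {u, v}"
  then obtain a b where "f - fscale a u - fscale b v = 0"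
    by (auto simp: fun_span_insert)
  then have "f = fscale a u + fscale b v"
    by (metis diff_add_cancel add.commute add_0)
  then show "\<exists>a b. f = fscale a u + fscale b v"
    by blast
qed (auto intro: fun_vs.span_add fun_vs.span_scale fun_vs.span_base)

text \<open>Closed under all operations of the construction, the cut-offs with their jumps included.
  Products are integrable, so \<open>ip\<close> is bilinear on this space without further side
  conditions.\<close>

definition tame :: "(real \<Rightarrow> real) set" where
  "tame = {f \<in> borel_measurable borel. \<exists>B R. \<forall>x. \<bar>f x\<bar> \<le> B \<and> (R < \<bar>x\<bar> \<longrightarrow> f x = 0)}"

text \<open>A linear condition, unlike a bound on the diameter of the support, so it passes to
  spans. The end points are not excluded; neighbouring functions may share one point.\<close>

definition supp_in :: "real \<Rightarrow> real \<Rightarrow> (real \<Rightarrow> real) set" where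
  "supp_in a b = {f. \<forall>x. x < a \<or> b < x \<longrightarrow> f x = 0}"

definition sh :: "int \<Rightarrow> (real \<Rightarrow> real) \<Rightarrow> real \<Rightarrow> real" where
  "sh k f = (\<lambda>x. f (x - of_int k))"

abbreviation D :: "(real \<Rightarrow> real) \<Rightarrow> real \<Rightarrow> real" where
  "D \<equiv> dil 1 0"

lemma tameE:
  assumes "f \<in> tame"
  obtains B R where "f \<in> borel_measurable borel" "\<And>x. \<bar>f x\<bar> \<le> B" "\<And>x. R < \<bar>x\<bar> \<Longrightarrow> f x = 0" "0 \<le> B"
proof -
  obtain B R where *: "f \<in> borel_measurable borel" "\<forall>x. \<bar>f x\<bar> \<le> B \<and> (R < \<bar>x\<bar> \<longrightarrow> f x = 0)"
    using assms unfolding tame_def by blast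
  have "0 \<le> \<bar>f 0\<bar>" by simp
  also have "\<dots> \<le> B" using * by blast
  finally show ?thesis using * that by blast
qed

lemma tameI:
  "f \<in> borel_measurable borel \<Longrightarrow> (\<And>x. \<bar>f x\<bar> \<le> B) \<Longrightarrow> (\<And>x. R < \<bar>x\<bar> \<Longrightarrow> f x = 0) \<Longrightarrow> f \<in> tame"
  unfolding tame_def by blast

lemma tame_add [intro]:
  assumes "f \<in> tame" "g \<in> tame"
  shows "f + g \<in> tame"
proof -
  obtain B R where f: "f \<in> borel_measurable borel" "\<And>x. \<bar>f x\<bar> \<le> B" "\<And>x. R < \<bar>x\<bar> \<Longrightarrow> f x = 0"
    using tameE[OF assms(1)] by metis
  obtain B' R' where g: "g \<in> borel_measurable borel" "\<And>x. \<bar>g x\<bar> \<le> B'" "\<And>x. R' < \<bar>x\<bar> \<Longrightarrow> g x = 0"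
    using tameE[OF assms(2)] by metis
  show ?thesis
  proof (rule tameI[where B = "B + B'" and R = "max R R'"])
    show "f + g \<in> borel_measurable borel"
      using f(1) g(1) by (auto simp: plus_fun_def)
    show "\<bar>(f + g) x\<bar> \<le> B + B'" for x
      using f(2)[of x] g(2)[of x] by auto
  qed (use f g in auto)
qed

lemma tame_scale [intro]:
  assumes "f \<in> tame"
  shows "fscale c f \<in> tame"
proof -
  obtain B R where f: "f \<in> borel_measurable borel" "\<And>x. \<bar>f x\<bar> \<le> B" "\<And>x. R < \<bar>x\<bar> \<Longrightarrow> f x = 0"
    using tameE[OF assms(1)] by metis
  show ?thesis
  proof (rule tameI[where B = "\<bar>c\<bar> * B" and R = "R"])
    show "fscale c f \<in> borel_measurable borel"
      using f(1) by (auto simp: fscale_def)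
    show "\<bar>fscale c f x\<bar> \<le> \<bar>c\<bar> * B" for x
      using f(2)[of x] by (auto simp: abs_mult intro!: mult_left_mono)
  qed (use f in auto)
qed

lemma tame_zero [intro]: "0 \<in> tame"
  by (rule tameI[where B = 0 and R = 0]) (auto simp: zero_fun_def)

lemma subspace_tame [intro]: "fun_vs.subspace tame"
  by (auto simp: fun_vs.subspace_def)

lemma tame_diff [intro]: "f \<in> tame \<Longrightarrow> g \<in> tame \<Longrightarrow> f - g \<in> tame"
  using fun_vs.subspace_diff by blast

lemma tame_sum [intro]: "(\<And>i. i \<in> A \<Longrightarrow> f i \<in> tame) \<Longrightarrow> (\<Sum>i\<in>A. f i) \<in> tame"
  using fun_vs.subspace_sum by blast

lemma tame_affine:
  assumes "f \<in> tame" "a \<noteq> 0"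
  shows "(\<lambda>x. c * f (a * x + b)) \<in> tame"
proof -
  obtain B R where f: "f \<in> borel_measurable borel" "\<And>x. \<bar>f x\<bar> \<le> B" "\<And>x. R < \<bar>x\<bar> \<Longrightarrow> f x = 0"
    using tameE[OF assms(1)] by metis
  show ?thesis
  proof (rule tameI[where B = "\<bar>c\<bar> * B" and R = "(\<bar>R\<bar> + \<bar>b\<bar>) / \<bar>a\<bar>"])
    show "(\<lambda>x. c * f (a * x + b)) \<in> borel_measurable borel"
      using f(1) by measurable
    show "\<bar>c * f (a * x + b)\<bar> \<le> \<bar>c\<bar> * B" for x
      using f(2)[of "a * x + b"] by (auto simp: abs_mult intro!: mult_left_mono)
    show "c * f (a * x + b) = 0" if "(\<bar>R\<bar> + \<bar>b\<bar>) / \<bar>a\<bar> < \<bar>x\<bar>" for x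
    proof -
      have "\<bar>R\<bar> + \<bar>b\<bar> < \<bar>a * x\<bar>"
        using that assms(2) by (simp add: divide_simps abs_mult mult.commute)
      then have "R < \<bar>a * x + b\<bar>"
        by linarith
      then show ?thesis using f(3) by simp
    qed
  qed
qed

lemma tame_sh [intro]: "f \<in> tame \<Longrightarrow> sh k f \<in> tame"
  using tame_affine[of f 1 1 "- of_int k"] by (simp add: sh_def)

lemma tame_dil [intro]: "f \<in> tame \<Longrightarrow> dil j k f \<in> tame"
  using tame_affine[of f "2 ^ j" "2 powr (real j / 2)" "- of_int k"] by (simp add: dil_def)

lemma tame_cut01 [intro]:
  assumes "f \<in> tame"
  shows "cut01 f \<in> tame"
proof -
  obtain B R where f: "f \<in> borel_measurable borel" "\<And>x. \<bar>f x\<bar> \<le> B" "\<And>x. R < \<bar>x\<bar> \<Longrightarrow> f x = 0" "0 \<le> B"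
    using tameE[OF assms(1)] by metis
  show ?thesis
  proof (rule tameI[where B = B and R = R])
    show "cut01 f \<in> borel_measurable borel"
      unfolding cut01_def using f(1) by measurable
    show "\<bar>cut01 f x\<bar> \<le> B" for x
      using f(2)[of x] f(4) by (auto simp: cut01_def indicator_def)
  qed (use f in \<open>auto simp: cut01_def\<close>)
qed

lemma tame_continuous:
  assumes "continuous_on UNIV f" "f \<in> supp_in a b"
  shows "f \<in> tame"
proof -
  have "compact (f ` {a..b})"
    by (intro compact_continuous_image continuous_on_subset[OF assms(1)]) auto
  then have "bounded (f ` {a..b})"
    by (rule compact_imp_bounded)
  then obtain B where B: "\<And>x. x \<in> {a..b} \<Longrightarrow> \<bar>f x\<bar> \<le> B"
    unfolding bounded_iff by force
  show ?thesis
  proof (rule tameI[where B = "max 0 B" and R = "max \<bar>a\<bar> \<bar>b\<bar>"])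
    show "f \<in> borel_measurable borel"
      by (intro borel_measurable_continuous_onI assms)
    show "\<bar>f x\<bar> \<le> max 0 B" for x
      using B[of x] assms(2) by (cases "x \<in> {a..b}") (auto simp: supp_in_def)
    show "f x = 0" if "max \<bar>a\<bar> \<bar>b\<bar> < \<bar>x\<bar>" for x
      using that assms(2) by (auto simp: supp_in_def abs_if split: if_splits)
  qed
qed

lemma subspace_supp_in [intro]: "fun_vs.subspace (supp_in a b)"
  by (auto simp: fun_vs.subspace_def supp_in_def)

lemma supp_inD: "f \<in> supp_in a b \<Longrightarrow> x < a \<or> b < x \<Longrightarrow> f x = 0"
  by (auto simp: supp_in_def)

lemma supp_in_mono: "f \<in> supp_in a b \<Longrightarrow> c \<le> a \<Longrightarrow> b \<le> d \<Longrightarrow> f \<in> supp_in c d"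
  by (auto simp: supp_in_def)

lemma supp_in_sh: "f \<in> supp_in a b \<Longrightarrow> a' \<le> a + of_int k \<Longrightarrow> b + of_int k \<le> b' \<Longrightarrow> sh k f \<in> supp_in a' b'"
  by (auto simp: supp_in_def sh_def)

lemma supp_in_dil: 
  assumes "f \<in> supp_in a b"
  shows "dil j k f \<in> supp_in ((a + of_int k) / 2 ^ j) ((b + of_int k) / 2 ^ j)"
  using assms by (auto simp: supp_in_def dil_def field_simps)

lemma supp_in_cut01 [intro]: "cut01 f \<in> supp_in 0 1"
  by (auto simp: supp_in_def cut01_def)

section \<open>The inner product on tame functions\<close>

lemma ip_eq: "ip f g = (\<integral>x. f x * g x \<partial>lborel)"
  by (simp add: inner_on_def set_lebesgue_integral_def)

lemma tame_mult_integrable: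
  assumes "f \<in> tame" "g \<in> tame"
  shows "integrable lborel (\<lambda>x. f x * g x)"
proof -
  obtain B R where f: "f \<in> borel_measurable borel" "\<And>x. \<bar>f x\<bar> \<le> B" "\<And>x. R < \<bar>x\<bar> \<Longrightarrow> f x = 0" "0 \<le> B"
    using tameE[OF assms(1)] by metis
  obtain B' R' where g: "g \<in> borel_measurable borel" "\<And>x. \<bar>g x\<bar> \<le> B'" "\<And>x. R' < \<bar>x\<bar> \<Longrightarrow> g x = 0"
    using tameE[OF assms(2)] by metis
  show ?thesis
  proof (rule Bochner_Integration.integrable_bound)
    show "integrable lborel (\<lambda>x. indicator {-R..R} x *\<^sub>R (B * B'))"
      using borel_integrable_compact[of "{-R..R}" "\<lambda>_. B * B'"] by (simp add: set_integrable_def)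
    show "(\<lambda>x. f x * g x) \<in> borel_measurable lborel"
      using f(1) g(1) by simp
    have "norm (f x * g x) \<le> norm (indicator {-R..R} x *\<^sub>R (B * B'))" for x
    proof (cases "R < \<bar>x\<bar>")
      case True
      then show ?thesis using f(3) by simp
    next
      case False
      have "0 \<le> B'" using g(2)[of 0] by linarith
      then have "\<bar>f x * g x\<bar> \<le> B * B'"
        using f(2)[of x] g(2)[of x] f(4) by (simp add: abs_mult mult_mono)
      moreover have "x \<in> {-R..R}"
        using False by auto
      ultimately show ?thesis
        by simp
    qed
    then show "AE x in lborel. norm (f x * g x) \<le> norm (indicator {-R..R} x *\<^sub>R (B * B'))"
      by simp
  qed
qed

lemma ip_commute: "ip f g = ip g f"
  by (simp add: ip_eq mult.commute)

lemma ip_add_left: "f \<in> tame \<Longrightarrow> g \<in> tame \<Longrightarrow> h \<in> tame \<Longrightarrow> ip (f + g) h = ip f h + ip g h"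
  by (simp add: ip_eq distrib_right tame_mult_integrable)

lemma ip_diff_left: "f \<in> tame \<Longrightarrow> g \<in> tame \<Longrightarrow> h \<in> tame \<Longrightarrow> ip (f - g) h = ip f h - ip g h"
  by (simp add: ip_eq left_diff_distrib tame_mult_integrable)

lemma ip_scale_left: "ip (fscale c f) h = c * ip f h"
  by (simp add: ip_eq mult.assoc)

lemma ip_add_right: "f \<in> tame \<Longrightarrow> g \<in> tame \<Longrightarrow> h \<in> tame \<Longrightarrow> ip h (f + g) = ip h f + ip h g"
  by (simp add: ip_commute[of h] ip_add_left)

lemma ip_diff_right: "f \<in> tame \<Longrightarrow> g \<in> tame \<Longrightarrow> h \<in> tame \<Longrightarrow> ip h (f - g) = ip h f - ip h g"
  by (simp add: ip_commute[of h] ip_diff_left)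

lemma ip_scale_right: "ip h (fscale c f) = c * ip h f"
  by (simp add: ip_commute[of h] ip_scale_left)

lemma ip_zero_left [simp]: "ip 0 h = 0"
  by (simp add: ip_eq)

lemma ip_zero_right [simp]: "ip h 0 = 0"
  by (simp add: ip_eq)

lemma ip_sum_left: "(\<And>i. i \<in> A \<Longrightarrow> f i \<in> tame) \<Longrightarrow> h \<in> tame \<Longrightarrow> ip (\<Sum>i\<in>A. f i) h = (\<Sum>i\<in>A. ip (f i) h)"
  by (induction A rule: infinite_finite_induct) (auto simp: ip_add_left tame_sum)

lemmas ip_linear = ip_add_left ip_diff_left ip_scale_left ip_add_right ip_diff_right ip_scale_right

lemma ip_nonneg: "0 \<le> ip f f"
  by (simp add: ip_eq)

lemma ip_span_zero:
  assumes "f \<in> fun_vs.span F" "g \<in> fun_vs.span G" "F \<subseteq> tame" "G \<subseteq> tame"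
    and "\<And>f g. f \<in> F \<Longrightarrow> g \<in> G \<Longrightarrow> ip f g = 0"
  shows "ip f g = 0"
proof -
  have "f \<in> {f \<in> tame. \<forall>g\<in>G. ip f g = 0}"
  proof (rule span_in_subspace[OF assms(1)])
    show "fun_vs.subspace {f \<in> tame. \<forall>g\<in>G. ip f g = 0}"
      using assms(4) by (auto simp: fun_vs.subspace_def ip_linear subset_iff)
  qed (use assms in auto)
  moreover have "g \<in> {g \<in> tame. ip f g = 0}"
  proof (rule span_in_subspace[OF assms(2)])
    show "fun_vs.subspace {g \<in> tame. ip f g = 0}"
      using calculation by (auto simp: fun_vs.subspace_def ip_linear)
  qed (use assms calculation in auto)
  ultimately show ?thesis by simp
qed

lemma ip_span_zero_right:
  assumes "g \<in> fun_vs.span G" "f \<in> tame" "G \<subseteq> tame" "\<And>g. g \<in> G \<Longrightarrow> ip f g = 0"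
  shows "ip f g = 0"
  by (rule ip_span_zero[of f "{f}" g G]) (use assms in \<open>auto intro: fun_vs.span_base\<close>)

lemma ip_span_zero_left:
  assumes "g \<in> fun_vs.span G" "f \<in> tame" "G \<subseteq> tame" "\<And>g. g \<in> G \<Longrightarrow> ip g f = 0"
  shows "ip g f = 0"
  using ip_span_zero_right[OF assms(1-3)] assms(4) by (simp add: ip_commute)

text \<open>The exceptional point is the common end point of two adjacent supports.\<close>

lemma ip_AE_zero:
  assumes "\<And>x. x \<noteq> a \<Longrightarrow> f x * g x = 0"
  shows "ip f g = 0"
proof -
  have "AE x in lborel. f x * g x = 0"
    using AE_lborel_singleton[of a] by eventually_elim (use assms in auto)
  then show ?thesis
    unfolding ip_eq by (rule integral_eq_zero_AE)
qed

lemma ip_disjoint: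
  assumes "f \<in> supp_in a b" "g \<in> supp_in c d" "b \<le> c"
  shows "ip f g = 0" "ip g f = 0"
proof -
  show "ip f g = 0"
  proof (rule ip_AE_zero[of b])
    show "f x * g x = 0" if "x \<noteq> b" for x
      using supp_inD[OF assms(1), of x] supp_inD[OF assms(2), of x] assms(3) that by force
  qed
  then show "ip g f = 0" by (simp add: ip_commute)
qed

text \<open>The factor \<open>a\<close> is a power of two for dilations, 1 for translations and -1
  for the reflection in the parity argument.\<close>

lemma ip_affine:
  assumes "c * c = \<bar>a\<bar>" "a \<noteq> 0"
  shows "ip (\<lambda>x. c * f (b + a * x)) (\<lambda>x. c * g (b + a * x)) = ip f g"
proof -
  have "ip f g = \<bar>a\<bar> *\<^sub>R (\<integral>x. f (b + a * x) * g (b + a * x) \<partial>lborel)"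
    unfolding ip_eq by (rule lborel_integral_real_affine[OF assms(2)])
  also have "\<dots> = (\<integral>x. (c * c) * (f (b + a * x) * g (b + a * x)) \<partial>lborel)"
    unfolding assms(1) by (simp only: integral_mult_right_zero real_scaleR_def)
  also have "\<dots> = ip (\<lambda>x. c * f (b + a * x)) (\<lambda>x. c * g (b + a * x))"
    unfolding ip_eq by (rule Bochner_Integration.integral_cong) auto
  finally show ?thesis by simp
qed

lemma ip_dil [simp]: "ip (dil j k f) (dil j k g) = ip f g"
proof -
  have "2 powr (real j / 2) * 2 powr (real j / 2) = (2::real) ^ j"
    by (simp flip: powr_add powr_realpow)
  then show ?thesis
    using ip_affine[of "2 powr (real j / 2)" "2 ^ j" f "- of_int k" g] by (simp add: dil_def add.commute)
qed

lemma ip_sh [simp]: "ip (sh k f) (sh k g) = ip f g"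
  using ip_affine[of 1 1 f "- of_int k" g] by (simp add: sh_def)

lemma sh_sh [simp]: "sh k (sh l f) = sh (k + l) f"
  by (simp add: sh_def algebra_simps)

lemma sh_0 [simp]: "sh 0 f = f"
  by (simp add: sh_def)

lemma ip_sh_sh: "ip (sh k f) (sh l g) = ip f (sh (l - k) g)"
  using ip_sh[of k f "sh (l - k) g"] by simp

lemma ip_sh_left: "ip (sh k f) g = ip f (sh (- k) g)"
  using ip_sh_sh[of k f 0 g] by simp

text \<open>Translating first and dilating afterwards separates position from level: arguments about
  one level are carried out with integer translates and then transported by
  \<open>dil j 0\<close>.\<close>

lemma dil_eq: "dil j k f = dil j 0 (sh k f)"
  by (simp add: dil_def sh_def)

lemma dil_0: "dil 0 k f = sh k f"
  by (simp add: dil_def sh_def)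

lemma sh_D: "sh k (D f) = D (sh (2 * k) f)"
  by (simp add: dil_def sh_def algebra_simps)

lemma dil_D: "dil j 0 (D f) = dil (j + 1) 0 f"
  by (simp add: dil_def fun_eq_iff add_divide_distrib powr_add power_add mult_ac)

lemma sh_add: "sh k (f + g) = sh k f + sh k g"
  and sh_scale: "sh k (fscale c f) = fscale c (sh k f)"
  and sh_diff: "sh k (f - g) = sh k f - sh k g"
  by (auto simp: sh_def fun_eq_iff)

lemma dil_add: "dil j k (f + g) = dil j k f + dil j k g"
  and dil_scale: "dil j k (fscale c f) = fscale c (dil j k f)"
  by (auto simp: dil_def fun_eq_iff algebra_simps)

lemma cut01_add: "cut01 (f + g) = cut01 f + cut01 g"
  and cut01_scale: "cut01 (fscale c f) = fscale c (cut01 f)"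
  and cut01_diff: "cut01 (f - g) = cut01 f - cut01 g"
  by (auto simp: cut01_def fun_eq_iff algebra_simps)

lemmas sh_span = span_map_subset[where L = "sh k" for k, OF _ sh_add sh_scale]
lemmas dil_span = span_map_subset[where L = "dil j k" for j k, OF _ dil_add dil_scale]

lemma normalize_fun_eq: "normalize_fun f = fscale (1 / sqrt (ip f f)) f"
  by (auto simp: normalize_fun_def norm_on_def fun_eq_iff)

lemma ip_normalize_fun: "ip f f \<noteq> 0 \<Longrightarrow> ip (normalize_fun f) (normalize_fun f) = 1"
  using ip_nonneg[of f] by (simp add: normalize_fun_eq ip_scale_left ip_scale_right)

lemma normalize_fun_span: "f \<in> fun_vs.span S \<Longrightarrow> normalize_fun f \<in> fun_vs.span S"
  by (simp add: normalize_fun_eq fun_vs.span_scale)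

lemma span_normalize_fun: "ip f f \<noteq> 0 \<Longrightarrow> f = fscale (sqrt (ip f f)) (normalize_fun f)"
  by (simp add: normalize_fun_eq fun_eq_iff)

text \<open>The points of \<open>U\<close> with nonzero value form an open null set, which is empty.
  Continuity is asked on \<open>U\<close> only, because cut functions are continuous merely inside
  the interval.\<close>

lemma ip_self_zero_open:
  assumes "f \<in> tame" "ip f f = 0" "open U" "continuous_on U f" "x \<in> U"
  shows "f x = 0"
proof (rule ccontr)
  assume "f x \<noteq> 0"
  have "AE x in lborel. f x * f x = 0"
    using integral_nonneg_eq_0_iff_AE[OF tame_mult_integrable[OF assms(1,1)]] assms(2)
    by (simp add: ip_eq)
  then have ae: "AE x in lborel. f x = 0"
    by simp
  have "open (f -` (- {0}) \<inter> U)"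
    using assms(3,4) continuous_on_open_vimage by blast
  then have op: "open {y \<in> U. f y \<noteq> 0}"
    by (simp add: vimage_def Int_def conj_commute)
  moreover have "negligible {y \<in> U. f y \<noteq> 0}"
  proof -
    have "{y \<in> U. f y \<noteq> 0} \<in> null_sets lborel"
    proof (rule AE_iff_null_sets[THEN iffD2])
      show "{y \<in> U. f y \<noteq> 0} \<in> sets lborel" using op by simp
      show "AE x in lborel. x \<notin> {y \<in> U. f y \<noteq> 0}"
        using ae by eventually_elim auto
    qed
    then show ?thesis
      using negligible_iff_null_sets null_sets_completionI by blast
  qed
  ultimately have "{y \<in> U. f y \<noteq> 0} = {}"
    using open_not_negligible by blast
  then show False
    using assms(5) \<open>f x \<noteq> 0\<close> by blast
qed

lemma ip_self_zero:
  assumes "f \<in> tame" "ip f f = 0" "continuous_on UNIV f"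
  shows "f = 0"
  using ip_self_zero_open[OF assms(1,2) open_UNIV assms(3)] by (simp add: fun_eq_iff)

subsection \<open>Continuously differentiable splines\<close>

definition c1 :: "(real \<Rightarrow> real) set" where
  "c1 = {f. \<exists>f'. continuous_on UNIV f' \<and> (\<forall>x. (f has_real_derivative f' x) (at x))}"

text \<open>Uniform knots on the whole line. Functions on the interval obtain their smoothness by
  agreeing on \<open>[0, 1]\<close> with such a spline.\<close>

definition splines :: "nat \<Rightarrow> (real \<Rightarrow> real) set" where
  "splines m = {f \<in> c1. \<forall>i :: int. \<exists>p :: real poly. degree p \<le> 3 \<and>
     (\<forall>x\<in>{of_int i / 2 ^ m..of_int (i + 1) / 2 ^ m}. f x = poly p x)}"

lemma c1_add: "f \<in> c1 \<Longrightarrow> g \<in> c1 \<Longrightarrow> f + g \<in> c1"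
proof -
  assume "f \<in> c1" "g \<in> c1"
  then obtain f' g' where "continuous_on UNIV f'" "\<And>x. (f has_real_derivative f' x) (at x)"
    "continuous_on UNIV g'" "\<And>x. (g has_real_derivative g' x) (at x)"
    unfolding c1_def by blast
  then show ?thesis
    unfolding c1_def plus_fun_def
    by (intro CollectI exI[of _ "\<lambda>x. f' x + g' x"]) (auto intro!: continuous_intros derivative_eq_intros)
qed

lemma c1_affine: "f \<in> c1 \<Longrightarrow> (\<lambda>x. c * f (a * x + b)) \<in> c1"
proof -
  assume "f \<in> c1"
  then obtain f' where f': "continuous_on UNIV f'" "\<And>x. (f has_real_derivative f' x) (at x)"
    unfolding c1_def by blast
  have "((\<lambda>x. c * f (a * x + b)) has_real_derivative c * (f' (a * x + b) * a)) (at x)" for x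
    by (intro DERIV_cmult DERIV_chain2[OF f'(2)]) (auto intro!: derivative_eq_intros)
  moreover have "continuous_on UNIV (\<lambda>x. c * (f' (a * x + b) * a))"
    by (intro continuous_intros continuous_on_compose2[OF f'(1)]) auto
  ultimately show ?thesis
    unfolding c1_def by blast
qed

lemma c1_scale: "f \<in> c1 \<Longrightarrow> fscale c f \<in> c1"
  using c1_affine[of f c 1 0] by (simp add: fscale_def)

lemma c1_zero: "0 \<in> c1"
  unfolding c1_def zero_fun_def by (auto intro!: exI[of _ "\<lambda>x. 0"])

lemma c1_continuous: "f \<in> c1 \<Longrightarrow> continuous_on S f"
  unfolding c1_def by (blast intro: DERIV_continuous_on has_field_derivative_at_within)

lemma c1_has_deriv:
  assumes "f \<in> c1"
  shows "(f has_real_derivative deriv f x) (at x)"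
proof -
  from assms obtain f' where f': "\<forall>x. (f has_real_derivative f' x) (at x)"
    by (auto simp: c1_def)
  show ?thesis
    using f'[rule_format, of x] DERIV_imp_deriv[OF f'[rule_format, of x]] by simp
qed

lemma c1_continuous_deriv:
  assumes "f \<in> c1"
  shows "continuous_on UNIV (deriv f)"
proof -
  from assms obtain f' where f': "continuous_on UNIV f'" "\<forall>x. (f has_real_derivative f' x) (at x)"
    by (auto simp: c1_def)
  have "f' x = deriv f x" for x
    using DERIV_imp_deriv[OF f'(2)[rule_format]] by (rule sym)
  then show ?thesis
    by (intro continuous_on_eq[OF f'(1)])
qed

lemma c1_deriv_add: "f \<in> c1 \<Longrightarrow> g \<in> c1 \<Longrightarrow> deriv (f + g) x = deriv f x + deriv g x"
  unfolding plus_fun_def by (rule DERIV_imp_deriv, rule DERIV_add; rule c1_has_deriv)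

lemma c1_deriv_scale: "f \<in> c1 \<Longrightarrow> deriv (fscale c f) x = c * deriv f x"
  unfolding fscale_def by (rule DERIV_imp_deriv, rule DERIV_cmult, rule c1_has_deriv)

text \<open>Value and derivative are continuous, so they vanish at the ends of an interval on which
  the function does. Read contrapositively, a nonzero value or derivative at 0 prevents a function
  from vanishing on either side of 0.\<close>

lemma c1_zero_at_end:
  assumes "f \<in> c1" "a < b" "\<And>x. x \<in> {a<..<b} \<Longrightarrow> f x = 0" "y = a \<or> y = b"
  shows "f y = 0" "deriv f y = 0"
proof -
  have y: "y \<in> closure {a<..<b}"
    using assms(2,4) by (auto simp: closure_greaterThanLessThan)
  show "f y = 0"
    by (rule continuous_constant_on_closure[OF c1_continuous[OF assms(1)] assms(3) y])
  have "deriv f x = 0" if "x \<in> {a<..<b}" for x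
  proof -
    have "(f has_real_derivative 0) (at x)"
    proof (rule has_field_derivative_transform_within_open)
      show "((\<lambda>x. 0) has_real_derivative 0) (at x)" by simp
      show "open {a<..<b}" by simp
    qed (use that assms(3) in auto)
    then show ?thesis by (rule DERIV_imp_deriv)
  qed
  then show "deriv f y = 0"
    using continuous_constant_on_closure[OF _ _ y, of "deriv f" 0] c1_continuous_deriv[OF assms(1)]
      continuous_on_subset by blast
qed

lemma splines_c1: "splines m \<subseteq> c1"
  by (auto simp: splines_def)

lemma subspace_splines: "fun_vs.subspace (splines m)"
  unfolding fun_vs.subspace_def
proof (intro conjI ballI allI)
  show "0 \<in> splines m"
    by (auto simp: splines_def c1_zero intro!: exI[of _ "0 :: real poly"])
next
  fix f g assume "f \<in> splines m" "g \<in> splines m"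
  then have c: "f \<in> c1" "g \<in> c1"
    and ex: "\<And>i :: int. \<exists>p :: real poly. degree p \<le> 3 \<and> (\<forall>x\<in>{of_int i / 2 ^ m..of_int (i + 1) / 2 ^ m}. f x = poly p x)"
      "\<And>i :: int. \<exists>p :: real poly. degree p \<le> 3 \<and> (\<forall>x\<in>{of_int i / 2 ^ m..of_int (i + 1) / 2 ^ m}. g x = poly p x)"
    unfolding splines_def by blast+
  have "\<exists>p :: real poly. degree p \<le> 3 \<and> (\<forall>x\<in>{of_int i / 2 ^ m..of_int (i + 1) / 2 ^ m}. (f + g) x = poly p x)" for i :: int
  proof -
    obtain p q where "degree p \<le> 3" "\<forall>x\<in>{of_int i / 2 ^ m..of_int (i + 1) / 2 ^ m}. f x = poly p x"
      "degree q \<le> 3" "\<forall>x\<in>{of_int i / 2 ^ m..of_int (i + 1) / 2 ^ m}. g x = poly q x"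
      using ex[of i] by blast
    then show ?thesis
      by (intro exI[of _ "p + q"]) (auto intro: degree_add_le)
  qed
  then show "f + g \<in> splines m"
    using c c1_add unfolding splines_def by blast
next
  fix c f assume "f \<in> splines m"
  then have c: "f \<in> c1"
    and ex: "\<And>i :: int. \<exists>p :: real poly. degree p \<le> 3 \<and> (\<forall>x\<in>{of_int i / 2 ^ m..of_int (i + 1) / 2 ^ m}. f x = poly p x)"
    unfolding splines_def by blast+
  have "\<exists>p :: real poly. degree p \<le> 3 \<and> (\<forall>x\<in>{of_int i / 2 ^ m..of_int (i + 1) / 2 ^ m}. (fscale c f) x = poly p x)" for i :: int
  proof -
    obtain p where "degree p \<le> 3" "\<forall>x\<in>{of_int i / 2 ^ m..of_int (i + 1) / 2 ^ m}. f x = poly p x"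
      using ex[of i] by blast
    then show ?thesis
      by (intro exI[of _ "smult c p"]) (auto intro: order_trans[OF degree_smult_le])
  qed
  then show "fscale c f \<in> splines m"
    using c c1_scale unfolding splines_def by blast
qed

lemma splines_dil:
  assumes "f \<in> splines m"
  shows "dil j k f \<in> splines (m + j)"
proof -
  have "dil j k f \<in> c1"
    using c1_affine[of f "2 powr (real j / 2)" "2 ^ j" "- of_int k"] assms splines_c1
    by (auto simp: dil_def)
  moreover have "\<exists>p :: real poly. degree p \<le> 3 \<and>
      (\<forall>x\<in>{of_int i / 2 ^ (m + j)..of_int (i + 1) / 2 ^ (m + j)}. dil j k f x = poly p x)" for i :: int
  proof -
    obtain p where p: "degree p \<le> 3"
      "\<And>x. x \<in> {of_int (i - k * 2 ^ m) / 2 ^ m..of_int (i - k * 2 ^ m + 1) / 2 ^ m} \<Longrightarrow> f x = poly p x"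
      using assms unfolding splines_def by blast
    let ?q = "smult (2 powr (real j / 2)) (pcompose p [: - of_int k, 2 ^ j:])"
    have "degree ?q \<le> 3"
      using p(1) by (auto simp: degree_pcompose)
    moreover have "dil j k f x = poly ?q x"
      if "x \<in> {of_int i / 2 ^ (m + j)..of_int (i + 1) / 2 ^ (m + j)}" for x
    proof -
      have "f (2 ^ j * x - of_int k) = poly p (2 ^ j * x - of_int k)"
        using that by (intro p(2)) (auto simp: field_simps power_add)
      then show ?thesis
        by (simp add: dil_def poly_pcompose mult.commute)
    qed
    ultimately show ?thesis by blast
  qed
  ultimately show ?thesis
    unfolding splines_def by blast
qed

lemma splines_sh: "f \<in> splines m \<Longrightarrow> sh k f \<in> splines m"
  using splines_dil[of f m 0 k] by (simp add: dil_0)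

lemma splines_tame: "f \<in> splines m \<Longrightarrow> f \<in> supp_in a b \<Longrightarrow> f \<in> tame"
  using tame_continuous c1_continuous splines_c1 by blast

text \<open>Only agreement on \<open>[0, 1]\<close> is asked, since cutting may create jumps at the
  end points.\<close>

lemma splines_imp_cubic_spline_on:
  assumes "g \<in> splines m" "\<And>x. x \<in> {0..1} \<Longrightarrow> f x = g x"
  shows "cubic_spline_on 0 1 f" "f C1_differentiable_on {0<..<1}"
proof -
  show "cubic_spline_on 0 1 f"
    unfolding cubic_spline_on_def
  proof (rule exI[of _ "2 ^ m"], rule exI[of _ "\<lambda>i. real i / 2 ^ m"], intro conjI allI impI)
    fix i :: nat assume i: "i < 2 ^ m"
    then have i': "real (Suc i) \<le> 2 ^ m"
      by (metis Suc_leI of_nat_le_iff of_nat_numeral of_nat_power)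
    obtain p where p: "degree p \<le> 3"
      "\<And>x. x \<in> {of_int (int i) / 2 ^ m..of_int (int i + 1) / 2 ^ m} \<Longrightarrow> g x = poly p x"
      using assms unfolding splines_def by blast
    show "real i / 2 ^ m < real (Suc i) / 2 ^ m"
      by (simp add: divide_strict_right_mono)
    show "\<exists>p. degree p \<le> 3 \<and> (\<forall>x\<in>{real i / 2 ^ m..real (Suc i) / 2 ^ m}. f x = poly p x)"
    proof (intro exI[of _ p] conjI ballI p(1))
      fix x assume x: "x \<in> {real i / 2 ^ m..real (Suc i) / 2 ^ m}"
      then have "0 \<le> x"
        by (metis atLeastAtMost_iff divide_nonneg_nonneg of_nat_0_le_iff order_trans zero_le_numeral zero_le_power)
      moreover have "real (Suc i) / 2 ^ m \<le> 1"
        using i' by simp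
      then have "x \<le> 1"
        using x by (meson atLeastAtMost_iff order_trans)
      ultimately show "f x = poly p x"
        using assms(2)[of x] p(2)[of x] x by (simp add: add.commute)
    qed
  qed auto
  show "f C1_differentiable_on {0<..<1}"
    unfolding C1_differentiable_on_def
  proof (intro exI[of _ "deriv g"] conjI ballI)
    have g: "g \<in> c1" using assms(1) splines_c1 by blast
    fix x :: real assume x: "x \<in> {0<..<1}"
    have "(f has_real_derivative deriv g x) (at x)"
    proof (rule has_field_derivative_transform_within_open[OF c1_has_deriv[OF g]])
      show "open {0<..<1::real}" "x \<in> {0<..<1}" using x by auto
    qed (use assms(2) in auto)
    then show "(f has_vector_derivative deriv g x) (at x)"
      by (simp add: has_real_derivative_iff_has_vector_derivative)
  next
    have g: "g \<in> c1" using assms(1) splines_c1 by blast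
    show "continuous_on {0<..<1} (deriv g)"
      using c1_continuous_deriv[OF g] continuous_on_subset by blast
  qed
qed

subsection \<open>Hermite cubics\<close>

lemma has_real_derivative_pos_part_sq:
  "((\<lambda>x::real. (max 0 x)\<^sup>2) has_real_derivative 2 * max 0 x) (at x)"
proof (cases x "0 :: real" rule: linorder_cases)
  case less
  have "((\<lambda>x::real. 0) has_real_derivative 2 * max 0 x) (at x)"
    using less by simp
  then show ?thesis
    by (rule has_field_derivative_transform_within_open[where S = "{..<0}"]) (use less in auto)
next
  case greater
  have "((\<lambda>x::real. x\<^sup>2) has_real_derivative 2 * max 0 x) (at x)"
    using greater by (auto intro!: derivative_eq_intros)
  then show ?thesis
    by (rule has_field_derivative_transform_within_open[where S = "{0<..}"]) (use greater in auto)
next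
  case equal
  \<comment> \<open>At the knot the difference quotient is either 0 or \<open>y\<close>.\<close>
  have "((\<lambda>y. ((max 0 y)\<^sup>2 - (max 0 x)\<^sup>2) / (y - x)) \<longlongrightarrow> 0) (at 0)"
  proof (rule Lim_null_comparison[where g = "\<lambda>y. \<bar>y\<bar>"])
    show "\<forall>\<^sub>F y in at 0. norm (((max 0 y)\<^sup>2 - (max 0 x)\<^sup>2) / (y - x)) \<le> \<bar>y\<bar>"
      using equal by (intro always_eventually) (auto simp: max_def power2_eq_square)
    show "((\<lambda>y::real. \<bar>y\<bar>) \<longlongrightarrow> 0) (at 0)"
      by (auto intro!: tendsto_eq_intros)
  qed
  then show ?thesis
    using equal by (simp add: has_field_derivative_iff)
qed

lemma pos_part_c1:
  "(\<lambda>x. (max 0 x)\<^sup>2) \<in> c1" "(\<lambda>x. (max 0 x) ^ 3) \<in> c1"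
proof -
  show "(\<lambda>x. (max 0 x)\<^sup>2) \<in> c1"
    unfolding c1_def using has_real_derivative_pos_part_sq
    by (intro CollectI exI[of _ "\<lambda>x. 2 * max 0 x"]) (auto intro!: continuous_intros)
  have "((\<lambda>x. x * (max 0 x)\<^sup>2) has_real_derivative (max 0 x)\<^sup>2 + x * (2 * max 0 x)) (at x)" for x :: real
    by (rule derivative_eq_intros has_real_derivative_pos_part_sq refl)+ (simp add: max_def)
  moreover have "(\<lambda>x::real. x * (max 0 x)\<^sup>2) = (\<lambda>x. (max 0 x) ^ 3)"
    by (auto simp: fun_eq_iff max_def power2_eq_square power3_eq_cube)
  ultimately show "(\<lambda>x. (max 0 x) ^ 3) \<in> c1"
    unfolding c1_def
    by (intro CollectI exI[of _ "\<lambda>x. (max 0 x)\<^sup>2 + x * (2 * max 0 x)"]) (auto intro!: continuous_intros)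
qed

lemma xi_out: "x \<le> -1 \<or> 1 \<le> x \<Longrightarrow> \<xi>\<^sub>1 x = 0" "x \<le> -1 \<or> 1 \<le> x \<Longrightarrow> \<xi>\<^sub>2 x = 0"
  by (auto simp: \<xi>\<^sub>1_def \<xi>\<^sub>2_def)

lemma xi_left:
  "-1 \<le> x \<Longrightarrow> x \<le> 0 \<Longrightarrow> \<xi>\<^sub>1 x = 1 - 3 * x^2 - 2 * x^3"
  "-1 \<le> x \<Longrightarrow> x \<le> 0 \<Longrightarrow> \<xi>\<^sub>2 x = x + 2 * x^2 + x^3"
  by (simp_all add: \<xi>\<^sub>1_def \<xi>\<^sub>2_def power2_eq_square power3_eq_cube algebra_simps)

lemma xi_right:
  "0 \<le> x \<Longrightarrow> x \<le> 1 \<Longrightarrow> \<xi>\<^sub>1 x = 1 - 3 * x^2 + 2 * x^3"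
  "0 \<le> x \<Longrightarrow> x \<le> 1 \<Longrightarrow> \<xi>\<^sub>2 x = x - 2 * x^2 + x^3"
  by (cases "x = 0"; simp add: \<xi>\<^sub>1_def \<xi>\<^sub>2_def power2_eq_square power3_eq_cube algebra_simps)+

text \<open>The coefficients are read off the jumps of the second and third derivatives at the knots.\<close>

lemma xi_truncated_powers:
  "\<xi>\<^sub>1 x = 3 * (max 0 (x + 1))\<^sup>2 - 2 * (max 0 (x + 1)) ^ 3 + 4 * (max 0 x) ^ 3
     - 3 * (max 0 (x - 1))\<^sup>2 - 2 * (max 0 (x - 1)) ^ 3"
  "\<xi>\<^sub>2 x = (max 0 (x + 1)) ^ 3 - (max 0 (x + 1))\<^sup>2 - 4 * (max 0 x)\<^sup>2
     - (max 0 (x - 1))\<^sup>2 - (max 0 (x - 1)) ^ 3"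
proof -
  consider "x \<le> -1" | "-1 \<le> x" "x \<le> 0" | "0 \<le> x" "x \<le> 1" | "1 \<le> x"
    by linarith
  note cs = this
  show "\<xi>\<^sub>1 x = 3 * (max 0 (x + 1))\<^sup>2 - 2 * (max 0 (x + 1)) ^ 3 + 4 * (max 0 x) ^ 3
     - 3 * (max 0 (x - 1))\<^sup>2 - 2 * (max 0 (x - 1)) ^ 3"
    by (cases rule: cs) (simp_all add: xi_out xi_left xi_right max_absorb2 max_absorb1,
        simp_all add: power2_eq_square power3_eq_cube algebra_simps)
  show "\<xi>\<^sub>2 x = (max 0 (x + 1)) ^ 3 - (max 0 (x + 1))\<^sup>2 - 4 * (max 0 x)\<^sup>2
     - (max 0 (x - 1))\<^sup>2 - (max 0 (x - 1)) ^ 3"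
    by (cases rule: cs) (simp_all add: xi_out xi_left xi_right max_absorb2 max_absorb1,
        simp_all add: power2_eq_square power3_eq_cube algebra_simps)
qed

lemma xi_c1: "\<xi>\<^sub>1 \<in> c1" "\<xi>\<^sub>2 \<in> c1"
proof -
  let ?q = "\<lambda>x::real. (max 0 x)\<^sup>2" and ?c = "\<lambda>x::real. (max 0 x) ^ 3"
  note aff = c1_affine[OF pos_part_c1(1), of _ 1] c1_affine[OF pos_part_c1(2), of _ 1]
  have eq1: "\<xi>\<^sub>1 = (\<lambda>x. 3 * ?q (1 * x + 1)) + (\<lambda>x. (- 2) * ?c (1 * x + 1)) + (\<lambda>x. 4 * ?c (1 * x + 0))
     + (\<lambda>x. (- 3) * ?q (1 * x + (- 1))) + (\<lambda>x. (- 2) * ?c (1 * x + (- 1)))"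
    by (auto simp: fun_eq_iff xi_truncated_powers)
  show "\<xi>\<^sub>1 \<in> c1"
    by (subst eq1) (intro c1_add aff)
  have eq2: "\<xi>\<^sub>2 = (\<lambda>x. 1 * ?c (1 * x + 1)) + (\<lambda>x. (- 1) * ?q (1 * x + 1)) + (\<lambda>x. (- 4) * ?q (1 * x + 0))
     + (\<lambda>x. (- 1) * ?q (1 * x + (- 1))) + (\<lambda>x. (- 1) * ?c (1 * x + (- 1)))"
    by (auto simp: fun_eq_iff xi_truncated_powers)
  show "\<xi>\<^sub>2 \<in> c1"
    by (subst eq2) (intro c1_add aff)
qed

lemma xi_supp: "\<xi>\<^sub>1 \<in> supp_in (-1) 1" "\<xi>\<^sub>2 \<in> supp_in (-1) 1"
  by (auto simp: supp_in_def \<xi>\<^sub>1_def \<xi>\<^sub>2_def)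

lemma xi_splines: "\<xi>\<^sub>1 \<in> splines 0" "\<xi>\<^sub>2 \<in> splines 0"
proof -
  have cases: "i \<le> -2 \<or> i = -1 \<or> i = 0 \<or> i \<ge> 1" for i :: int
    by linarith
  have z: "\<xi>\<^sub>1 x = 0 \<and> \<xi>\<^sub>2 x = 0" if "i \<le> -2 \<or> i \<ge> 1" "x \<in> {of_int i..of_int (i + 1)}" for x and i :: int
  proof -
    have "x \<le> -1 \<or> x \<ge> 1"
    proof (cases "i \<le> -2")
      case True
      then have "of_int (i + 1) \<le> (-1 :: real)" by linarith
      then show ?thesis using that(2) by auto
    next
      case False
      then have "of_int i \<ge> (1 :: real)" using that by simp
      then show ?thesis using that(2) by auto
    qed
    then show ?thesis
      by (auto simp: \<xi>\<^sub>1_def \<xi>\<^sub>2_def)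
  qed
  have "\<exists>p :: real poly. degree p \<le> 3 \<and> (\<forall>x\<in>{of_int i..of_int (i + 1)}. \<xi>\<^sub>1 x = poly p x)" for i
    using cases[of i]
  proof (elim disjE)
    assume "i = -1"
    then show ?thesis
      by (intro exI[of _ "[:1, 0, -3, -2:]"]) (auto simp: xi_left xi_right power2_eq_square power3_eq_cube algebra_simps)
  next
    assume "i = 0"
    then show ?thesis
      by (intro exI[of _ "[:1, 0, -3, 2:]"]) (auto simp: xi_left xi_right power2_eq_square power3_eq_cube algebra_simps)
  qed (use z[of i] in \<open>auto intro!: exI[of _ "0 :: real poly"]\<close>)
  then show "\<xi>\<^sub>1 \<in> splines 0"
    by (auto simp: splines_def xi_c1)
  have "\<exists>p :: real poly. degree p \<le> 3 \<and> (\<forall>x\<in>{of_int i..of_int (i + 1)}. \<xi>\<^sub>2 x = poly p x)" for i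
    using cases[of i]
  proof (elim disjE)
    assume "i = -1"
    then show ?thesis
      by (intro exI[of _ "[:0, 1, 2, 1:]"]) (auto simp: xi_left xi_right power2_eq_square power3_eq_cube algebra_simps)
  next
    assume "i = 0"
    then show ?thesis
      by (intro exI[of _ "[:0, 1, -2, 1:]"]) (auto simp: xi_left xi_right power2_eq_square power3_eq_cube algebra_simps)
  qed (use z[of i] in \<open>auto intro!: exI[of _ "0 :: real poly"]\<close>)
  then show "\<xi>\<^sub>2 \<in> splines 0"
    by (auto simp: splines_def xi_c1)
qed

lemma xi_tame: "\<xi>\<^sub>1 \<in> tame" "\<xi>\<^sub>2 \<in> tame"
  using xi_splines xi_supp splines_tame by blast+

text \<open>Hermite interpolation at -1/2, 0 and 1/2: the coefficients of the first generator are
  the values there, those of the second are half the derivatives, by the chain rule.\<close>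

lemma xi_refine:
  "\<xi>\<^sub>1 x = 1/2 * \<xi>\<^sub>1 (2 * x + 1) + \<xi>\<^sub>1 (2 * x) + 1/2 * \<xi>\<^sub>1 (2 * x - 1)
     + 3/4 * \<xi>\<^sub>2 (2 * x + 1) - 3/4 * \<xi>\<^sub>2 (2 * x - 1)"
  "\<xi>\<^sub>2 x = 1/8 * \<xi>\<^sub>1 (2 * x - 1) - 1/8 * \<xi>\<^sub>1 (2 * x + 1)
     - 1/8 * \<xi>\<^sub>2 (2 * x + 1) + 1/2 * \<xi>\<^sub>2 (2 * x) - 1/8 * \<xi>\<^sub>2 (2 * x - 1)"
proof -
  consider "x < -1" | "-1 \<le> x" "x < -1/2" | "-1/2 \<le> x" "x < 0" | "0 \<le> x" "x < 1/2"
    | "1/2 \<le> x" "x < 1" | "x \<ge> 1"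
    by linarith
  note cs = this
  show "\<xi>\<^sub>1 x = 1/2 * \<xi>\<^sub>1 (2 * x + 1) + \<xi>\<^sub>1 (2 * x) + 1/2 * \<xi>\<^sub>1 (2 * x - 1)
     + 3/4 * \<xi>\<^sub>2 (2 * x + 1) - 3/4 * \<xi>\<^sub>2 (2 * x - 1)"
    by (cases rule: cs) (simp_all add: xi_out xi_left xi_right,
        simp_all add: power2_eq_square power3_eq_cube field_simps)
  show "\<xi>\<^sub>2 x = 1/8 * \<xi>\<^sub>1 (2 * x - 1) - 1/8 * \<xi>\<^sub>1 (2 * x + 1)
     - 1/8 * \<xi>\<^sub>2 (2 * x + 1) + 1/2 * \<xi>\<^sub>2 (2 * x) - 1/8 * \<xi>\<^sub>2 (2 * x - 1)"
    by (cases rule: cs) (simp_all add: xi_out xi_left xi_right,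
        simp_all add: power2_eq_square power3_eq_cube field_simps)
qed

section \<open>Inner products of Hermite functions\<close>

lemma xi_neg: "\<xi>\<^sub>1 (- x) = \<xi>\<^sub>1 x" "\<xi>\<^sub>2 (- x) = - \<xi>\<^sub>2 x"
proof -
  consider "x \<le> -1" | "-1 \<le> x" "x \<le> 0" | "0 \<le> x" "x \<le> 1" | "1 \<le> x"
    by linarith
  then have "\<xi>\<^sub>1 (- x) = \<xi>\<^sub>1 x \<and> \<xi>\<^sub>2 (- x) = - \<xi>\<^sub>2 x"
    by cases (simp_all add: xi_out xi_left xi_right)
  then show "\<xi>\<^sub>1 (- x) = \<xi>\<^sub>1 x" "\<xi>\<^sub>2 (- x) = - \<xi>\<^sub>2 x"
    by auto
qed

text \<open>Reflection turns the integral of an even times an odd function into its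
  negative.\<close>

lemma ip_xi1_xi2: "ip \<xi>\<^sub>1 \<xi>\<^sub>2 = 0"
proof -
  have "ip \<xi>\<^sub>1 \<xi>\<^sub>2 = ip (\<lambda>x. 1 * \<xi>\<^sub>1 (0 + -1 * x)) (\<lambda>x. 1 * \<xi>\<^sub>2 (0 + -1 * x))"
    by (rule ip_affine[symmetric]) auto
  also have "\<dots> = - ip \<xi>\<^sub>1 \<xi>\<^sub>2"
    by (simp add: ip_eq xi_neg)
  finally show ?thesis by simp
qed

text \<open>The product of a Hermite function with its right neighbour starts in degree two, because
  the neighbour has a double zero at 0.\<close>

lemma ip_sextic_unit_interval:
  assumes "\<And>x. f x * g x = (a2 * x^2 + a3 * x^3 + a4 * x^4 + a5 * x^5 + a6 * x^6) * indicator {0..1} x"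
  shows "ip f g = a2 / 3 + a3 / 4 + a4 / 5 + a5 / 6 + a6 / 7"
proof -
  let ?F = "\<lambda>x::real. a2 * x^3 / 3 + a3 * x^4 / 4 + a4 * x^5 / 5 + a5 * x^6 / 6 + a6 * x^7 / 7"
  have "ip f g = (\<integral>x. (a2 * x^2 + a3 * x^3 + a4 * x^4 + a5 * x^5 + a6 * x^6) * indicator {0..1} x \<partial>lborel)"
    unfolding ip_eq assms ..
  also have "\<dots> = ?F 1 - ?F 0"
    by (rule integral_FTC_Icc_real) (auto intro!: derivative_eq_intros continuous_intros)
  finally show ?thesis by simp
qed

text \<open>The coupling entries of the cubic Hermite mass matrix of the unit interval, with their
  usual denominator 420.\<close>

lemma ip_xi_overlap:
  "ip \<xi>\<^sub>1 (sh 1 \<xi>\<^sub>1) = 54 / 420" "ip \<xi>\<^sub>1 (sh 1 \<xi>\<^sub>2) = - 13 / 420"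
  "ip \<xi>\<^sub>2 (sh 1 \<xi>\<^sub>1) = 13 / 420" "ip \<xi>\<^sub>2 (sh 1 \<xi>\<^sub>2) = - 3 / 420"
proof -
  have in01: "\<xi>\<^sub>1 x = 1 - 3 * x^2 + 2 * x^3" "\<xi>\<^sub>2 x = x - 2 * x^2 + x^3"
    "\<xi>\<^sub>1 (x - 1) = 3 * x^2 - 2 * x^3" "\<xi>\<^sub>2 (x - 1) = x^3 - x^2" if "x \<in> {0..1}" for x
    using that
    by (simp_all add: xi_right xi_left, simp_all add: power2_eq_square power3_eq_cube algebra_simps)
  have out: "\<xi>\<^sub>1 x * h (x - 1) = 0" "\<xi>\<^sub>2 x * h (x - 1) = 0"
    if "x \<notin> {0..1}" "h = \<xi>\<^sub>1 \<or> h = \<xi>\<^sub>2" for x h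
  proof -
    have "x - 1 \<le> -1 \<or> 1 \<le> x" using that(1) by auto
    then show "\<xi>\<^sub>1 x * h (x - 1) = 0" "\<xi>\<^sub>2 x * h (x - 1) = 0"
      using that(2) xi_out by auto
  qed
  have "\<xi>\<^sub>1 x * sh 1 \<xi>\<^sub>1 x = (3 * x^2 + (-2) * x^3 + (-9) * x^4 + 12 * x^5 + (-4) * x^6) * indicator {0..1} x" for x
  proof (cases "x \<in> {0..1}")
    case True
    then show ?thesis
      by (simp add: sh_def in01 power2_eq_square power3_eq_cube) algebra
  qed (use out in \<open>simp add: sh_def\<close>)
  from ip_sextic_unit_interval[OF this] show "ip \<xi>\<^sub>1 (sh 1 \<xi>\<^sub>1) = 54 / 420" by simp
  have "\<xi>\<^sub>1 x * sh 1 \<xi>\<^sub>2 x = ((-1) * x^2 + 1 * x^3 + 3 * x^4 + (-5) * x^5 + 2 * x^6) * indicator {0..1} x" for x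
  proof (cases "x \<in> {0..1}")
    case True
    then show ?thesis
      by (simp add: sh_def in01 power2_eq_square power3_eq_cube) algebra
  qed (use out in \<open>simp add: sh_def\<close>)
  from ip_sextic_unit_interval[OF this] show "ip \<xi>\<^sub>1 (sh 1 \<xi>\<^sub>2) = - 13 / 420" by simp
  have "\<xi>\<^sub>2 x * sh 1 \<xi>\<^sub>1 x = (0 * x^2 + 3 * x^3 + (-8) * x^4 + 7 * x^5 + (-2) * x^6) * indicator {0..1} x" for x
  proof (cases "x \<in> {0..1}")
    case True
    then show ?thesis
      by (simp add: sh_def in01 power2_eq_square power3_eq_cube) algebra
  qed (use out in \<open>simp add: sh_def\<close>)
  from ip_sextic_unit_interval[OF this] show "ip \<xi>\<^sub>2 (sh 1 \<xi>\<^sub>1) = 13 / 420" by simp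
  have "\<xi>\<^sub>2 x * sh 1 \<xi>\<^sub>2 x = (0 * x^2 + (-1) * x^3 + 3 * x^4 + (-3) * x^5 + 1 * x^6) * indicator {0..1} x" for x
  proof (cases "x \<in> {0..1}")
    case True
    then show ?thesis
      by (simp add: sh_def in01 power2_eq_square power3_eq_cube) algebra
  qed (use out in \<open>simp add: sh_def\<close>)
  from ip_sextic_unit_interval[OF this] show "ip \<xi>\<^sub>2 (sh 1 \<xi>\<^sub>2) = - 3 / 420" by simp
qed

text \<open>The determinant \<open>54 * 3 - 13 * 13\<close> is not 0. Hence a combination at one
  knot is determined by its inner products with the two functions at the next knot.\<close>

lemma xi_combination_zero:
  assumes "ip (fscale a \<xi>\<^sub>1 + fscale b \<xi>\<^sub>2) (sh 1 \<xi>\<^sub>1) = 0" "ip (fscale a \<xi>\<^sub>1 + fscale b \<xi>\<^sub>2) (sh 1 \<xi>\<^sub>2) = 0"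
  shows "a = 0" "b = 0"
proof -
  have "54 * a + 13 * b = 0" "13 * a + 3 * b = 0"
    using assms by (simp_all add: ip_linear xi_tame tame_scale tame_sh ip_xi_overlap)
  then show "a = 0" "b = 0" by auto
qed

section \<open>Partition of unity and interpolation of cubics\<close>

lemma xi_partition_of_unity: "0 \<le> x \<Longrightarrow> x \<le> 1 \<Longrightarrow> \<xi>\<^sub>1 x + \<xi>\<^sub>1 (x - 1) = 1"
  by (simp add: xi_right xi_left, simp add: power2_eq_square power3_eq_cube algebra_simps)

lemma xi1_nonneg: "0 \<le> \<xi>\<^sub>1 x"
  by (auto simp: \<xi>\<^sub>1_def)

text \<open>A cubic is determined by its values and derivatives at two points; \<open>r'\<close> is
  the derivative of \<open>r\<close>.\<close>

lemma cubic_interpolation: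
  fixes c0 c1 c2 c3 :: real
  defines "r \<equiv> \<lambda>y. c0 + c1 * y + c2 * y^2 + c3 * y^3" and "r' \<equiv> \<lambda>y. c1 + 2 * c2 * y + 3 * c3 * y^2"
  assumes "i \<le> y" "y \<le> i + 1"
  shows "r y = r i * \<xi>\<^sub>1 (y - i) + r' i * \<xi>\<^sub>2 (y - i) + r (i + 1) * \<xi>\<^sub>1 (y - (i + 1)) + r' (i + 1) * \<xi>\<^sub>2 (y - (i + 1))"
proof -
  define t where "t = y - i"
  have y: "y = i + t" by (simp add: t_def)
  have t: "0 \<le> t" "t \<le> 1" using assms(3,4) by (auto simp: t_def)
  have "\<xi>\<^sub>1 t = 1 - 3 * t^2 + 2 * t^3" "\<xi>\<^sub>2 t = t - 2 * t^2 + t^3"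
    using t by (simp_all add: xi_right)
  moreover have "\<xi>\<^sub>1 (t - 1) = 3 * t^2 - 2 * t^3" "\<xi>\<^sub>2 (t - 1) = t^3 - t^2"
    using t by (simp_all add: xi_left, simp_all add: power2_eq_square power3_eq_cube algebra_simps)
  moreover have "y - i = t" "y - (i + 1) = t - 1"
    by (auto simp: t_def)
  moreover have "r (i + t) = r i * (1 - 3 * t^2 + 2 * t^3) + r' i * (t - 2 * t^2 + t^3)
      + r (i + 1) * (3 * t^2 - 2 * t^3) + r' (i + 1) * (t^3 - t^2)"
    unfolding r_def r'_def by algebra
  ultimately show ?thesis
    by (simp add: y)
qed

lemma cubic_interpolation_global:
  fixes c0 c1 c2 c3 :: real
  defines "r \<equiv> \<lambda>y. c0 + c1 * y + c2 * y^2 + c3 * y^3" and "r' \<equiv> \<lambda>y. c1 + 2 * c2 * y + 3 * c3 * y^2"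
  assumes "-2 \<le> y" "y \<le> 2"
  shows "r y = (\<Sum>k\<in>{-2,-1,0,1,2::int}. r (of_int k) * \<xi>\<^sub>1 (y - of_int k) + r' (of_int k) * \<xi>\<^sub>2 (y - of_int k))"
proof -
  consider "-2 \<le> y" "y \<le> -1" | "-1 \<le> y" "y \<le> 0" | "0 \<le> y" "y \<le> 1" | "1 \<le> y" "y \<le> 2"
    using assms(3,4) by linarith
  then show ?thesis
  proof cases
    case 1
    then show ?thesis
      using cubic_interpolation[of "-2" y c0 c1 c2 c3] by (simp add: r_def r'_def xi_out)
  next
    case 2
    then show ?thesis
      using cubic_interpolation[of "-1" y c0 c1 c2 c3] by (simp add: r_def r'_def xi_out)
  next
    case 3
    then show ?thesis
      using cubic_interpolation[of "0" y c0 c1 c2 c3] by (simp add: r_def r'_def xi_out)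
  next
    case 4
    then show ?thesis
      using cubic_interpolation[of "1" y c0 c1 c2 c3] by (simp add: r_def r'_def xi_out)
  qed
qed

section \<open>Hermite functions of levels one and two\<close>

lemma xi_1_eq: "\<xi> 1 n = D (sh (n div 2) (if even n then \<xi>\<^sub>1 else \<xi>\<^sub>2))"
  unfolding \<xi>_def by (rule dil_eq)

lemma xi_1_even: "\<xi> 1 (2 * k) = D (sh k \<xi>\<^sub>1)" and xi_1_odd: "\<xi> 1 (2 * k + 1) = D (sh k \<xi>\<^sub>2)"
  by (simp_all add: xi_1_eq)

lemma xi_2_eq: "\<xi> 2 n = D (\<xi> 1 n)"
  unfolding xi_1_eq by (simp add: \<xi>_def dil_D dil_eq[of 2 "n div 2"])

text \<open>Level one has two knots per unit length and two functions per knot, so a unit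
  translation moves the index by 4. On level two it moves it by 8.\<close>

lemma sh_xi_1: "sh k (\<xi> 1 n) = \<xi> 1 (n + 4 * k)"
proof -
  have "even (n + 4 * k) = even n" by auto
  moreover have "(n + 4 * k) div 2 = 2 * k + n div 2" by auto
  ultimately show ?thesis
    by (simp add: xi_1_eq sh_D)
qed

lemma sh_xi_2: "sh k (\<xi> 2 n) = \<xi> 2 (n + 8 * k)"
  by (simp add: xi_2_eq sh_D sh_xi_1)

lemma xi_1_splines: "\<xi> 1 n \<in> splines 1"
  using splines_dil[of _ 0 1] xi_splines by (auto simp: \<xi>_def)

lemma xi_2_splines: "\<xi> 2 n \<in> splines 2"
  using splines_dil[OF xi_1_splines, of 1 0] by (simp add: xi_2_eq one_add_one)

lemma xi_1_supp:
  assumes "2 * a + 1 \<le> of_int (n div 2)" "of_int (n div 2) \<le> 2 * b - 1"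
  shows "\<xi> 1 n \<in> supp_in a b"
proof -
  have "\<xi> 1 n \<in> supp_in ((-1 + of_int (n div 2)) / 2 ^ 1) ((1 + of_int (n div 2)) / 2 ^ 1)"
    unfolding \<xi>_def by (rule supp_in_dil) (use xi_supp in auto)
  then show ?thesis
    by (rule supp_in_mono) (use assms in auto)
qed

lemma xi_2_supp:
  assumes "4 * a + 1 \<le> of_int (n div 2)" "of_int (n div 2) \<le> 4 * b - 1"
  shows "\<xi> 2 n \<in> supp_in a b"
proof -
  have "\<xi> 2 n \<in> supp_in ((-1 + of_int (n div 2)) / 2 ^ 2) ((1 + of_int (n div 2)) / 2 ^ 2)"
    unfolding \<xi>_def by (rule supp_in_dil) (use xi_supp in auto)
  then show ?thesis
    by (rule supp_in_mono) (use assms in auto)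
qed

lemma xi_1_tame: "\<xi> 1 n \<in> tame"
  using xi_tame by (auto simp: \<xi>_def)

lemma xi_2_tame: "\<xi> 2 n \<in> tame"
  using xi_tame by (auto simp: \<xi>_def)

text \<open>The knot \<open>n div 2\<close> of level one is the knot \<open>2 * (n div 2)\<close> of
  level two. Together with its two neighbours it accounts for the six indices.\<close>

lemma xi_1_span_xi_2: "\<xi> 1 n \<in> fun_vs.span (\<xi> 2 ` {4 * (n div 2) - 2..4 * (n div 2) + 3})"
proof -
  have base: "f \<in> fun_vs.span (\<xi> 1 ` {-2..3})" if "f = \<xi>\<^sub>1 \<or> f = \<xi>\<^sub>2" for f
  proof -
    have in_span: "fscale c (D (sh k \<xi>\<^sub>1)) \<in> fun_vs.span (\<xi> 1 ` {-2..3})"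
      "fscale c (D (sh k \<xi>\<^sub>2)) \<in> fun_vs.span (\<xi> 1 ` {-2..3})" if "k \<in> {-1, 0, 1}" for c k
      using that unfolding xi_1_even[symmetric] xi_1_odd[symmetric]
      by (intro fun_vs.span_scale; auto intro!: fun_vs.span_base imageI)+
    \<comment> \<open>The divisions by \<open>sqrt 2\<close> undo the normalization in
      \<open>D\<close>.\<close>
    have s: "sqrt 2 \<noteq> 0" "2 powr (1/2) = sqrt 2" by (auto simp: powr_half_sqrt)
    have "\<xi>\<^sub>1 = fscale (1/2 / sqrt 2) (D (sh (-1) \<xi>\<^sub>1)) + fscale (1 / sqrt 2) (D (sh 0 \<xi>\<^sub>1))
        + fscale (1/2 / sqrt 2) (D (sh 1 \<xi>\<^sub>1)) + fscale (3/4 / sqrt 2) (D (sh (-1) \<xi>\<^sub>2))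
        + fscale (- 3/4 / sqrt 2) (D (sh 1 \<xi>\<^sub>2))"
      by (rule ext, subst xi_refine) (simp add: dil_def sh_def s)
    then have "\<xi>\<^sub>1 \<in> fun_vs.span (\<xi> 1 ` {-2..3})"
      by (rule ssubst) (intro fun_vs.span_add in_span; simp)
    moreover have "\<xi>\<^sub>2 = fscale (-1/8 / sqrt 2) (D (sh (-1) \<xi>\<^sub>1)) + fscale (1/8 / sqrt 2) (D (sh 1 \<xi>\<^sub>1))
        + fscale (-1/8 / sqrt 2) (D (sh (-1) \<xi>\<^sub>2)) + fscale (1/2 / sqrt 2) (D (sh 0 \<xi>\<^sub>2))
        + fscale (-1/8 / sqrt 2) (D (sh 1 \<xi>\<^sub>2))"
      by (rule ext, subst xi_refine) (simp add: dil_def sh_def s)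
    then have "\<xi>\<^sub>2 \<in> fun_vs.span (\<xi> 1 ` {-2..3})"
      by (rule ssubst) (intro fun_vs.span_add in_span; simp)
    ultimately show ?thesis using that by auto
  qed
  show ?thesis
    unfolding xi_1_eq
  proof (rule dil_span[OF sh_span[OF base]])
    fix s assume "s \<in> \<xi> 1 ` {-2..3}"
    then obtain m where m: "m \<in> {-2..3}" "s = \<xi> 1 m" by blast
    then show "sh (n div 2) s \<in> fun_vs.span (\<xi> 1 ` {4 * (n div 2) - 2..4 * (n div 2) + 3})"
      by (auto simp: sh_xi_1 intro!: fun_vs.span_base imageI)
  next
    fix s assume "s \<in> \<xi> 1 ` {4 * (n div 2) - 2..4 * (n div 2) + 3}"
    then show "D s \<in> fun_vs.span (\<xi> 2 ` {4 * (n div 2) - 2..4 * (n div 2) + 3})"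
      by (auto simp: xi_2_eq intro!: fun_vs.span_base)
  qed auto
qed

lemma splines_ip_self_zero: "f \<in> splines m \<Longrightarrow> f \<in> tame \<Longrightarrow> ip f f = 0 \<Longrightarrow> f = 0"
  by (rule ip_self_zero[OF _ _ c1_continuous]) (auto dest: subsetD[OF splines_c1])

subsection \<open>The scaling functions\<close>

text \<open>Up to multiples of \<open>\<phi> 5\<close>, the restrictions of \<open>\<phi> 5\<close>
  and \<open>\<phi> 6\<close> to each of the two unit intervals of their support are multiples of
  such residuals of cut Hermite functions. In this form the condition on \<open>W\<close> applies to
  them.\<close>

definition orth_rest :: "(nat \<Rightarrow> real \<Rightarrow> real) \<Rightarrow> (real \<Rightarrow> real) \<Rightarrow> real \<Rightarrow> real" where
  "orth_rest \<phi> f = f - (\<Sum>i=1..4. fscale (ip f (\<phi> i)) (\<phi> i))"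

lemma ip_orth_rest:
  assumes "f \<in> tame" "h \<in> tame" "\<And>i. i \<in> {1..4} \<Longrightarrow> \<phi> i \<in> tame"
  shows "ip (orth_rest \<phi> f) h = ip f h - (\<Sum>i=1..4. ip f (\<phi> i) * ip (\<phi> i) h)"
proof -
  have "ip (\<Sum>i=1..4. fscale (ip f (\<phi> i)) (\<phi> i)) h = (\<Sum>i=1..4. ip (fscale (ip f (\<phi> i)) (\<phi> i)) h)"
    by (intro ip_sum_left tame_scale assms)
  moreover have "(\<Sum>i=1..4. fscale (ip f (\<phi> i)) (\<phi> i)) \<in> tame"
    by (intro tame_sum tame_scale assms)
  ultimately show ?thesis
    unfolding orth_rest_def using assms(1,2) by (simp add: ip_diff_left ip_scale_left)
qed

lemma orth_rest_orth:
  assumes "f \<in> tame" "\<And>i. i \<in> {1..4} \<Longrightarrow> \<phi> i \<in> tame"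
    and "\<And>i j. i \<in> {1..4} \<Longrightarrow> j \<in> {1..4} \<Longrightarrow> ip (\<phi> i) (\<phi> j) = (if i = j then 1 else 0)"
    and "j \<in> {1..4}"
  shows "ip (orth_rest \<phi> f) (\<phi> j) = 0"
proof -
  have "ip (orth_rest \<phi> f) (\<phi> j) = ip f (\<phi> j) - (\<Sum>i=1..4. ip f (\<phi> i) * ip (\<phi> i) (\<phi> j))"
    using assms by (intro ip_orth_rest) auto
  also have "(\<Sum>i=1..4. ip f (\<phi> i) * ip (\<phi> i) (\<phi> j)) = (\<Sum>i=1..4. if i = j then ip f (\<phi> j) else 0)"
    using assms(3,4) by (intro sum.cong) auto
  also have "\<dots> = ip f (\<phi> j)"
    using assms(4) by (simp add: sum.delta)
  finally show ?thesis by simp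
qed

lemma ip_cut01_left: "g \<in> supp_in 0 1 \<Longrightarrow> ip (cut01 f) g = ip f g"
proof -
  assume g: "g \<in> supp_in 0 1"
  have "cut01 f x * g x = f x * g x" for x
    using supp_inD[OF g, of x] by (cases "x < 0"; cases "1 < x"; simp add: cut01_def)
  then show ?thesis by (simp only: ip_eq)
qed

lemma ip_cut01_both:
  assumes "f \<in> supp_in a 1" "g \<in> supp_in 0 b"
  shows "ip (cut01 f) (cut01 g) = ip f g"
proof -
  have "cut01 f x * cut01 g x = f x * g x" for x
    using supp_inD[OF assms(1), of x] supp_inD[OF assms(2), of x]
    by (cases "x < 0"; cases "1 < x"; simp add: cut01_def)
  then show ?thesis by (simp only: ip_eq)
qed

lemma orthonormal_basis2D:
  assumes "orthonormal_basis2 f g V"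
  shows "ip f f = 1" "ip g g = 1" "ip f g = 0" "ip g f = 0" "f \<in> V" "g \<in> V" "V = fun_vs.span {f, g}"
  using assms by (auto simp: orthonormal_basis2_def ip_commute[of g f] intro: fun_vs.span_base)

text \<open>Orthogonality of the residual to \<open>u\<close> and \<open>v\<close> forces both
  coefficients, so the definite description is unambiguous.\<close>

lemma orth_proj_span2:
  assumes "ip u u = 1" "ip v v = 1" "ip u v = 0" "u \<in> tame" "v \<in> tame" "f \<in> tame"
  shows "orth_proj (fun_vs.span {u, v}) f = fscale (ip f u) u + fscale (ip f v) v"
  unfolding orth_proj_def
proof (rule the_equality)
  have vu: "ip v u = 0" using assms by (simp add: ip_commute)
  note t = assms(4-6) tame_add tame_scale tame_diff
  show "fscale (ip f u) u + fscale (ip f v) v \<in> fun_vs.span {u, v} \<and>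
    (\<forall>w\<in>fun_vs.span {u, v}. ip (f - (fscale (ip f u) u + fscale (ip f v) v)) w = 0)"
  proof (intro conjI ballI)
    fix w assume "w \<in> fun_vs.span {u, v}"
    then show "ip (f - (fscale (ip f u) u + fscale (ip f v) v)) w = 0"
      by (rule ip_span_zero_right) (use assms vu in \<open>auto simp: t ip_linear\<close>)
  qed (auto simp: span2_iff)
  fix p assume p: "p \<in> fun_vs.span {u, v} \<and> (\<forall>w\<in>fun_vs.span {u, v}. ip (f - p) w = 0)"
  then obtain a b where ab: "p = fscale a u + fscale b v"
    by (auto simp: span2_iff)
  have "ip (f - p) u = 0" "ip (f - p) v = 0"
    using p by (auto intro: fun_vs.span_base)
  then have "ip f u = a" "ip f v = b"
    using assms vu by (simp_all add: ab t ip_linear)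
  then show "p = fscale (ip f u) u + fscale (ip f v) v"
    by (simp add: ab)
qed

lemma sub_components_eq:
  "sub_components \<phi> m f = f - (\<Sum>i=1..m. fscale (ip f (\<phi> i)) (\<phi> i))
     - (\<Sum>i=1..m. fscale (ip f (sh (-1) (\<phi> i))) (sh (-1) (\<phi> i)))"
  by (auto simp: sub_components_def sh_def fun_eq_iff sum_fun_apply)

lemma atLeastAtMost_1_4: "{1..4::nat} = {1, 2, 3, 4}"
  by auto

lemma atLeastAtMost_1_6: "{1..6::nat} = {1, 2, 3, 4} \<union> {5, 6}"
  by auto

lemma xi_1_span_A1: "n \<in> {2, 3} \<Longrightarrow> \<xi> 1 n \<in> A1"
  using xi_1_span_xi_2[of n] by (auto simp: A1_def)

lemma A1_splines: "A1 \<subseteq> splines 2"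
  unfolding A1_def by (rule fun_vs.span_minimal[OF _ subspace_splines]) (auto simp: xi_2_splines)

lemma A1_supp: "A1 \<subseteq> supp_in 0 1"
  unfolding A1_def
proof (rule fun_vs.span_minimal[OF _ subspace_supp_in])
  show "\<xi> 2 ` {2..7} \<subseteq> supp_in 0 1"
  proof clarify
    fix n :: int assume "n \<in> {2..7}"
    then have "1 \<le> n div 2" "n div 2 \<le> 3" by auto
    then show "\<xi> 2 n \<in> supp_in 0 1" by (intro xi_2_supp) simp_all
  qed
qed

lemma A1_tame: "A1 \<subseteq> tame"
  unfolding A1_def by (rule fun_vs.span_minimal[OF _ subspace_tame]) (auto simp: xi_2_tame)

locale scaling =
  fixes \<phi> :: "nat \<Rightarrow> real \<Rightarrow> real"
  assumes scaling: "scaling_generators \<phi>"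
begin

lemma phi_1_2: "\<phi> 1 = normalize_fun (\<xi> 1 2)" "\<phi> 2 = normalize_fun (\<xi> 1 3)"
  using scaling by (auto simp: scaling_generators_def)

lemma phi_5_6: "\<phi> 5 = normalize_fun (sub_components \<phi> 4 (\<xi> 1 0))"
  "\<phi> 6 = normalize_fun (sub_components \<phi> 5 (\<xi> 1 1))"
  using scaling by (auto simp: scaling_generators_def)

lemma phi_3_4:
  "orthonormal_basis2 (\<phi> 3) (\<phi> 4) (fun_vs.span {\<phi> 3, \<phi> 4})"
  "\<phi> 3 \<in> A1" "\<phi> 4 \<in> A1"
  "\<And>g. g \<in> A0 \<Longrightarrow> ip (\<phi> 3) g = 0" "\<And>g. g \<in> A0 \<Longrightarrow> ip (\<phi> 4) g = 0"
  "\<And>f g. f \<in> C0 \<Longrightarrow> g \<in> C1 \<Longrightarrow>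
    ip (f - orth_proj (fun_vs.span {\<phi> 3, \<phi> 4}) f) (g - orth_proj (fun_vs.span {\<phi> 3, \<phi> 4}) g) = 0"
proof -
  obtain W where W: "W \<subseteq> ominus A1 A0" "orthonormal_basis2 (\<phi> 3) (\<phi> 4) W"
    "\<forall>f\<in>C0. \<forall>g\<in>C1. ip (f - orth_proj W f) (g - orth_proj W g) = 0"
    using scaling by (auto simp: scaling_generators_def)
  have eq: "W = fun_vs.span {\<phi> 3, \<phi> 4}"
    using orthonormal_basis2D(7)[OF W(2)] .
  have mem: "\<phi> 3 \<in> ominus A1 A0" "\<phi> 4 \<in> ominus A1 A0"
    using W(1) orthonormal_basis2D(5,6)[OF W(2)] by auto
  show "orthonormal_basis2 (\<phi> 3) (\<phi> 4) (fun_vs.span {\<phi> 3, \<phi> 4})"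
    using W(2) eq by simp
  show "\<phi> 3 \<in> A1" "\<phi> 4 \<in> A1"
    "\<And>g. g \<in> A0 \<Longrightarrow> ip (\<phi> 3) g = 0" "\<And>g. g \<in> A0 \<Longrightarrow> ip (\<phi> 4) g = 0"
    using mem by (auto simp: ominus_def)
  show "ip (f - orth_proj (fun_vs.span {\<phi> 3, \<phi> 4}) f) (g - orth_proj (fun_vs.span {\<phi> 3, \<phi> 4}) g) = 0"
    if "f \<in> C0" "g \<in> C1" for f g
    using W(3) that eq by blast
qed

lemma xi_1_norm_nonzero: "ip (\<xi> 1 n) (\<xi> 1 n) \<noteq> 0"
proof
  assume "ip (\<xi> 1 n) (\<xi> 1 n) = 0"
  then have z: "\<xi> 1 n = 0"
    by (rule splines_ip_self_zero[OF xi_1_splines xi_1_tame])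
  \<comment> \<open>A quarter to the right of the knot the argument of the generator is 1/2, where
    neither generator vanishes. At the knot itself the second one does.\<close>
  have "\<xi> 1 n (of_int (n div 2) / 2 + 1/4) = 0"
    unfolding z by simp
  then show False
    by (auto simp: \<xi>_def dil_def \<xi>\<^sub>1_def \<xi>\<^sub>2_def split: if_splits)
qed

lemma phi_A1: "l \<in> {1..4} \<Longrightarrow> \<phi> l \<in> A1"
proof -
  have "\<phi> 1 \<in> A1" "\<phi> 2 \<in> A1"
    using xi_1_span_A1 by (auto simp: phi_1_2 A1_def intro: normalize_fun_span)
  moreover assume "l \<in> {1..4}"
  ultimately show ?thesis
    using phi_3_4 unfolding atLeastAtMost_1_4 by auto
qed

lemma phi_A1_props:
  assumes "l \<in> {1..4}"
  shows "\<phi> l \<in> tame" "\<phi> l \<in> supp_in 0 1" "\<phi> l \<in> splines 2"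
  using phi_A1[OF assms] A1_tame A1_supp A1_splines by auto

lemma phi_orthonormal_A1:
  assumes "l \<in> {1..4}" "m \<in> {1..4}"
  shows "ip (\<phi> l) (\<phi> m) = (if l = m then 1 else 0)"
proof -
  have A0: "\<phi> 1 \<in> A0" "\<phi> 2 \<in> A0"
    by (auto simp: phi_1_2 A0_def intro!: normalize_fun_span intro: fun_vs.span_base)
  have "ip (\<xi> 1 2) (\<xi> 1 3) = 0"
    using xi_1_even[of 1] xi_1_odd[of 1] ip_xi1_xi2 by simp
  then have 12: "ip (\<phi> 1) (\<phi> 2) = 0"
    by (simp add: phi_1_2 normalize_fun_eq ip_scale_left ip_scale_right)
  have 11: "ip (\<phi> 1) (\<phi> 1) = 1" "ip (\<phi> 2) (\<phi> 2) = 1"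
    unfolding phi_1_2 by (intro ip_normalize_fun xi_1_norm_nonzero)+
  note b = orthonormal_basis2D(1-4)[OF phi_3_4(1)] phi_3_4(4)[OF A0(1)] phi_3_4(4)[OF A0(2)]
    phi_3_4(5)[OF A0(1)] phi_3_4(5)[OF A0(2)]
  show ?thesis
    using assms b 11 12 ip_commute unfolding atLeastAtMost_1_4 by auto
qed

lemma orth_rest_phi_orth: "f \<in> tame \<Longrightarrow> j \<in> {1..4} \<Longrightarrow> ip (orth_rest \<phi> f) (\<phi> j) = 0"
  by (rule orth_rest_orth) (auto simp: phi_A1_props phi_orthonormal_A1)

lemma orth_rest_tame: "f \<in> tame \<Longrightarrow> orth_rest \<phi> f \<in> tame"
  unfolding orth_rest_def by (intro tame_diff tame_sum tame_scale phi_A1_props) auto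

text \<open>The components along \<open>A0\<close> and along \<open>W\<close> can be removed one
  after the other because these spaces are orthogonal. The first removal leads into
  \<open>ominus X A0\<close>, the second is the projection occurring in the condition on
  \<open>W\<close>.\<close>

lemma orth_rest_C:
  assumes "f \<in> tame" "f \<in> X" "fun_vs.subspace X" "A0 \<subseteq> X"
  obtains f0 where "f0 \<in> ominus X A0" "orth_rest \<phi> f = f0 - orth_proj (fun_vs.span {\<phi> 3, \<phi> 4}) f0"
proof
  define f0 where "f0 = f - fscale (ip f (\<phi> 1)) (\<phi> 1) - fscale (ip f (\<phi> 2)) (\<phi> 2)"
  have i: "1 \<in> {1..4::nat}" "2 \<in> {1..4::nat}" "3 \<in> {1..4::nat}" "4 \<in> {1..4::nat}" by auto
  note t = assms(1) phi_A1_props(1)[OF i(1)] phi_A1_props(1)[OF i(2)]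
    phi_A1_props(1)[OF i(3)] phi_A1_props(1)[OF i(4)] tame_add tame_scale tame_diff
  have A0: "\<phi> 1 \<in> A0" "\<phi> 2 \<in> A0"
    by (auto simp: phi_1_2 A0_def intro!: normalize_fun_span intro: fun_vs.span_base)
  have f0: "f0 \<in> tame"
    unfolding f0_def by (intro t)
  have "f0 \<in> X"
    unfolding f0_def using A0 assms
    by (intro fun_vs.subspace_diff[OF assms(3)] fun_vs.subspace_scale[OF assms(3)]) auto
  moreover have "ip f0 g = 0" if "g \<in> A0" for g
  proof (rule ip_span_zero_right)
    show "g \<in> fun_vs.span {\<xi> 1 2, \<xi> 1 3}" using that by (simp add: A0_def)
    have "ip f0 (\<phi> 1) = 0" "ip f0 (\<phi> 2) = 0"
      unfolding f0_def using phi_orthonormal_A1[OF i(1,2)] phi_orthonormal_A1[OF i(2,1)]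
        phi_orthonormal_A1[OF i(1,1)] phi_orthonormal_A1[OF i(2,2)]
      by (simp_all add: t ip_diff_left ip_scale_left)
    then show "ip f0 h = 0" if "h \<in> {\<xi> 1 2, \<xi> 1 3}" for h
      using that span_normalize_fun[OF xi_1_norm_nonzero, of 2] span_normalize_fun[OF xi_1_norm_nonzero, of 3]
      by (metis empty_iff insertE ip_scale_right mult_zero_right phi_1_2)
  qed (use f0 in \<open>auto simp: xi_1_tame\<close>)
  ultimately show "f0 \<in> ominus X A0"
    by (auto simp: ominus_def)
  have "ip f0 (\<phi> 3) = ip f (\<phi> 3)" "ip f0 (\<phi> 4) = ip f (\<phi> 4)"
    unfolding f0_def using phi_orthonormal_A1[OF i(1,3)] phi_orthonormal_A1[OF i(2,3)]
        phi_orthonormal_A1[OF i(1,4)] phi_orthonormal_A1[OF i(2,4)]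
    by (simp_all add: t ip_diff_left ip_scale_left)
  moreover have "orth_proj (fun_vs.span {\<phi> 3, \<phi> 4}) f0 = fscale (ip f0 (\<phi> 3)) (\<phi> 3) + fscale (ip f0 (\<phi> 4)) (\<phi> 4)"
    by (rule orth_proj_span2) (use orthonormal_basis2D[OF phi_3_4(1)] in \<open>auto simp: t f0\<close>)
  ultimately show "orth_rest \<phi> f = f0 - orth_proj (fun_vs.span {\<phi> 3, \<phi> 4}) f0"
    unfolding orth_rest_def atLeastAtMost_1_4 by (simp add: f0_def algebra_simps)
qed

text \<open>The condition on \<open>W\<close>, transferred to the cut Hermite functions from which
  \<open>\<phi> 5\<close> and \<open>\<phi> 6\<close> are built.\<close>

lemma orth_rest_C0_C1:
  assumes "f \<in> {cut01 (\<xi> 1 0), cut01 (\<xi> 1 1)}" "g \<in> {cut01 (\<xi> 1 4), cut01 (\<xi> 1 5)}"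
  shows "ip (orth_rest \<phi> f) (orth_rest \<phi> g) = 0"
proof -
  have t: "f \<in> tame" "g \<in> tame"
    using assms by (auto simp: xi_1_tame)
  have "f \<in> B0" "g \<in> B1"
    using assms by (auto simp: B0_def B1_def intro: fun_vs.span_base)
  moreover have "A0 \<subseteq> B0" "A0 \<subseteq> B1"
    by (auto simp: B0_def B1_def intro: fun_vs.span_base)
  moreover have "fun_vs.subspace B0" "fun_vs.subspace B1"
    by (auto simp: B0_def B1_def)
  ultimately obtain f0 g0 where
    "f0 \<in> C0" "orth_rest \<phi> f = f0 - orth_proj (fun_vs.span {\<phi> 3, \<phi> 4}) f0"
    "g0 \<in> C1" "orth_rest \<phi> g = g0 - orth_proj (fun_vs.span {\<phi> 3, \<phi> 4}) g0"
    using orth_rest_C[OF t(1)] orth_rest_C[OF t(2)] unfolding C0_def C1_def by metis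
  then show ?thesis
    using phi_3_4(6) by simp
qed

text \<open>A continuously differentiable function supported on one side of 0 has vanishing value
  and derivative there. Hence the subtracted components are invisible in the jets of
  \<open>g5\<close> and \<open>g6\<close> at 0, apart from the multiple of \<open>\<phi> 5\<close>
  in \<open>g6\<close>.\<close>

definition flat :: "(real \<Rightarrow> real) set" where
  "flat = {f \<in> c1. f 0 = 0 \<and> deriv f 0 = 0}"

lemma subspace_flat: "fun_vs.subspace flat"
  unfolding fun_vs.subspace_def
proof (intro conjI ballI allI)
  show "0 \<in> flat"
    using c1_zero_at_end[OF c1_zero, of 0 1 0] by (auto simp: flat_def c1_zero)
qed (auto simp: flat_def c1_add c1_scale c1_deriv_add c1_deriv_scale)

lemma flat_of_supp: "f \<in> c1 \<Longrightarrow> f \<in> supp_in a b \<Longrightarrow> 0 \<le> a \<or> b \<le> 0 \<Longrightarrow> f \<in> flat"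
proof (elim disjE)
  assume f: "f \<in> c1" "f \<in> supp_in a b" and "0 \<le> a"
  then show ?thesis
    using c1_zero_at_end[OF f(1), of "-1" 0 0] supp_inD[OF f(2)] by (auto simp: flat_def)
next
  assume f: "f \<in> c1" "f \<in> supp_in a b" and "b \<le> 0"
  then show ?thesis
    using c1_zero_at_end[OF f(1), of 0 1 0] supp_inD[OF f(2)] by (auto simp: flat_def)
qed

lemma phi_A1_end:
  assumes "i \<in> {1..4}"
  shows "x \<le> 0 \<Longrightarrow> \<phi> i x = 0" "1 \<le> x \<Longrightarrow> \<phi> i x = 0"
proof -
  have c1: "\<phi> i \<in> c1" using phi_A1_props[OF assms] splines_c1 by auto
  note s = supp_inD[OF phi_A1_props(2)[OF assms]]
  show "\<phi> i x = 0" if "x \<le> 0"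
    using s[of x] c1_zero_at_end(1)[OF c1, of "-1" 0 0] s that by (cases "x = 0") auto
  show "\<phi> i x = 0" if "1 \<le> x"
    using s[of x] c1_zero_at_end(1)[OF c1, of 1 2 1] s that by (cases "x = 1") auto
qed

lemma ip_sh_phi_A1: "ip f (sh (-1) (\<phi> i)) = ip (sh 1 f) (\<phi> i)"
  using ip_sh_left[of 1 f "\<phi> i"] by simp

text \<open>On \<open>[0, 1]\<close> the components translated to \<open>[-1, 0]\<close> vanish, and
  conversely. Cutting does not alter the remaining coefficients, since each pairing takes place
  inside a single unit interval.\<close>

lemma cut01_sub_components_4:
  "cut01 (f - (\<Sum>i=1..4. fscale (ip f (\<phi> i)) (\<phi> i))
     - (\<Sum>i=1..4. fscale (ip f (sh (-1) (\<phi> i))) (sh (-1) (\<phi> i)))) = orth_rest \<phi> (cut01 f)" (is "cut01 ?g = _")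
  "cut01 (sh 1 (f - (\<Sum>i=1..4. fscale (ip f (\<phi> i)) (\<phi> i))
     - (\<Sum>i=1..4. fscale (ip f (sh (-1) (\<phi> i))) (sh (-1) (\<phi> i))))) = orth_rest \<phi> (cut01 (sh 1 f))"
proof -
  have c: "ip (cut01 h) (\<phi> i) = ip h (\<phi> i)" if "i \<in> {1..4}" for h i
    using ip_cut01_left phi_A1_props that by blast
  have cs: "(\<Sum>i=1..4. ip (cut01 h) (\<phi> i) * \<phi> i x) = (\<Sum>i=1..4. ip h (\<phi> i) * \<phi> i x)" for h x
    by (rule sum.cong) (auto simp: c)
  have s: "cut01 (\<phi> i) = \<phi> i" if "i \<in> {1..4}" for i
  proof
    show "cut01 (\<phi> i) x = \<phi> i x" for x
      using supp_inD[OF phi_A1_props(2)[OF that], of x]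
      by (cases "x < 0"; cases "1 < x"; simp add: cut01_def)
  qed
  show "cut01 ?g = orth_rest \<phi> (cut01 f)"
  proof
    fix x
    show "cut01 ?g x = orth_rest \<phi> (cut01 f) x"
    proof (cases "x \<in> {0..1}")
      case True
      then have "sh (-1) (\<phi> i) x = 0" if "i \<in> {1..4}" for i
        using phi_A1_end(2)[OF that, of "x + 1"] by (simp add: sh_def)
      then have "cut01 ?g x = f x - (\<Sum>i=1..4. ip f (\<phi> i) * \<phi> i x)"
        using True by (simp add: cut01_def sum_fun_apply)
      also have "\<dots> = orth_rest \<phi> (cut01 f) x"
        using True by (simp add: orth_rest_def sum_fun_apply cs) (simp add: cut01_def)
      finally show ?thesis .
    next
      case False
      then have "\<phi> i x = 0" if "i \<in> {1..4}" for i
        using supp_inD[OF phi_A1_props(2)[OF that]] by auto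
      then show ?thesis
        using False by (simp add: cut01_def orth_rest_def sum_fun_apply)
    qed
  qed
  show "cut01 (sh 1 ?g) = orth_rest \<phi> (cut01 (sh 1 f))"
  proof
    fix x
    show "cut01 (sh 1 ?g) x = orth_rest \<phi> (cut01 (sh 1 f)) x"
    proof (cases "x \<in> {0..1}")
      case True
      then have z: "\<phi> i (x - 1) = 0" if "i \<in> {1..4}" for i
        using phi_A1_end(1)[OF that, of "x - 1"] by simp
      have "cut01 (sh 1 ?g) x = f (x - 1) - (\<Sum>i=1..4. ip (sh 1 f) (\<phi> i) * \<phi> i x)"
      proof -
        have "cut01 (sh 1 ?g) x = ?g (x - 1)"
          using True by (simp only: cut01_def sh_def) simp
        also have "\<dots> = f (x - 1) - (\<Sum>i=1..4. ip f (\<phi> i) * \<phi> i (x - 1))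
            - (\<Sum>i=1..4. ip f (sh (-1) (\<phi> i)) * sh (-1) (\<phi> i) (x - 1))"
          by (simp add: sum_fun_apply)
        also have "(\<Sum>i=1..4. ip f (\<phi> i) * \<phi> i (x - 1)) = 0"
          using z by (intro sum.neutral) auto
        also have "(\<Sum>i=1..4. ip f (sh (-1) (\<phi> i)) * sh (-1) (\<phi> i) (x - 1)) = (\<Sum>i=1..4. ip (sh 1 f) (\<phi> i) * \<phi> i x)"
          by (intro sum.cong refl) (simp only: ip_sh_phi_A1, simp add: sh_def[of "-1"])
        finally show ?thesis by (simp only: diff_zero)
      qed
      also have "\<dots> = orth_rest \<phi> (cut01 (sh 1 f)) x"
        using True by (simp add: orth_rest_def sum_fun_apply cs) (simp add: cut01_def sh_def)
      finally show ?thesis .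
    next
      case False
      then have "\<phi> i x = 0" if "i \<in> {1..4}" for i
        using supp_inD[OF phi_A1_props(2)[OF that]] by auto
      then show ?thesis
        using False by (simp add: cut01_def orth_rest_def sum_fun_apply)
    qed
  qed
qed

section \<open>The outer generators \<open>\<phi> 5\<close> and \<open>\<phi> 6\<close>\<close>

definition g5 :: "real \<Rightarrow> real" where "g5 = sub_components \<phi> 4 (\<xi> 1 0)"

definition g6 :: "real \<Rightarrow> real" where "g6 = sub_components \<phi> 5 (\<xi> 1 1)"

lemma cut01_g5:
  "cut01 g5 = orth_rest \<phi> (cut01 (\<xi> 1 0))" "cut01 (sh 1 g5) = orth_rest \<phi> (cut01 (\<xi> 1 4))"
  using cut01_sub_components_4[of "\<xi> 1 0"] by (simp_all add: g5_def sub_components_eq sh_xi_1)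

text \<open>The index range covers the knots -3/4, ..., 3/4, that is, the level-two functions
  supported in \<open>[-1, 1]\<close>.\<close>

lemma span_xi_2_props:
  "fun_vs.span (\<xi> 2 ` {-6..7}) \<subseteq> tame" "fun_vs.span (\<xi> 2 ` {-6..7}) \<subseteq> splines 2"
  "fun_vs.span (\<xi> 2 ` {-6..7}) \<subseteq> supp_in (-1) 1"
proof -
  show "fun_vs.span (\<xi> 2 ` {-6..7}) \<subseteq> tame"
    by (rule fun_vs.span_minimal[OF _ subspace_tame]) (auto simp: xi_2_tame)
  show "fun_vs.span (\<xi> 2 ` {-6..7}) \<subseteq> splines 2"
    by (rule fun_vs.span_minimal[OF _ subspace_splines]) (auto simp: xi_2_splines)
  show "fun_vs.span (\<xi> 2 ` {-6..7}) \<subseteq> supp_in (-1) 1"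
  proof (rule fun_vs.span_minimal[OF _ subspace_supp_in], clarify)
    fix n :: int assume "n \<in> {-6..7}"
    then have "-3 \<le> n div 2" "n div 2 \<le> 3" by auto
    then show "\<xi> 2 n \<in> supp_in (-1) 1" by (intro xi_2_supp) simp_all
  qed
qed

lemma A1_span: "f \<in> A1 \<Longrightarrow> f \<in> fun_vs.span (\<xi> 2 ` {-6..7})"
  unfolding A1_def by (erule span_superset_mono) auto

lemma sh_A1_span: "f \<in> A1 \<Longrightarrow> sh (-1) f \<in> fun_vs.span (\<xi> 2 ` {-6..7})"
  unfolding A1_def by (erule sh_span) (auto simp: sh_xi_2 intro!: fun_vs.span_base imageI)

lemma xi_1_01_span: "n \<in> {0, 1} \<Longrightarrow> \<xi> 1 n \<in> fun_vs.span (\<xi> 2 ` {-6..7})"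
  using xi_1_span_xi_2[of n] by (auto elim!: span_superset_mono)

lemma g5_span: "g5 \<in> fun_vs.span (\<xi> 2 ` {-6..7})"
  unfolding g5_def sub_components_eq
  by (intro fun_vs.span_diff fun_vs.span_sum fun_vs.span_scale xi_1_01_span A1_span sh_A1_span phi_A1) auto

lemma components_flat:
  "- (\<Sum>i=1..4. fscale (a i) (\<phi> i)) - (\<Sum>i=1..4. fscale (b i) (sh (-1) (\<phi> i))) \<in> flat"
proof (intro fun_vs.subspace_diff[OF subspace_flat] fun_vs.subspace_neg[OF subspace_flat]
    fun_vs.subspace_sum[OF subspace_flat] fun_vs.subspace_scale[OF subspace_flat])
  fix i :: nat assume i: "i \<in> {1..4}"
  show "\<phi> i \<in> flat"
    using phi_A1_props[OF i] splines_c1 flat_of_supp by blast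
  have "sh (-1) (\<phi> i) \<in> supp_in (-1) 0"
    using phi_A1_props(2)[OF i] by (rule supp_in_sh) auto
  then show "sh (-1) (\<phi> i) \<in> flat"
    using splines_sh[OF phi_A1_props(3)[OF i]] splines_c1 flat_of_supp by blast
qed

lemma g5_flat: "g5 - \<xi> 1 0 \<in> flat"
proof -
  have "g5 - \<xi> 1 0 = - (\<Sum>i=1..4. fscale (ip (\<xi> 1 0) (\<phi> i)) (\<phi> i))
      - (\<Sum>i=1..4. fscale (ip (\<xi> 1 0) (sh (-1) (\<phi> i))) (sh (-1) (\<phi> i)))"
    by (simp add: g5_def sub_components_eq)
  then show ?thesis
    by (simp only: components_flat)
qed

lemma xi_1_01_jet: "\<xi> 1 0 0 \<noteq> 0" "deriv (\<xi> 1 0) 0 = 0" "\<xi> 1 1 0 = 0" "deriv (\<xi> 1 1) 0 \<noteq> 0"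
proof -
  show "\<xi> 1 0 0 \<noteq> 0" "\<xi> 1 1 0 = 0"
    by (auto simp: \<xi>_def dil_def \<xi>\<^sub>1_def \<xi>\<^sub>2_def)
  \<comment> \<open>The derivative at 0 can be read off from the polynomial on the right of 0, since
    the difference is continuously differentiable and vanishes on \<open>(0, 1/2)\<close>.\<close>
  have jet: "deriv (\<xi> 1 n) 0 = deriv (poly p) 0" if "\<And>x. x \<in> {0<..<1/2} \<Longrightarrow> \<xi> 1 n x = poly p x" for n p
  proof -
    have c: "poly p \<in> c1" "\<xi> 1 n \<in> c1"
      using xi_1_splines splines_c1 poly_DERIV unfolding c1_def by (blast intro: continuous_intros)+
    then have "\<xi> 1 n + fscale (-1) (poly p) \<in> c1"
      by (intro c1_add c1_scale)
    then have "deriv (\<xi> 1 n + fscale (-1) (poly p)) 0 = 0"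
      by (rule c1_zero_at_end(2)[of _ 0 "1/2"]) (use that in auto)
    then have "deriv (\<xi> 1 n) 0 + (-1) * deriv (poly p) 0 = 0"
      by (simp only: c1_deriv_add c1_deriv_scale c1_scale c)
    then show ?thesis by simp
  qed
  have "\<xi> 1 0 x = poly (smult (2 powr (1/2)) [:1, 0, -12, 16:]) x"
    "\<xi> 1 1 x = poly (smult (2 powr (1/2)) [:0, 2, -8, 8:]) x" if "x \<in> {0<..<1/2}" for x
    using that by (simp_all add: \<xi>_def dil_def xi_right power2_eq_square power3_eq_cube algebra_simps)
  note j = jet[OF this(1)] jet[OF this(2)]
  show "deriv (\<xi> 1 0) 0 = 0" "deriv (\<xi> 1 1) 0 \<noteq> 0"
    using j by (simp_all add: DERIV_imp_deriv[OF poly_DERIV] pderiv_pCons)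
qed

lemma xi_1_c1: "\<xi> 1 n \<in> c1"
  using xi_1_splines splines_c1 by blast

lemma jet_mod_flat:
  assumes "h - f \<in> flat" "f \<in> c1"
  shows "h 0 = f 0" "deriv h 0 = deriv f 0"
proof -
  have h: "h = (h - f) + f" by simp
  show "h 0 = f 0" using assms by (auto simp: flat_def)
  show "deriv h 0 = deriv f 0"
    by (subst h, subst c1_deriv_add) (use assms in \<open>auto simp: flat_def\<close>)
qed

lemma g5_jet: "g5 0 \<noteq> 0" "deriv g5 0 = 0"
  using jet_mod_flat[OF g5_flat xi_1_c1] xi_1_01_jet by auto

lemma g5_norm: "ip g5 g5 \<noteq> 0"
proof
  assume "ip g5 g5 = 0"
  then have "g5 = 0"
    using splines_ip_self_zero[of g5 2] g5_span span_xi_2_props(1,2) by auto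
  then show False
    using g5_jet by simp
qed

lemma phi_5: "\<phi> 5 = fscale (1 / sqrt (ip g5 g5)) g5"
  by (simp add: phi_5_6 normalize_fun_eq g5_def)

lemma phi_5_span: "\<phi> 5 \<in> fun_vs.span (\<xi> 2 ` {-6..7})"
  unfolding phi_5 by (intro fun_vs.span_scale g5_span)

lemma phi_5_props: "\<phi> 5 \<in> tame" "\<phi> 5 \<in> splines 2" "\<phi> 5 \<in> supp_in (-1) 1"
  using phi_5_span span_xi_2_props by auto

text \<open>Thus the component along the translate of \<open>\<phi> 5\<close> drops out of
  \<open>g6\<close>. After a translation by one the two functions meet only on
  \<open>[0, 1]\<close>, where the condition on \<open>W\<close> separates them.\<close>

lemma xi_11_phi_5: "ip (\<xi> 1 1) (sh (-1) (\<phi> 5)) = 0"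
proof -
  let ?c = "cut01 (\<xi> 1 5)"
  \<comment> \<open>Since \<open>cut01 g5\<close> is orthogonal to \<open>\<phi> 1\<close>, ...,
    \<open>\<phi> 4\<close>, replacing the Hermite function by its residual does not change the
    pairing.\<close>
  have "ip (orth_rest \<phi> ?c) (cut01 g5) = ip ?c (cut01 g5) - (\<Sum>i=1..4. ip ?c (\<phi> i) * ip (\<phi> i) (cut01 g5))"
    using g5_span span_xi_2_props by (intro ip_orth_rest) (auto simp: xi_1_tame phi_A1_props)
  moreover have "ip (\<phi> i) (cut01 g5) = 0" if "i \<in> {1..4}" for i
    unfolding cut01_g5 ip_commute[of "\<phi> i"] using that
    by (intro orth_rest_phi_orth) (auto simp: xi_1_tame)
  moreover have "ip (orth_rest \<phi> ?c) (cut01 g5) = 0"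
    unfolding cut01_g5 ip_commute[of "orth_rest \<phi> ?c"] by (rule orth_rest_C0_C1) auto
  ultimately have "ip ?c (cut01 g5) = 0"
    by simp
  moreover have "ip (cut01 g5) ?c = ip g5 (\<xi> 1 5)"
  proof (rule ip_cut01_both)
    show "g5 \<in> supp_in (-1) 1" using g5_span span_xi_2_props by auto
    show "\<xi> 1 5 \<in> supp_in 0 2" by (rule xi_1_supp) auto
  qed
  ultimately have "ip g5 (\<xi> 1 5) = 0"
    by (simp add: ip_commute)
  then have "ip (\<phi> 5) (\<xi> 1 5) = 0"
    by (subst phi_5) (simp add: ip_scale_left)
  then show ?thesis
    using ip_sh_phi_A1[of "\<xi> 1 1" 5] by (simp add: sh_xi_1 ip_commute)
qed

lemma g6_eq: "g6 = \<xi> 1 1 - (\<Sum>i=1..4. fscale (ip (\<xi> 1 1) (\<phi> i)) (\<phi> i))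
     - (\<Sum>i=1..4. fscale (ip (\<xi> 1 1) (sh (-1) (\<phi> i))) (sh (-1) (\<phi> i)))
     - fscale (ip (\<xi> 1 1) (\<phi> 5)) (\<phi> 5)" (is "_ = ?g - fscale ?c _")
proof -
  have "{1..5::nat} = insert 5 {1..4}" by auto
  then show ?thesis
    by (simp add: g6_def sub_components_eq xi_11_phi_5 fun_eq_iff sum_fun_apply)
qed

lemma g6_span: "g6 \<in> fun_vs.span (\<xi> 2 ` {-6..7})"
  unfolding g6_eq
  by (intro fun_vs.span_diff fun_vs.span_sum fun_vs.span_scale xi_1_01_span A1_span sh_A1_span phi_A1 phi_5_span) auto

lemma g6_flat: "g6 - (\<xi> 1 1 - fscale (ip (\<xi> 1 1) (\<phi> 5)) (\<phi> 5)) \<in> flat"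
proof -
  have "g6 - (\<xi> 1 1 - fscale (ip (\<xi> 1 1) (\<phi> 5)) (\<phi> 5)) = - (\<Sum>i=1..4. fscale (ip (\<xi> 1 1) (\<phi> i)) (\<phi> i))
      - (\<Sum>i=1..4. fscale (ip (\<xi> 1 1) (sh (-1) (\<phi> i))) (sh (-1) (\<phi> i)))"
    by (simp add: g6_eq)
  then show ?thesis
    by (simp only: components_flat)
qed

lemma phi_5_c1: "\<phi> 5 \<in> c1"
  using phi_5_props splines_c1 by blast

lemma phi_5_jet: "\<phi> 5 0 \<noteq> 0" "deriv (\<phi> 5) 0 = 0"
proof -
  have c1: "g5 \<in> c1" using g5_span span_xi_2_props(2) splines_c1 by blast
  show "\<phi> 5 0 \<noteq> 0" "deriv (\<phi> 5) 0 = 0"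
    unfolding phi_5 c1_deriv_scale[OF c1] using g5_jet g5_norm by auto
qed

text \<open>The derivative of \<open>\<phi> 5\<close> at 0 is 0, so subtracting a multiple of
  \<open>\<phi> 5\<close> leaves the nonzero derivative of \<open>\<xi> 1 1\<close>.\<close>

lemma g6_jet: "deriv g6 0 \<noteq> 0"
proof -
  let ?c = "ip (\<xi> 1 1) (\<phi> 5)"
  have eq: "\<xi> 1 1 - fscale ?c (\<phi> 5) = \<xi> 1 1 + fscale (- ?c) (\<phi> 5)"
    by (auto simp: fun_eq_iff)
  have "\<xi> 1 1 + fscale (- ?c) (\<phi> 5) \<in> c1"
    by (intro c1_add c1_scale xi_1_c1 phi_5_c1)
  then have "deriv g6 0 = deriv (\<xi> 1 1) 0 + - ?c * deriv (\<phi> 5) 0"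
    using jet_mod_flat(2)[OF g6_flat] unfolding eq
    by (simp only: c1_deriv_add c1_deriv_scale c1_scale xi_1_c1 phi_5_c1)
  then show ?thesis
    using xi_1_01_jet by (simp add: phi_5_jet)
qed

lemma g6_norm: "ip g6 g6 \<noteq> 0"
proof
  assume "ip g6 g6 = 0"
  then have "g6 = 0"
    using splines_ip_self_zero[of g6 2] g6_span span_xi_2_props(1,2) by auto
  moreover have "deriv (0 :: real \<Rightarrow> real) 0 = 0"
    using c1_zero_at_end[OF c1_zero, of 0 1 0] by simp
  ultimately show False
    using g6_jet by simp
qed

lemma phi_6: "\<phi> 6 = fscale (1 / sqrt (ip g6 g6)) g6"
  by (simp add: phi_5_6 normalize_fun_eq g6_def)

lemma phi_outer_span: "l \<in> {5, 6} \<Longrightarrow> \<phi> l \<in> fun_vs.span (\<xi> 2 ` {-6..7})"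
  using phi_5_span phi_6 g6_span fun_vs.span_scale by (metis empty_iff insertE)

lemma phi_outer_props:
  assumes "l \<in> {5, 6}"
  shows "\<phi> l \<in> tame" "\<phi> l \<in> splines 2" "\<phi> l \<in> supp_in (-1) 1"
  using phi_outer_span[OF assms] span_xi_2_props by auto

lemma phi_6_jet: "deriv (\<phi> 6) 0 \<noteq> 0"
proof -
  have c1: "g6 \<in> c1" using g6_span span_xi_2_props(2) splines_c1 by blast
  show ?thesis
    unfolding phi_6 c1_deriv_scale[OF c1] using g6_jet g6_norm by auto
qed

lemma phi_tame: "l \<in> {1..6} \<Longrightarrow> \<phi> l \<in> tame"
  unfolding atLeastAtMost_1_6 using phi_A1_props phi_outer_props atLeastAtMost_1_4 by auto

lemma phi_splines: "l \<in> {1..6} \<Longrightarrow> \<phi> l \<in> splines 2"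
  unfolding atLeastAtMost_1_6 using phi_A1_props phi_outer_props atLeastAtMost_1_4 by auto

lemma phi_supp: "l \<in> {1..6} \<Longrightarrow> \<phi> l \<in> supp_in (-1) 1"
  using supp_in_mono[OF phi_A1_props(2), of l "-1" 1] phi_outer_props(3)[of l]
  unfolding atLeastAtMost_1_6 atLeastAtMost_1_4 by auto

text \<open>The jets at 0 form a triangular system: \<open>\<phi> 5\<close> has nonzero value and
  zero derivative, \<open>\<phi> 6\<close> has nonzero derivative. One-sided information suffices
  because both functions are continuously differentiable.\<close>

lemma phi_combination_zero:
  assumes "\<And>x. x \<in> {0<..<1} \<Longrightarrow> a * \<phi> 5 x + b * \<phi> 6 x = 0"
  shows "a = 0" "b = 0"
proof -
  let ?f = "fscale a (\<phi> 5) + fscale b (\<phi> 6)"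
  have c: "\<phi> 5 \<in> c1" "\<phi> 6 \<in> c1"
    by (rule subsetD[OF splines_c1 phi_splines]; simp)+
  then have f: "?f \<in> c1"
    by (intro c1_add c1_scale)
  have "deriv ?f 0 = 0" "?f 0 = 0"
    by (rule c1_zero_at_end[OF f, of 0 1]; use assms in simp)+
  then have "b * deriv (\<phi> 6) 0 = 0" "a * \<phi> 5 0 + b * \<phi> 6 0 = 0"
    using c by (simp_all add: c1_deriv_add c1_deriv_scale c1_scale phi_5_jet)
  then show "b = 0" "a = 0"
    using phi_6_jet phi_5_jet by auto
qed

text \<open>The right half comes from the side of \<open>C0\<close> and the left half, moved to
  \<open>[0, 1]\<close>, from the side of \<open>C1\<close>, as \<open>orth_rest_C0_C1\<close>
  requires. For \<open>\<phi> 6\<close> the additional multiple of \<open>\<phi> 5\<close> stays in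
  the same span.\<close>

lemma cut01_phi_outer:
  assumes "l \<in> {5, 6}"
  shows "cut01 (\<phi> l) \<in> fun_vs.span (orth_rest \<phi> ` {cut01 (\<xi> 1 0), cut01 (\<xi> 1 1)})"
    "cut01 (sh 1 (\<phi> l)) \<in> fun_vs.span (orth_rest \<phi> ` {cut01 (\<xi> 1 4), cut01 (\<xi> 1 5)})"
proof -
  let ?F = "fun_vs.span (orth_rest \<phi> ` {cut01 (\<xi> 1 0), cut01 (\<xi> 1 1)})"
  let ?G = "fun_vs.span (orth_rest \<phi> ` {cut01 (\<xi> 1 4), cut01 (\<xi> 1 5)})"
  have 5: "cut01 (\<phi> 5) \<in> ?F" "cut01 (sh 1 (\<phi> 5)) \<in> ?G"
    unfolding phi_5 sh_scale cut01_scale cut01_g5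
    by (auto intro: fun_vs.span_scale fun_vs.span_base)
  define g where "g = \<xi> 1 1 - (\<Sum>i=1..4. fscale (ip (\<xi> 1 1) (\<phi> i)) (\<phi> i))
     - (\<Sum>i=1..4. fscale (ip (\<xi> 1 1) (sh (-1) (\<phi> i))) (sh (-1) (\<phi> i)))"
  have g6: "g6 = g - fscale (ip (\<xi> 1 1) (\<phi> 5)) (\<phi> 5)"
    unfolding g_def by (rule g6_eq)
  have sh1: "sh 1 (\<xi> 1 1) = \<xi> 1 5"
    by (simp add: sh_xi_1)
  have "cut01 g = orth_rest \<phi> (cut01 (\<xi> 1 1))" "cut01 (sh 1 g) = orth_rest \<phi> (cut01 (\<xi> 1 5))"
    unfolding g_def cut01_sub_components_4 sh1 by (rule refl)+
  then have "cut01 g6 = orth_rest \<phi> (cut01 (\<xi> 1 1)) - fscale (ip (\<xi> 1 1) (\<phi> 5)) (cut01 (\<phi> 5))"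
    "cut01 (sh 1 g6) = orth_rest \<phi> (cut01 (\<xi> 1 5)) - fscale (ip (\<xi> 1 1) (\<phi> 5)) (cut01 (sh 1 (\<phi> 5)))"
    by (simp_all only: g6 sh_diff cut01_diff sh_scale cut01_scale)
  then have "cut01 g6 \<in> ?F" "cut01 (sh 1 g6) \<in> ?G"
    using 5 by (auto intro!: fun_vs.span_diff fun_vs.span_scale intro: fun_vs.span_base)
  then have "cut01 (\<phi> 6) \<in> ?F" "cut01 (sh 1 (\<phi> 6)) \<in> ?G"
    unfolding phi_6 sh_scale cut01_scale by (auto intro: fun_vs.span_scale)
  then show "cut01 (\<phi> l) \<in> ?F" "cut01 (sh 1 (\<phi> l)) \<in> ?G"
    using 5 assms by auto
qed

end

text \<open>The translates supported in \<open>[a, b]\<close>: inner generators occupy one unit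
  interval, whereas \<open>\<phi> 5\<close> and \<open>\<phi> 6\<close> straddle the point
  \<open>k\<close>, which must therefore lie strictly inside.\<close>

definition Tset :: "(nat \<Rightarrow> real \<Rightarrow> real) \<Rightarrow> int \<Rightarrow> int \<Rightarrow> (real \<Rightarrow> real) set" where
  "Tset \<phi> a b = {sh k (\<phi> l) | k l. (l \<in> {1..4} \<and> a \<le> k \<and> k < b) \<or> (l \<in> {5, 6} \<and> a < k \<and> k < b)}"

lemma Tset_mono: "a' \<le> a \<Longrightarrow> b \<le> b' \<Longrightarrow> Tset \<phi> a b \<subseteq> Tset \<phi> a' b'"
  by (fastforce simp: Tset_def)

lemma sh_Tset: "f \<in> Tset \<phi> a b \<Longrightarrow> sh q f \<in> Tset \<phi> (a + q) (b + q)"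
  by (fastforce simp: Tset_def)

lemma sh_Tset_span: "f \<in> fun_vs.span (Tset \<phi> a b) \<Longrightarrow> sh q f \<in> fun_vs.span (Tset \<phi> (a + q) (b + q))"
  by (erule sh_span) (auto intro: fun_vs.span_base sh_Tset)

lemma sh_D_Tset_span:
  "f \<in> fun_vs.span (D ` Tset \<phi> a b) \<Longrightarrow> sh q f \<in> fun_vs.span (D ` Tset \<phi> (a + 2 * q) (b + 2 * q))"
  by (erule sh_span) (auto simp: sh_D intro!: fun_vs.span_base sh_Tset)

lemma D_span: "f \<in> fun_vs.span S \<Longrightarrow> D f \<in> fun_vs.span (D ` S)"
  by (erule dil_span) (auto intro: fun_vs.span_base)

section \<open>Removing the last knot of a Hermite spline\<close>

lemma span_xi_2_peel:
  assumes "f \<in> fun_vs.span (\<xi> 2 ` {-6..2 * k + 1})" "-3 \<le> k"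
  obtains c d r where "f = fscale c (\<xi> 2 (2 * k)) + fscale d (\<xi> 2 (2 * k + 1)) + r"
    "r \<in> fun_vs.span (\<xi> 2 ` {-6..2 * k - 1})"
proof -
  have "{-6..2 * k + 1} = insert (2 * k) (insert (2 * k + 1) {-6..2 * k - 1})"
    using assms(2) by auto
  then obtain c d where "f - fscale c (\<xi> 2 (2 * k)) - fscale d (\<xi> 2 (2 * k + 1)) \<in> fun_vs.span (\<xi> 2 ` {-6..2 * k - 1})"
    using assms(1) by (auto simp: fun_span_insert)
  then show ?thesis
    by (rule that[of c d, rotated]) simp
qed

lemma span_xi_2_supp: "r \<in> fun_vs.span (\<xi> 2 ` {-6..2 * k - 1}) \<Longrightarrow> r \<in> supp_in (-1) (of_int k / 4)"
proof (erule span_in_subspace[OF _ _ subspace_supp_in], clarify)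
  fix n :: int assume "n \<in> {-6..2 * k - 1}"
  then have "-3 \<le> n div 2" "n div 2 \<le> k - 1" by auto
  then show "\<xi> 2 n \<in> supp_in (-1) (of_int k / 4)" by (intro xi_2_supp) simp_all
qed

lemma span_xi_2_splines: "r \<in> fun_vs.span (\<xi> 2 ` A) \<Longrightarrow> r \<in> splines 2"
  by (erule span_in_subspace[OF _ _ subspace_splines]) (auto simp: xi_2_splines)

lemma span_xi_2_tame: "r \<in> fun_vs.span (\<xi> 2 ` A) \<Longrightarrow> r \<in> tame"
  by (erule span_in_subspace[OF _ _ subspace_tame]) (auto simp: xi_2_tame)

lemma span_xi_2_zero_right:
  assumes "r \<in> fun_vs.span (\<xi> 2 ` {-6..2 * k - 1})" "of_int k / 4 \<le> x"
  shows "r x = 0"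
proof (cases "x = of_int k / 4")
  case True
  have r: "r \<in> c1" using span_xi_2_splines[OF assms(1)] splines_c1 by auto
  show ?thesis
    unfolding True
    by (rule c1_zero_at_end(1)[OF r, of "of_int k / 4" "of_int k / 4 + 1"])
      (auto intro: supp_inD[OF span_xi_2_supp[OF assms(1)]])
qed (use assms(2) in \<open>auto intro: supp_inD[OF span_xi_2_supp[OF assms(1)]]\<close>)

lemma xi_2_values:
  "\<xi> 2 (2 * k) (of_int k / 4) = 2" "\<xi> 2 (2 * k + 1) (of_int k / 4) = 0"
  "\<xi> 2 (2 * k + 1) (of_int k / 4 + 1/8) \<noteq> 0"
  by (auto simp: \<xi>_def dil_def \<xi>\<^sub>1_def \<xi>\<^sub>2_def algebra_simps)

text \<open>At the knot \<open>k / 4\<close> every spanning function except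
  \<open>\<xi> 2 (2 * k)\<close> vanishes, which gives the first coefficient. Half a mesh width
  further only the functions of this knot are left, which gives the second.\<close>

lemma span_xi_2_peel_zero:
  assumes "f \<in> fun_vs.span (\<xi> 2 ` {-6..2 * k + 1})" "-3 \<le> k"
    and "f (of_int k / 4) = 0" "f (of_int k / 4 + 1/8) = 0"
  shows "f \<in> fun_vs.span (\<xi> 2 ` {-6..2 * k - 1})"
proof -
  obtain c d r where f: "f = fscale c (\<xi> 2 (2 * k)) + fscale d (\<xi> 2 (2 * k + 1)) + r"
    and r: "r \<in> fun_vs.span (\<xi> 2 ` {-6..2 * k - 1})"
    using span_xi_2_peel[OF assms(1,2)] .
  have "c = 0"
    using assms(3) span_xi_2_zero_right[OF r, of "of_int k / 4"] by (simp add: f xi_2_values)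
  moreover have "d = 0"
    using assms(4) span_xi_2_zero_right[OF r, of "of_int k / 4 + 1/8"] xi_2_values(3)[of k]
    by (simp add: f \<open>c = 0\<close>)
  ultimately have "f = r"
    by (simp add: f fun_eq_iff)
  then show ?thesis using r by simp
qed

text \<open>Of all functions in the span only the two at the knot \<open>k / 4\<close> overlap those
  at the next knot, so \<open>xi_combination_zero\<close> applies after rescaling.\<close>

lemma span_xi_2_peel_orth:
  assumes "f \<in> fun_vs.span (\<xi> 2 ` {-6..2 * k + 1})" "-3 \<le> k"
    and "ip f (\<xi> 2 (2 * k + 2)) = 0" "ip f (\<xi> 2 (2 * k + 3)) = 0"
  shows "f \<in> fun_vs.span (\<xi> 2 ` {-6..2 * k - 1})"
proof -
  obtain c d r where f: "f = fscale c (\<xi> 2 (2 * k)) + fscale d (\<xi> 2 (2 * k + 1)) + r"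
    and r: "r \<in> fun_vs.span (\<xi> 2 ` {-6..2 * k - 1})"
    using span_xi_2_peel[OF assms(1,2)] .
  have X: "\<xi> 2 (2 * k) = D (D (sh k \<xi>\<^sub>1))" "\<xi> 2 (2 * k + 1) = D (D (sh k \<xi>\<^sub>2))"
    "\<xi> 2 (2 * k + 2) = D (D (sh k (sh 1 \<xi>\<^sub>1)))" "\<xi> 2 (2 * k + 3) = D (D (sh k (sh 1 \<xi>\<^sub>2)))"
    using xi_1_even[of k] xi_1_odd[of k] xi_1_even[of "k + 1"] xi_1_odd[of "k + 1"]
    by (simp_all add: xi_2_eq distrib_left add.commute)
  have rz: "ip r (\<xi> 2 (2 * k + 2)) = 0" "ip r (\<xi> 2 (2 * k + 3)) = 0"
    by (rule ip_disjoint(1)[OF span_xi_2_supp[OF r] _ order_refl],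
        rule xi_2_supp[where b = "of_int k / 4 + 1/2"]; simp)+
  have key: "ip f (D (D (sh k h))) = ip (fscale c \<xi>\<^sub>1 + fscale d \<xi>\<^sub>2) h + ip r (D (D (sh k h)))" if "h \<in> tame" for h
    unfolding f X using that span_xi_2_tame[OF r]
    by (simp add: ip_add_left ip_scale_left tame_add tame_scale tame_dil tame_sh xi_tame)
  have "ip (fscale c \<xi>\<^sub>1 + fscale d \<xi>\<^sub>2) (sh 1 \<xi>\<^sub>1) = 0" "ip (fscale c \<xi>\<^sub>1 + fscale d \<xi>\<^sub>2) (sh 1 \<xi>\<^sub>2) = 0"
    using assms(3,4) rz key[OF tame_sh[OF xi_tame(1)], of 1] key[OF tame_sh[OF xi_tame(2)], of 1]
    unfolding X by simp_all
  then have "c = 0" "d = 0"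
    by (rule xi_combination_zero)+
  then have "f = r"
    by (simp add: f fun_eq_iff)
  then show ?thesis using r by simp
qed

text \<open>The polynomial is interpolated at the knots -1, -1/2, ..., 1. The powers of two in
  \<open>c\<close> move these knots to the integers.\<close>

lemma cubic_eq_span_xi_1:
  fixes p :: "real poly"
  assumes "degree p < 4"
  shows "\<exists>v\<in>fun_vs.span (\<xi> 1 ` {-4..5}). \<forall>x\<in>{-1..1}. poly p x = v x"
proof -
  define c where "c i = coeff p i / 2 ^ i" for i
  define r where "r y = c 0 + c 1 * y + c 2 * y^2 + c 3 * y^3" for y
  define r' where "r' y = c 1 + 2 * c 2 * y + 3 * c 3 * y^2" for y
  have p: "poly p x = r (2 * x)" for x
  proof -
    have "degree p \<le> 3" using assms by simp
    then have "poly p x = (\<Sum>i\<le>3. coeff p i * x ^ i)"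
      unfolding poly_altdef by (intro sum.mono_neutral_left) (auto simp: coeff_eq_0)
    also have "\<dots> = r (2 * x)"
    proof -
      have "{..3::nat} = {0, 1, 2, 3}" by auto
      then show ?thesis by (simp add: r_def c_def power_mult_distrib)
    qed
    finally show ?thesis .
  qed
  define v where "v = (\<Sum>k\<in>{-2,-1,0,1,2::int}. fscale (r (of_int k) / sqrt 2) (\<xi> 1 (2 * k)) + fscale (r' (of_int k) / sqrt 2) (\<xi> 1 (2 * k + 1)))"
  have "v \<in> fun_vs.span (\<xi> 1 ` {-4..5})"
    unfolding v_def by (intro fun_vs.span_sum fun_vs.span_add fun_vs.span_scale fun_vs.span_base imageI) auto
  moreover have "poly p x = v x" if "x \<in> {-1..1}" for x
  proof -
    have "r (2 * x) = (\<Sum>k\<in>{-2,-1,0,1,2::int}. r (of_int k) * \<xi>\<^sub>1 (2 * x - of_int k) + r' (of_int k) * \<xi>\<^sub>2 (2 * x - of_int k))"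
      unfolding r_def r'_def by (rule cubic_interpolation_global) (use that in auto)
    also have "\<dots> = v x"
      unfolding v_def sum_fun_apply xi_1_even xi_1_odd
      by (intro sum.cong refl) (simp add: dil_def sh_def powr_half_sqrt)
    finally show ?thesis by (simp add: p)
  qed
  ultimately show ?thesis by blast
qed

context scaling
begin

section \<open>Orthonormality of the translates of the generators\<close>

lemma phi_inner_outer:
  assumes "l \<in> {1..4}" "m \<in> {5, 6}"
  shows "ip (\<phi> l) (sh k (\<phi> m)) = 0"
proof -
  note l = phi_A1_props[OF assms(1)] and m = phi_outer_props[OF assms(2)]
  have s: "sh k (\<phi> m) \<in> supp_in (of_int k - 1) (of_int k + 1)"
    using m(3) by (rule supp_in_sh) auto
  have z: "ip (cut01 (\<phi> m)) (\<phi> l) = 0" "ip (cut01 (sh 1 (\<phi> m))) (\<phi> l) = 0"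
    by (rule ip_span_zero_left[OF cut01_phi_outer(1)[OF assms(2)]]
          ip_span_zero_left[OF cut01_phi_outer(2)[OF assms(2)]];
        use assms l in \<open>auto intro!: orth_rest_phi_orth orth_rest_tame simp: xi_1_tame tame_cut01\<close>)+
  consider "k = 0" | "k = 1" | "k \<ge> 2" | "k \<le> -1"
    by linarith
  then show ?thesis
  proof cases
    case 1
    then show ?thesis
      using z(1) unfolding ip_cut01_left[OF l(2)] by (simp add: ip_commute)
  next
    case 2
    then show ?thesis
      using z(2) unfolding ip_cut01_left[OF l(2)] by (simp add: ip_commute)
  next
    case 3
    then show ?thesis by (intro ip_disjoint(1)[OF l(2) s]) auto
  next
    case 4
    then have "of_int k + 1 \<le> (0::real)" by linarith
    then show ?thesis by (intro ip_disjoint(2)[OF s l(2)])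
  qed
qed

text \<open>The supports meet in \<open>[0, 1]\<close>, where the first function shows its right
  half and the second its left half.\<close>

lemma phi_outer_shift:
  assumes "l \<in> {5, 6}" "m \<in> {5, 6}"
  shows "ip (\<phi> l) (sh 1 (\<phi> m)) = 0"
proof -
  note l = phi_outer_props[OF assms(1)] and m = phi_outer_props[OF assms(2)]
  have "ip (\<phi> l) (sh 1 (\<phi> m)) = ip (cut01 (\<phi> l)) (cut01 (sh 1 (\<phi> m)))"
    by (rule ip_cut01_both[symmetric, OF l(3) supp_in_sh[OF m(3), of _ _ 2]]) auto
  also have "\<dots> = 0"
    by (rule ip_span_zero[OF cut01_phi_outer(1)[OF assms(1)] cut01_phi_outer(2)[OF assms(2)]])
      (use orth_rest_C0_C1 in \<open>auto intro!: orth_rest_tame simp: xi_1_tame tame_cut01\<close>)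
  finally show ?thesis .
qed

lemma phi_5_6_orthonormal: "ip (\<phi> 5) (\<phi> 5) = 1" "ip (\<phi> 6) (\<phi> 6) = 1" "ip (\<phi> 5) (\<phi> 6) = 0"
proof -
  show 5: "ip (\<phi> 5) (\<phi> 5) = 1"
    using ip_normalize_fun[OF g5_norm] by (simp add: phi_5_6 g5_def)
  show "ip (\<phi> 6) (\<phi> 6) = 1"
    using ip_normalize_fun[OF g6_norm] by (simp add: phi_5_6 g6_def)
  have z: "ip (\<phi> i) (\<phi> 5) = 0" "ip (sh (-1) (\<phi> i)) (\<phi> 5) = 0" if "i \<in> {1..4}" for i
    using phi_inner_outer[OF that, of 5 0] phi_inner_outer[OF that, of 5 1]
    by (simp_all add: ip_sh_left)
  let ?a = "\<Sum>i=1..4. fscale (ip (\<xi> 1 1) (\<phi> i)) (\<phi> i)"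
  let ?b = "\<Sum>i=1..4. fscale (ip (\<xi> 1 1) (sh (-1) (\<phi> i))) (sh (-1) (\<phi> i))"
  have t: "\<phi> 5 \<in> tame" "?a \<in> tame" "?b \<in> tame"
    by (auto intro!: tame_sum tame_scale tame_sh phi_A1_props phi_5_props)
  have "ip ?a (\<phi> 5) = 0"
    by (subst ip_sum_left) (auto intro!: tame_scale phi_A1_props sum.neutral t simp: ip_scale_left z)
  moreover have "ip ?b (\<phi> 5) = 0"
    by (subst ip_sum_left) (auto intro!: tame_scale tame_sh phi_A1_props sum.neutral t simp: ip_scale_left z)
  ultimately have "ip g6 (\<phi> 5) = 0"
    unfolding g6_eq by (simp add: ip_diff_left ip_scale_left t tame_diff tame_scale xi_1_tame 5)
  then show "ip (\<phi> 5) (\<phi> 6) = 0"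
    by (simp add: phi_6 ip_scale_right ip_commute[of "\<phi> 5"])
qed

lemma phi_orthonormal:
  assumes "l \<in> {1..6}" "m \<in> {1..6}"
  shows "ip (sh i (\<phi> l)) (sh j (\<phi> m)) = (if i = j \<and> l = m then 1 else 0)"
proof -
  have "ip (\<phi> l) (sh k (\<phi> m)) = (if k = 0 \<and> l = m then 1 else 0)" for k
  proof -
    consider "l \<in> {1..4}" "m \<in> {1..4}" | "l \<in> {1..4}" "m \<in> {5, 6}" | "l \<in> {5, 6}" "m \<in> {1..4}"
      | "l \<in> {5, 6}" "m \<in> {5, 6}"
      using assms unfolding atLeastAtMost_1_6 atLeastAtMost_1_4 by blast
    then show ?thesis
    proof cases
      case 1
      note l = phi_A1_props[OF 1(1)] and m = phi_A1_props[OF 1(2)]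
      have s: "sh k (\<phi> m) \<in> supp_in (of_int k) (of_int k + 1)"
        using m(2) by (rule supp_in_sh) auto
      consider "k = 0" | "k \<ge> 1" | "k \<le> -1" by linarith
      then show ?thesis
      proof cases
        case 2
        then show ?thesis by (simp add: ip_disjoint(1)[OF l(2) s])
      next
        case 3
        then have "of_int k + 1 \<le> (0::real)" by linarith
        then show ?thesis using 3 by (simp add: ip_disjoint(2)[OF s l(2)])
      qed (use 1 phi_orthonormal_A1 in auto)
    next
      case 2
      then show ?thesis using phi_inner_outer[OF 2] by auto
    next
      case 3
      then show ?thesis
        using phi_inner_outer[OF 3(2,1), of "- k"] ip_sh_left[of "- k" "\<phi> l" "\<phi> m"] by (auto simp: ip_commute)
    next
      case 4
      note l = phi_outer_props[OF 4(1)] and m = phi_outer_props[OF 4(2)]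
      have s: "sh k (\<phi> m) \<in> supp_in (of_int k - 1) (of_int k + 1)"
        using m(3) by (rule supp_in_sh) auto
      consider "k = 0" | "k = 1" | "k = -1" | "k \<ge> 2" | "k \<le> -2" by linarith
      then show ?thesis
      proof cases
        case 1
        then show ?thesis using 4 phi_5_6_orthonormal by (auto simp: ip_commute[of "\<phi> 6" "\<phi> 5"])
      next
        case 2
        then show ?thesis using phi_outer_shift[OF 4] by simp
      next
        case 3
        then show ?thesis
          using phi_outer_shift[OF 4(2,1)] ip_sh_left[of 1 "\<phi> l" "\<phi> m"] by (simp add: ip_commute)
      next
        case 4
        then show ?thesis by (simp add: ip_disjoint(1)[OF l(3) s])
      next
        case 5
        then have "of_int k + 1 \<le> (-1::real)" by linarith
        then show ?thesis using 5 by (simp add: ip_disjoint(2)[OF s l(3)])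
      qed
    qed
  qed
  then show ?thesis by (simp add: ip_sh_sh)
qed

section \<open>Spans of translates and refinement\<close>

lemma Tset_phi: "f \<in> Tset \<phi> a b \<Longrightarrow> \<exists>k l. f = sh k (\<phi> l) \<and> l \<in> {1..6}"
  unfolding Tset_def atLeastAtMost_1_6 atLeastAtMost_1_4 by blast

lemma Tset_tame: "Tset \<phi> a b \<subseteq> tame" "D ` Tset \<phi> a b \<subseteq> tame"
proof -
  show 1: "Tset \<phi> a b \<subseteq> tame"
    using Tset_phi phi_tame tame_sh by blast
  show "D ` Tset \<phi> a b \<subseteq> tame"
    using 1 tame_dil by auto
qed

lemma Tset_splines: "Tset \<phi> a b \<subseteq> splines 2" "D ` Tset \<phi> a b \<subseteq> splines 3"
proof -
  show 1: "Tset \<phi> a b \<subseteq> splines 2"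
    using Tset_phi phi_splines splines_sh by blast
  show "D ` Tset \<phi> a b \<subseteq> splines 3"
    using 1 splines_dil[of _ 2 1 0] by auto
qed

lemma Tset_supp: "Tset \<phi> a b \<subseteq> supp_in a b"
proof
  fix f assume "f \<in> Tset \<phi> a b"
  then obtain k l where f: "f = sh k (\<phi> l)" and kl: "(l \<in> {1..4} \<and> a \<le> k \<and> k < b) \<or> (l \<in> {5, 6} \<and> a < k \<and> k < b)"
    by (auto simp: Tset_def)
  from kl show "f \<in> supp_in a b"
  proof
    assume *: "l \<in> {1..4} \<and> a \<le> k \<and> k < b"
    then have "real_of_int a \<le> of_int k" "real_of_int k + 1 \<le> of_int b" by linarith+
    then show ?thesis unfolding f using * by (intro supp_in_sh[OF phi_A1_props(2)]) auto
  next
    assume *: "l \<in> {5, 6} \<and> a < k \<and> k < b"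
    then have "real_of_int a + 1 \<le> of_int k" "real_of_int k + 1 \<le> of_int b" by linarith+
    then show ?thesis unfolding f using * by (intro supp_in_sh[OF phi_outer_props(3)]) auto
  qed
qed

lemma D_Tset_supp: "D ` Tset \<phi> a b \<subseteq> supp_in (of_int a / 2) (of_int b / 2)"
proof clarify
  fix f assume "f \<in> Tset \<phi> a b"
  then have "f \<in> supp_in (of_int a) (of_int b)"
    using Tset_supp by blast
  from supp_in_dil[OF this, of 1 0] show "D f \<in> supp_in (of_int a / 2) (of_int b / 2)"
    by simp
qed

lemma span_D_Tset:
  assumes "f \<in> fun_vs.span (D ` Tset \<phi> a b)"
  shows "f \<in> tame" "f \<in> splines 3" "f \<in> supp_in (of_int a / 2) (of_int b / 2)"
  using span_in_subspace[OF assms Tset_tame(2) subspace_tame]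
    span_in_subspace[OF assms Tset_splines(2) subspace_splines]
    span_in_subspace[OF assms D_Tset_supp subspace_supp_in] by auto

text \<open>An outer generator centred at or beyond an end of \<open>[a, b]\<close> is not among the
  spanning functions, so orthonormality makes it orthogonal to the span even where the supports
  overlap. Many relations between the wavelets reduce to this.\<close>

lemma phi_outer_orth_Tset:
  assumes "l \<in> {5, 6}" "f \<in> fun_vs.span (Tset \<phi> a b)" "k \<le> a \<or> b \<le> k"
  shows "ip (sh k (\<phi> l)) f = 0"
proof (rule ip_span_zero_right[OF assms(2)])
  show "sh k (\<phi> l) \<in> tame"
    using assms(1) phi_tame[of l] by auto
  fix g assume "g \<in> Tset \<phi> a b"
  then obtain i m where g: "g = sh i (\<phi> m)" "(m \<in> {1..4} \<and> a \<le> i \<and> i < b) \<or> (m \<in> {5, 6} \<and> a < i \<and> i < b)"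
    by (auto simp: Tset_def)
  then have "m \<in> {1..6}" "\<not> (k = i \<and> l = m)"
    using assms(1,3) by auto
  moreover have "l \<in> {1..6}" using assms(1) by auto
  ultimately show "ip (sh k (\<phi> l)) g = 0"
    by (simp add: g phi_orthonormal)
qed (use Tset_tame in auto)

lemma D_phi_outer_orth_Tset:
  assumes "l \<in> {5, 6}" "f \<in> fun_vs.span (D ` Tset \<phi> a b)" "k \<le> a \<or> b \<le> k"
  shows "ip (D (sh k (\<phi> l))) f = 0"
proof (rule ip_span_zero_right[OF assms(2)])
  show "D (sh k (\<phi> l)) \<in> tame"
    using assms(1) phi_tame[of l] by (intro tame_dil tame_sh) auto
  fix g assume "g \<in> D ` Tset \<phi> a b"
  then obtain h where "g = D h" "h \<in> Tset \<phi> a b" by blast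
  then show "ip (D (sh k (\<phi> l))) g = 0"
    using phi_outer_orth_Tset[OF assms(1) fun_vs.span_base assms(3)] by simp
qed (use Tset_tame in auto)

text \<open>The construction solved for the Hermite functions: normalization and subtraction of
  components can be reversed because no norm is 0.\<close>

lemma xi_1_Tset_base:
  "n \<in> {2, 3} \<Longrightarrow> \<xi> 1 n \<in> fun_vs.span (Tset \<phi> 0 1)"
  "n \<in> {0, 1} \<Longrightarrow> \<xi> 1 n \<in> fun_vs.span (Tset \<phi> (-1) 1)"
proof -
  have in_span: "\<phi> i \<in> fun_vs.span (Tset \<phi> 0 1)" "\<phi> i \<in> fun_vs.span (Tset \<phi> (-1) 1)"
    "sh (-1) (\<phi> i) \<in> fun_vs.span (Tset \<phi> (-1) 1)" if "i \<in> {1..4}" for i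
  proof -
    show "\<phi> i \<in> fun_vs.span (Tset \<phi> 0 1)" "\<phi> i \<in> fun_vs.span (Tset \<phi> (-1) 1)"
      using that unfolding Tset_def by (auto intro!: fun_vs.span_base exI[of _ 0] exI[of _ i])
    show "sh (-1) (\<phi> i) \<in> fun_vs.span (Tset \<phi> (-1) 1)"
      using that unfolding Tset_def by (auto intro!: fun_vs.span_base exI[of _ "-1"] exI[of _ i])
  qed
  have out: "\<phi> i \<in> fun_vs.span (Tset \<phi> (-1) 1)" if "i \<in> {5, 6}" for i
    unfolding Tset_def by (rule fun_vs.span_base) (use that in \<open>auto intro!: exI[of _ 0] exI[of _ i]\<close>)
  have "fscale (sqrt (ip (\<xi> 1 2) (\<xi> 1 2))) (\<phi> 1) \<in> fun_vs.span (Tset \<phi> 0 1)"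
    "fscale (sqrt (ip (\<xi> 1 3) (\<xi> 1 3))) (\<phi> 2) \<in> fun_vs.span (Tset \<phi> 0 1)"
    by (intro fun_vs.span_scale in_span; simp)+
  then show "\<xi> 1 n \<in> fun_vs.span (Tset \<phi> 0 1)" if "n \<in> {2, 3}"
    using that unfolding phi_1_2 span_normalize_fun[OF xi_1_norm_nonzero, symmetric] by auto
  have g: "g5 \<in> fun_vs.span (Tset \<phi> (-1) 1)" "g6 \<in> fun_vs.span (Tset \<phi> (-1) 1)"
    using fun_vs.span_scale[OF out, of 5 "sqrt (ip g5 g5)"] fun_vs.span_scale[OF out, of 6 "sqrt (ip g6 g6)"]
      g5_norm g6_norm by (simp_all add: phi_5 phi_6 fscale_def)
  have "g5 + (\<Sum>i=1..4. fscale (ip (\<xi> 1 0) (\<phi> i)) (\<phi> i))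
     + (\<Sum>i=1..4. fscale (ip (\<xi> 1 0) (sh (-1) (\<phi> i))) (sh (-1) (\<phi> i))) \<in> fun_vs.span (Tset \<phi> (-1) 1)"
    by (intro fun_vs.span_add fun_vs.span_sum fun_vs.span_scale in_span g)
  moreover have "g6 + (\<Sum>i=1..4. fscale (ip (\<xi> 1 1) (\<phi> i)) (\<phi> i))
     + (\<Sum>i=1..4. fscale (ip (\<xi> 1 1) (sh (-1) (\<phi> i))) (sh (-1) (\<phi> i)))
     + fscale (ip (\<xi> 1 1) (\<phi> 5)) (\<phi> 5) \<in> fun_vs.span (Tset \<phi> (-1) 1)"
    by (intro fun_vs.span_add fun_vs.span_sum fun_vs.span_scale in_span g out) auto
  ultimately show "\<xi> 1 n \<in> fun_vs.span (Tset \<phi> (-1) 1)" if "n \<in> {0, 1}"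
    using that by (auto simp: g5_def sub_components_eq[of \<phi> 4] g6_eq)
qed

text \<open>Remainders 2 and 3 belong to half-integer knots, whose functions fit between two
  integers; remainders 0 and 1 belong to integer knots, whose functions straddle the
  integer.\<close>

lemma xi_1_Tset:
  assumes "n mod 4 \<in> {2, 3} \<and> a \<le> n div 4 \<and> n div 4 < b \<or> n mod 4 \<in> {0, 1} \<and> a < n div 4 \<and> n div 4 < b"
  shows "\<xi> 1 n \<in> fun_vs.span (Tset \<phi> a b)"
proof -
  have n: "\<xi> 1 n = sh (n div 4) (\<xi> 1 (n mod 4))"
    by (simp add: sh_xi_1)
  from assms show ?thesis
  proof
    assume *: "n mod 4 \<in> {2, 3} \<and> a \<le> n div 4 \<and> n div 4 < b"
    then have "\<xi> 1 n \<in> fun_vs.span (Tset \<phi> (0 + n div 4) (1 + n div 4))"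
      unfolding n by (intro sh_Tset_span xi_1_Tset_base) auto
    then show ?thesis
      by (rule span_superset_mono) (rule Tset_mono; use * in simp)
  next
    assume *: "n mod 4 \<in> {0, 1} \<and> a < n div 4 \<and> n div 4 < b"
    then have "\<xi> 1 n \<in> fun_vs.span (Tset \<phi> (-1 + n div 4) (1 + n div 4))"
      unfolding n by (intro sh_Tset_span xi_1_Tset_base) auto
    then show ?thesis
      by (rule span_superset_mono) (rule Tset_mono; use * in simp)
  qed
qed

lemma phi_A1_D_Tset: "f \<in> A1 \<Longrightarrow> f \<in> fun_vs.span (D ` Tset \<phi> 0 2)"
  unfolding A1_def
proof (erule span_trans_subset, clarify)
  fix n :: int assume "n \<in> {2..7}"
  then have "n = 2 \<or> n = 3 \<or> n = 4 \<or> n = 5 \<or> n = 6 \<or> n = 7" by auto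
  then have "\<xi> 1 n \<in> fun_vs.span (Tset \<phi> 0 2)"
    by (intro xi_1_Tset) auto
  then show "\<xi> 2 n \<in> fun_vs.span (D ` Tset \<phi> 0 2)"
    unfolding xi_2_eq by (rule D_span)
qed

text \<open>A level-two Hermite function is the dilate of the level-one function with the same
  index, and the latter lies in the span of the translates.\<close>

lemma phi_outer_D_Tset: "l \<in> {5, 6} \<Longrightarrow> \<phi> l \<in> fun_vs.span (D ` Tset \<phi> (-2) 2)"
proof (drule phi_outer_span, erule span_trans_subset, clarify)
  fix n :: int assume n: "n \<in> {-6..7}"
  have "n div 4 \<in> {-2..1}"
    using n by auto
  moreover have "n mod 4 \<in> {2, 3}" if "n div 4 = -2"
  proof -
    have "n = 4 * (n div 4) + n mod 4" "n mod 4 < 4" by simp_all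
    then have "2 \<le> n mod 4 \<and> n mod 4 < 4" using n that by simp
    then show ?thesis by auto
  qed
  moreover have "n mod 4 \<in> {0, 1} \<union> {2, 3}"
    by auto
  ultimately have "n mod 4 \<in> {2, 3} \<and> -2 \<le> n div 4 \<and> n div 4 < 2 \<or> n mod 4 \<in> {0, 1} \<and> -2 < n div 4 \<and> n div 4 < 2"
    by (cases "n div 4 = -2") auto
  then have "\<xi> 1 n \<in> fun_vs.span (Tset \<phi> (-2) 2)"
    by (rule xi_1_Tset)
  then show "\<xi> 2 n \<in> fun_vs.span (D ` Tset \<phi> (-2) 2)"
    unfolding xi_2_eq by (rule D_span)
qed

lemma phi_D_Tset:
  assumes "l \<in> {1..4} \<and> a \<le> 2 * k \<and> 2 * k + 2 \<le> b \<or> l \<in> {5, 6} \<and> a \<le> 2 * k - 2 \<and> 2 * k + 2 \<le> b"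
  shows "sh k (\<phi> l) \<in> fun_vs.span (D ` Tset \<phi> a b)"
  using assms
proof
  assume *: "l \<in> {1..4} \<and> a \<le> 2 * k \<and> 2 * k + 2 \<le> b"
  then have "sh k (\<phi> l) \<in> fun_vs.span (D ` Tset \<phi> (0 + 2 * k) (2 + 2 * k))"
    by (intro sh_D_Tset_span phi_A1_D_Tset phi_A1) auto
  then show ?thesis
    by (rule span_superset_mono) (intro image_mono Tset_mono; use * in simp)
next
  assume *: "l \<in> {5, 6} \<and> a \<le> 2 * k - 2 \<and> 2 * k + 2 \<le> b"
  then have "sh k (\<phi> l) \<in> fun_vs.span (D ` Tset \<phi> (-2 + 2 * k) (2 + 2 * k))"
    by (intro sh_D_Tset_span phi_outer_D_Tset) auto
  then show ?thesis
    by (rule span_superset_mono) (intro image_mono Tset_mono; use * in simp)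
qed

text \<open>A function in the span of \<open>\<phi> 5\<close>, \<open>\<phi> 6\<close> that is also in the span of their dilates
  vanishes on \<open>[1/2, \<infinity>)\<close> and is orthogonal to the Hermite functions supported in \<open>[0, 1]\<close>;
  this forces its coefficients at the knots \<open>3/4\<close>, \<open>1/2\<close>, \<open>1/4\<close> and \<open>0\<close> to vanish in turn.\<close>

lemma D_phi_outer_independent:
  assumes eq: "fscale \<alpha> (D (\<phi> 5)) + fscale \<beta> (D (\<phi> 6)) = fscale a (\<phi> 5) + fscale b (\<phi> 6)"
  shows "\<alpha> = 0" "\<beta> = 0"
proof -
  define f where "f = fscale a (\<phi> 5) + fscale b (\<phi> 6)"
  have f3: "f \<in> fun_vs.span (\<xi> 2 ` {-6..2 * 3 + 1})"
    unfolding f_def using phi_outer_span by (auto intro!: fun_vs.span_add fun_vs.span_scale)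
  have p: "\<phi> 5 x = 0" "\<phi> 6 x = 0" if "1 < x" for x
    using that supp_inD[OF phi_outer_props(3)] by auto
  have c: "\<phi> 5 \<in> c1" "\<phi> 6 \<in> c1"
    by (rule subsetD[OF splines_c1 phi_splines]; simp)+
  have "\<phi> 5 1 = 0" "\<phi> 6 1 = 0"
    using c1_zero_at_end(1)[OF c(1), of 1 2 1] c1_zero_at_end(1)[OF c(2), of 1 2 1] p by auto
  then have z: "f x = 0" if "1/2 \<le> x" for x
    unfolding f_def eq[symmetric] using that p[of "2 * x"] \<open>\<phi> 5 1 = 0\<close> \<open>\<phi> 6 1 = 0\<close>
    by (cases "2 * x = 1") (simp_all add: dil_def)
  \<comment> \<open>The functions \<open>\<xi> 1 n\<close> lie in the span of
    \<open>Tset \<phi> 0 2\<close>, and \<open>\<phi> 5\<close>, \<open>\<phi> 6\<close> are centred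
    at the left end of its interval.\<close>
  have o: "ip f (\<xi> 2 n) = 0" if "n \<in> {2..5}" for n
  proof -
    have "n = 2 \<or> n = 3 \<or> n = 4 \<or> n = 5" using that by auto
    then have "\<xi> 1 n \<in> fun_vs.span (Tset \<phi> 0 2)"
      by (intro xi_1_Tset) auto
    then have "ip (\<phi> l) (\<xi> 1 n) = 0" if "l \<in> {5, 6}" for l
      using phi_outer_orth_Tset[OF that, of _ 0 2 0] by simp
    then show ?thesis
      unfolding f_def eq[symmetric] xi_2_eq
      by (simp add: ip_add_left ip_scale_left tame_scale tame_dil phi_outer_props xi_1_tame)
  qed
  \<comment> \<open>The knots 3/4 and 1/2 are removed by the vanishing of \<open>f\<close>, the
    knots 1/4 and 0 by its orthogonality to the functions of the respective next knot.\<close>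
  have "f \<in> fun_vs.span (\<xi> 2 ` {-6..2 * 2 + 1})"
    using span_xi_2_peel_zero[OF f3] z by simp
  then have "f \<in> fun_vs.span (\<xi> 2 ` {-6..2 * 1 + 1})"
    using span_xi_2_peel_zero[of f 2] z by simp
  then have "f \<in> fun_vs.span (\<xi> 2 ` {-6..2 * 0 + 1})"
    using span_xi_2_peel_orth[of f 1] o by simp
  then have "f \<in> fun_vs.span (\<xi> 2 ` {-6..2 * 0 - 1})"
    using span_xi_2_peel_orth[of f 0] o by simp
  then have fz: "f x = 0" if "0 \<le> x" for x
    using span_xi_2_zero_right[of f 0 x] that by simp
  have "\<alpha> * \<phi> 5 x + \<beta> * \<phi> 6 x = 0" if "x \<in> {0<..<1}" for x
  proof -
    have "(fscale \<alpha> (D (\<phi> 5)) + fscale \<beta> (D (\<phi> 6))) (x / 2) = 0"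
      unfolding eq f_def[symmetric] using fz that by simp
    then have "2 powr (1/2) * (\<alpha> * \<phi> 5 x + \<beta> * \<phi> 6 x) = 0"
      by (simp add: dil_def algebra_simps)
    then show ?thesis by simp
  qed
  from phi_combination_zero[OF this] show "\<alpha> = 0" "\<beta> = 0"
    by auto
qed

end

subsection \<open>The wavelets\<close>

lemma compose_double:
  "(\<lambda>x. f (2 * x)) = fscale (1 / sqrt 2) (D f)" "(\<lambda>x. f (2 * x - 1)) = fscale (1 / sqrt 2) (D (sh 1 f))"
  by (simp_all add: fun_eq_iff dil_def sh_def powr_half_sqrt)

lemma \<phi>R_eq:
  assumes "l \<in> {1..6}"
  shows "\<phi>R \<phi> j (6 * k + int l) = dil j (if l \<le> 4 then k else k + 1) (\<phi> l)"
proof -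
  have 1: "6 * k + int l - 1 = 6 * k + (int l - 1)" by simp
  have "(6 * k + int l - 1) div 6 = k" "(6 * k + int l - 1) mod 6 = int l - 1"
    unfolding 1 using assms by (subst div_mult_self4 mod_mult_self4; simp)+
  then show ?thesis
    by (simp add: \<phi>R_def Let_def)
qed

lemma \<psi>R_eq:
  assumes "l \<in> {1..6}"
  shows "\<psi>R \<psi> j (6 * k + int l) = dil j (if l \<le> 2 then k else k + 1) (\<psi> l)"
proof -
  have 1: "6 * k + int l - 1 = 6 * k + (int l - 1)" by simp
  have "(6 * k + int l - 1) div 6 = k" "(6 * k + int l - 1) mod 6 = int l - 1"
    unfolding 1 using assms by (subst div_mult_self4 mod_mult_self4; simp)+
  then show ?thesis
    by (simp add: \<psi>R_def Let_def)
qed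

lemma index_6:
  fixes n :: int
  obtains k l where "n = 6 * k + int l" "l \<in> {1..6::nat}"
proof (rule that[of "(n - 1) div 6" "nat ((n - 1) mod 6 + 1)"])
  show "nat ((n - 1) mod 6 + 1) \<in> {1..6}"
    using pos_mod_bound[of 6 "n - 1"] pos_mod_sign[of 6 "n - 1"] by auto
  have "int (nat ((n - 1) mod 6 + 1)) = (n - 1) mod 6 + 1"
    using pos_mod_sign[of 6 "n - 1"] by simp
  then show "n = 6 * ((n - 1) div 6) + int (nat ((n - 1) mod 6 + 1))"
    by simp
qed

lemma splines_projection:
  assumes "u \<in> splines m" "u \<in> tame" "f \<in> tame"
  obtains a where "ip (f - fscale a u) u = 0"
proof (cases "ip u u = 0")
  case True
  then have "u = 0" using splines_ip_self_zero assms by blast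
  then show ?thesis by (intro that[of 0]) simp
next
  case False
  then show ?thesis
    using assms by (intro that[of "ip f u / ip u u"]) (simp add: ip_diff_left ip_scale_left tame_scale)
qed

text \<open>Formulated so that \<open>u\<close> and \<open>v\<close> may be dependent or zero, since
  the functions to which it is applied are not known to be independent. A spline of norm zero is
  itself zero.\<close>

lemma splines_projection2:
  assumes "u \<in> splines m" "u \<in> tame" "v \<in> splines m" "v \<in> tame" "f \<in> tame"
  obtains p where "p \<in> fun_vs.span {u, v}" "ip (f - p) u = 0" "ip (f - p) v = 0"
proof -
  obtain c where c: "ip (v - fscale c u) u = 0"
    using splines_projection[OF assms(1,2,4)] .
  define w where "w = v - fscale c u"
  have w: "w \<in> splines m" "w \<in> tame"
    unfolding w_def
    by (intro fun_vs.subspace_diff[OF subspace_splines] fun_vs.subspace_scale[OF subspace_splines]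
        tame_diff tame_scale assms)+
  obtain a where a: "ip (f - fscale a u) u = 0"
    using splines_projection[OF assms(1,2,5)] .
  obtain b where b: "ip (f - fscale b w) w = 0"
    using splines_projection[OF w assms(5)] .
  note t = assms(2,4,5) w(2) tame_scale tame_add tame_diff
  have wu: "ip w u = 0" "ip u w = 0"
    using c by (simp_all add: w_def ip_commute)
  have v: "v = w + fscale c u"
    by (simp add: w_def)
  let ?p = "fscale a u + fscale b w"
  have "?p \<in> fun_vs.span {u, v}"
    unfolding w_def by (intro fun_vs.span_add fun_vs.span_scale fun_vs.span_diff fun_vs.span_base) auto
  moreover have u0: "ip (f - ?p) u = 0"
    using a wu by (simp add: t ip_diff_left ip_add_left ip_scale_left)
  moreover have "ip (f - ?p) w = 0"
    using b wu by (simp add: t ip_diff_left ip_add_left ip_scale_left)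
  then have "ip (f - ?p) v = 0"
    using u0 unfolding v by (subst ip_add_right) (auto simp: t ip_scale_right)
  ultimately show ?thesis
    by (rule that)
qed

lemma atLeastAtMost_psi: "{1..6::nat} = {1, 2} \<union> {3, 4} \<union> {5, 6}"
  by auto

locale wavelets = scaling +
  fixes \<psi> :: "nat \<Rightarrow> real \<Rightarrow> real"
  assumes wavelets: "wavelet_generators \<phi> \<psi>"
begin

section \<open>The wavelets as functions of level one\<close>

lemma span_unit_interval:
  "fun_vs.span ((\<lambda>k x. \<phi> k (2 * x)) ` {1..4} \<union> (\<lambda>k x. \<phi> k (2 * x - 1)) ` {1..6}) =
   fun_vs.span (D ` Tset \<phi> 0 2)" (is "fun_vs.span ?S = _")
proof
  show "fun_vs.span ?S \<subseteq> fun_vs.span (D ` Tset \<phi> 0 2)"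
  proof (rule fun_vs.span_minimal)
    show "?S \<subseteq> fun_vs.span (D ` Tset \<phi> 0 2)"
    proof
      fix f assume "f \<in> ?S"
      then consider l where "l \<in> {1..4}" "f = fscale (1 / sqrt 2) (D (\<phi> l))"
        | l where "l \<in> {1..6}" "f = fscale (1 / sqrt 2) (D (sh 1 (\<phi> l)))"
        unfolding compose_double by blast
      then show "f \<in> fun_vs.span (D ` Tset \<phi> 0 2)"
      proof cases
        case 1
        have "\<phi> l \<in> Tset \<phi> 0 2"
          using 1(1) unfolding Tset_def by (auto intro!: exI[of _ 0] exI[of _ l])
        then show ?thesis unfolding 1(2) by (intro fun_vs.span_scale fun_vs.span_base) auto
      next
        case 2
        have "sh 1 (\<phi> l) \<in> Tset \<phi> 0 2"
          using 2(1) unfolding Tset_def atLeastAtMost_1_6 atLeastAtMost_1_4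
          by (intro CollectI exI[of _ 1] exI[of _ l]) auto
        then show ?thesis unfolding 2(2) by (intro fun_vs.span_scale fun_vs.span_base) auto
      qed
    qed
  qed auto
  have sc: "D h = fscale (sqrt 2) (fscale (1 / sqrt 2) (D h))" for h
    by (simp add: fun_eq_iff)
  show "fun_vs.span (D ` Tset \<phi> 0 2) \<subseteq> fun_vs.span ?S"
  proof (rule fun_vs.span_minimal)
    show "D ` Tset \<phi> 0 2 \<subseteq> fun_vs.span ?S"
    proof clarify
      fix h assume "h \<in> Tset \<phi> 0 2"
      then obtain k l where h: "h = sh k (\<phi> l)" and kl: "(l \<in> {1..4} \<and> 0 \<le> k \<and> k < 2) \<or> (l \<in> {5, 6} \<and> 0 < k \<and> k < 2)"
        by (auto simp: Tset_def)
      from kl have "k = 0 \<and> l \<in> {1..4} \<or> k = 1 \<and> l \<in> {1..6}"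
        by auto
      then have "fscale (1 / sqrt 2) (D h) \<in> ?S"
        unfolding h compose_double by auto
      then show "D h \<in> fun_vs.span ?S"
        by (subst sc) (intro fun_vs.span_scale fun_vs.span_base)
    qed
  qed auto
qed

lemma psi_1_2:
  "orthonormal_basis2 (\<psi> 1) (\<psi> 2)
    (ominus (fun_vs.span (D ` Tset \<phi> 0 2)) (\<phi> ` {1..6} \<union> {sh 1 (\<phi> 5), sh 1 (\<phi> 6)}))"
  using wavelets unfolding wavelet_generators_def span_unit_interval by (simp add: sh_def)

lemma psi_3_4: "\<psi> 3 = normalize_fun (wavelet_h \<phi> 1)"
  "\<psi> 4 = normalize_fun (\<lambda>x. wavelet_h \<phi> 2 x - ip (wavelet_h \<phi> 2) (\<psi> 3) * \<psi> 3 x)"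
  using wavelets unfolding wavelet_generators_def by blast+

lemma psi_5_6:
  "orthonormal_basis2 (\<psi> 5) (\<psi> 6) (ominus (fun_vs.span (\<phi>R \<phi> 1 ` {-11..10}))
    (\<phi>R \<phi> 0 ` {-7..6} \<union> {sh (-1) (\<psi> 1), sh (-1) (\<psi> 2)} \<union> \<psi> ` {1..4}))"
  using wavelets unfolding wavelet_generators_def by (simp add: sh_def)

lemma psi_1_2_ip:
  assumes "l \<in> {1, 2}"
  shows "\<psi> l \<in> fun_vs.span (D ` Tset \<phi> 0 2)" "m \<in> {1..6} \<Longrightarrow> ip (\<psi> l) (\<phi> m) = 0"
    "m \<in> {5, 6} \<Longrightarrow> ip (\<psi> l) (sh 1 (\<phi> m)) = 0"
  using assms orthonormal_basis2D(5,6)[OF psi_1_2] unfolding ominus_def by auto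

text \<open>The indices -11, ..., 10 enumerate the level-one functions supported in
  \<open>[-1, 1]\<close>.\<close>

lemma span_\<phi>R: "fun_vs.span (\<phi>R \<phi> 1 ` {-11..10}) \<subseteq> fun_vs.span (D ` Tset \<phi> (-2) 2)"
proof (intro fun_vs.span_mono, clarify)
  fix n :: int assume n: "n \<in> {-11..10}"
  obtain k l where kl: "n = 6 * k + int l" "l \<in> {1..6}" by (rule index_6)
  have b: "-2 \<le> k" "k \<le> 1" "k = 1 \<Longrightarrow> l \<le> 4" using n kl by auto
  have "sh (if l \<le> 4 then k else k + 1) (\<phi> l) \<in> Tset \<phi> (-2) 2"
    unfolding Tset_def using kl(2) b
    by (intro CollectI exI[of _ "if l \<le> 4 then k else k + 1"] exI[of _ l]) (cases "k = 1"; auto)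
  then show "\<phi>R \<phi> 1 n \<in> D ` Tset \<phi> (-2) 2"
    unfolding kl(1) \<phi>R_eq[OF kl(2)] by (subst dil_eq) auto
qed

lemma psi_5_6_ip:
  assumes "l \<in> {5, 6}"
  shows "\<psi> l \<in> fun_vs.span (D ` Tset \<phi> (-2) 2)"
    "m \<in> {1..4} \<Longrightarrow> k \<in> {-1, 0} \<Longrightarrow> ip (\<psi> l) (sh k (\<phi> m)) = 0"
    "m \<in> {5, 6} \<Longrightarrow> k \<in> {-1, 0, 1} \<Longrightarrow> ip (\<psi> l) (sh k (\<phi> m)) = 0"
    "m \<in> {1, 2} \<Longrightarrow> ip (\<psi> l) (sh (-1) (\<psi> m)) = 0"
    "m \<in> {1..4} \<Longrightarrow> ip (\<psi> l) (\<psi> m) = 0"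
proof -
  have l: "\<psi> l \<in> fun_vs.span (\<phi>R \<phi> 1 ` {-11..10})"
    and o: "\<And>g. g \<in> \<phi>R \<phi> 0 ` {-7..6} \<union> {sh (-1) (\<psi> 1), sh (-1) (\<psi> 2)} \<union> \<psi> ` {1..4} \<Longrightarrow> ip (\<psi> l) g = 0"
    using assms orthonormal_basis2D(5,6)[OF psi_5_6] unfolding ominus_def by auto
  show "\<psi> l \<in> fun_vs.span (D ` Tset \<phi> (-2) 2)"
    using l span_\<phi>R by blast
  \<comment> \<open>Decoding -7, ..., 6 yields \<open>\<phi> 1\<close>, ..., \<open>\<phi> 4\<close>
    translated by -1 and 0, and \<open>\<phi> 5\<close>, \<open>\<phi> 6\<close> translated by -1, 0
    and 1.\<close>
  have R: "ip (\<psi> l) (sh (if m \<le> 4 then k else k + 1) (\<phi> m)) = 0"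
    if "m \<in> {1..6}" "6 * k + int m \<in> {-7..6}" for k m
  proof -
    have "ip (\<psi> l) (\<phi>R \<phi> 0 (6 * k + int m)) = 0"
      by (rule o) (use that(2) in blast)
    then show ?thesis
      unfolding \<phi>R_eq[OF that(1)] dil_0 .
  qed
  show "ip (\<psi> l) (sh k (\<phi> m)) = 0" if "m \<in> {1..4}" "k \<in> {-1, 0}" for m k
    using R[of m k] that by auto
  show "ip (\<psi> l) (sh k (\<phi> m)) = 0" if "m \<in> {5, 6}" "k \<in> {-1, 0, 1}" for m k
    using R[of m "k - 1"] that by auto
  show "m \<in> {1, 2} \<Longrightarrow> ip (\<psi> l) (sh (-1) (\<psi> m)) = 0" "m \<in> {1..4} \<Longrightarrow> ip (\<psi> l) (\<psi> m) = 0"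
    using o by auto
qed

definition e1 :: "real \<Rightarrow> real" where "e1 = fscale (1 / sqrt 2) (D (\<phi> 5))"
definition e2 :: "real \<Rightarrow> real" where "e2 = fscale (1 / sqrt 2) (D (\<phi> 6))"

lemma wavelet_h_eq:
  "wavelet_h \<phi> 1 = e1 - fscale (ip e1 (\<phi> 5)) (\<phi> 5) - fscale (ip e1 (\<phi> 6)) (\<phi> 6)"
  "wavelet_h \<phi> 2 = e2 - fscale (ip e2 (\<phi> 5)) (\<phi> 5) - fscale (ip e2 (\<phi> 6)) (\<phi> 6)"
  unfolding wavelet_h_def e1_def e2_def Let_def compose_double[symmetric] by (simp_all add: fun_eq_iff)

lemma e_tame: "e1 \<in> tame" "e2 \<in> tame"
  unfolding e1_def e2_def by (auto intro!: tame_scale tame_dil phi_outer_props)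

lemma e_splines: "e1 \<in> splines 3" "e2 \<in> splines 3"
  unfolding e1_def e2_def using splines_dil[of "\<phi> _" 2 1 0] phi_outer_props
  by (auto intro!: fun_vs.subspace_scale[OF subspace_splines])

lemma phi_56_splines3: "l \<in> {5, 6} \<Longrightarrow> \<phi> l \<in> splines 3"
  using phi_outer_D_Tset span_D_Tset(2) by blast

lemma wavelet_h_props:
  assumes "i \<in> {1, 2}"
  shows "wavelet_h \<phi> i \<in> tame" "wavelet_h \<phi> i \<in> splines 3" "l \<in> {5, 6} \<Longrightarrow> ip (wavelet_h \<phi> i) (\<phi> l) = 0"
proof -
  have 56: "ip (\<phi> 5) (\<phi> 6) = 0" "ip (\<phi> 6) (\<phi> 5) = 0"
    using phi_5_6_orthonormal by (simp_all add: ip_commute)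
  show "wavelet_h \<phi> i \<in> tame"
    using assms by (auto simp: wavelet_h_eq intro!: tame_diff tame_scale e_tame phi_outer_props)
  show "wavelet_h \<phi> i \<in> splines 3"
    using assms by (auto simp: wavelet_h_eq e_splines phi_56_splines3
        intro!: fun_vs.subspace_diff[OF subspace_splines] fun_vs.subspace_scale[OF subspace_splines])
  show "ip (wavelet_h \<phi> i) (\<phi> l) = 0" if "l \<in> {5, 6}"
    using assms that
    by (auto simp: wavelet_h_eq ip_diff_left ip_scale_left tame_diff tame_scale e_tame phi_outer_props
        phi_5_6_orthonormal 56)
qed

text \<open>Otherwise a nontrivial combination of the dilated outer generators would lie in the span
  of the outer generators themselves.\<close>

lemma wavelet_h_combination:
  assumes "fscale s (wavelet_h \<phi> 1) + fscale t (wavelet_h \<phi> 2) = 0"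
  shows "s = 0" "t = 0"
proof -
  have "fscale (s / sqrt 2) (D (\<phi> 5)) + fscale (t / sqrt 2) (D (\<phi> 6)) =
     fscale (s * ip e1 (\<phi> 5) + t * ip e2 (\<phi> 5)) (\<phi> 5) + fscale (s * ip e1 (\<phi> 6) + t * ip e2 (\<phi> 6)) (\<phi> 6)"
  proof
    fix x
    have "(fscale s (wavelet_h \<phi> 1) + fscale t (wavelet_h \<phi> 2)) x = 0"
      unfolding assms by simp
    then have "s * e1 x + t * e2 x = (s * ip e1 (\<phi> 5) + t * ip e2 (\<phi> 5)) * \<phi> 5 x + (s * ip e1 (\<phi> 6) + t * ip e2 (\<phi> 6)) * \<phi> 6 x"
      by (simp add: wavelet_h_eq algebra_simps)
    then show "(fscale (s / sqrt 2) (D (\<phi> 5)) + fscale (t / sqrt 2) (D (\<phi> 6))) x =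
     (fscale (s * ip e1 (\<phi> 5) + t * ip e2 (\<phi> 5)) (\<phi> 5) + fscale (s * ip e1 (\<phi> 6) + t * ip e2 (\<phi> 6)) (\<phi> 6)) x"
      by (simp add: e1_def[THEN fun_cong] e2_def[THEN fun_cong])
  qed
  from D_phi_outer_independent[OF this] show "s = 0" "t = 0"
    by simp_all
qed

definition g4 :: "real \<Rightarrow> real" where
  "g4 = wavelet_h \<phi> 2 - fscale (ip (wavelet_h \<phi> 2) (\<psi> 3)) (\<psi> 3)"

lemma psi_4: "\<psi> 4 = normalize_fun g4"
  unfolding psi_3_4(2) g4_def by (rule arg_cong[of _ _ normalize_fun]) (simp add: fun_eq_iff)

lemma h1_norm: "ip (wavelet_h \<phi> 1) (wavelet_h \<phi> 1) \<noteq> 0"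
proof
  assume "ip (wavelet_h \<phi> 1) (wavelet_h \<phi> 1) = 0"
  then have "wavelet_h \<phi> 1 = 0"
    using splines_ip_self_zero wavelet_h_props(1,2)[of 1] by blast
  then have "fscale 1 (wavelet_h \<phi> 1) + fscale 0 (wavelet_h \<phi> 2) = 0"
    by (simp add: fun_eq_iff)
  then show False
    using wavelet_h_combination(1)[of 1 0] by simp
qed

lemma psi_3: "\<psi> 3 \<in> tame" "\<psi> 3 \<in> splines 3" "ip (\<psi> 3) (\<psi> 3) = 1"
  "\<psi> 3 = fscale (1 / sqrt (ip (wavelet_h \<phi> 1) (wavelet_h \<phi> 1))) (wavelet_h \<phi> 1)"
proof -
  show 1: "\<psi> 3 = fscale (1 / sqrt (ip (wavelet_h \<phi> 1) (wavelet_h \<phi> 1))) (wavelet_h \<phi> 1)"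
    unfolding psi_3_4 by (rule normalize_fun_eq)
  show "ip (\<psi> 3) (\<psi> 3) = 1"
    unfolding psi_3_4 by (rule ip_normalize_fun[OF h1_norm])
  show "\<psi> 3 \<in> tame" "\<psi> 3 \<in> splines 3"
    unfolding 1 by (intro tame_scale fun_vs.subspace_scale[OF subspace_splines] wavelet_h_props; simp)+
qed

lemma g4_props: "g4 \<in> tame" "g4 \<in> splines 3" "ip g4 g4 \<noteq> 0" "ip (\<psi> 3) g4 = 0"
proof -
  show t: "g4 \<in> tame" "g4 \<in> splines 3"
    unfolding g4_def using wavelet_h_props(1,2)[of 2] psi_3(1,2)
    by (auto intro!: fun_vs.subspace_diff[OF subspace_splines] fun_vs.subspace_scale[OF subspace_splines])
  show "ip (\<psi> 3) g4 = 0"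
    unfolding g4_def ip_commute[of "\<psi> 3"] using wavelet_h_props(1)[of 2] psi_3(1-3)
    by (simp add: ip_diff_left ip_scale_left tame_scale)
  show "ip g4 g4 \<noteq> 0"
  proof
    assume "ip g4 g4 = 0"
    then have z: "g4 = 0"
      using splines_ip_self_zero t by blast
    \<comment> \<open>The second function enters with coefficient 1, so the combination cannot
      vanish.\<close>
    have "fscale (- ip (wavelet_h \<phi> 2) (\<psi> 3) / sqrt (ip (wavelet_h \<phi> 1) (wavelet_h \<phi> 1))) (wavelet_h \<phi> 1)
        + fscale 1 (wavelet_h \<phi> 2) = g4"
      unfolding g4_def by (subst (3) psi_3(4)) (simp add: fun_eq_iff)
    from wavelet_h_combination(2)[OF this[unfolded z]] show False
      by simp
  qed
qed

lemma psi_34_ip: "ip (\<psi> 3) (\<psi> 3) = 1" "ip (\<psi> 4) (\<psi> 4) = 1" "ip (\<psi> 3) (\<psi> 4) = 0"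
  using psi_3(3) ip_normalize_fun[OF g4_props(3)] g4_props(4)
  by (simp_all add: psi_4) (simp add: normalize_fun_eq ip_scale_right)

lemma psi_34_span:
  assumes "l \<in> {3, 4}"
  shows "\<psi> l \<in> fun_vs.span {D (\<phi> 5), D (\<phi> 6), \<phi> 5, \<phi> 6}" (is "_ \<in> ?S")
proof -
  have h: "wavelet_h \<phi> 1 \<in> ?S" "wavelet_h \<phi> 2 \<in> ?S"
    unfolding wavelet_h_eq e1_def e2_def
    by (auto intro!: fun_vs.span_diff fun_vs.span_scale intro: fun_vs.span_base)
  then have 3: "\<psi> 3 \<in> ?S"
    unfolding psi_3_4 by (intro normalize_fun_span)
  then have "\<psi> 4 \<in> ?S"
    using h unfolding psi_4 g4_def by (intro normalize_fun_span fun_vs.span_diff fun_vs.span_scale)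
  then show ?thesis using 3 assms by auto
qed

lemma psi_34_phi: "l \<in> {3, 4} \<Longrightarrow> m \<in> {5, 6} \<Longrightarrow> ip (\<psi> l) (\<phi> m) = 0"
proof -
  assume l: "l \<in> {3, 4}" and m: "m \<in> {5, 6}"
  have 3: "ip (\<psi> 3) (\<phi> m) = 0"
    unfolding psi_3(4) using wavelet_h_props(3)[of 1, OF _ m] by (simp add: ip_scale_left)
  have "ip g4 (\<phi> m) = 0"
    unfolding g4_def using 3 wavelet_h_props(3)[of 2, OF _ m] wavelet_h_props(1)[of 2] psi_3(1) phi_outer_props(1)[OF m]
    by (simp add: ip_scale_left ip_diff_left tame_scale)
  then have "ip (\<psi> 4) (\<phi> m) = 0"
    unfolding psi_4 normalize_fun_eq by (simp add: ip_scale_left)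
  then show ?thesis using 3 l by auto
qed

text \<open>The Gram-Schmidt steps reversed. Orthogonality to \<open>\<psi> 3\<close>,
  \<open>\<psi> 4\<close>, \<open>\<phi> 5\<close>, \<open>\<phi> 6\<close> thus implies
  orthogonality to the dilated outer generators.\<close>

lemma D_phi_span_psi:
  assumes "l \<in> {5, 6}"
  shows "D (\<phi> l) \<in> fun_vs.span {\<psi> 3, \<psi> 4, \<phi> 5, \<phi> 6}" (is "_ \<in> ?S")
proof -
  have 3: "wavelet_h \<phi> 1 \<in> ?S"
    by (subst span_normalize_fun[OF h1_norm]) (auto simp: psi_3_4(1)[symmetric] intro!: fun_vs.span_scale intro: fun_vs.span_base)
  have "g4 \<in> ?S"
    by (subst span_normalize_fun[OF g4_props(3)]) (auto simp: psi_4[symmetric] intro!: fun_vs.span_scale intro: fun_vs.span_base)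
  then have "g4 + fscale (ip (wavelet_h \<phi> 2) (\<psi> 3)) (\<psi> 3) \<in> ?S"
    by (intro fun_vs.span_add fun_vs.span_scale) (auto intro: fun_vs.span_base)
  then have 4: "wavelet_h \<phi> 2 \<in> ?S"
    by (simp add: g4_def)
  have "wavelet_h \<phi> 1 + fscale (ip e1 (\<phi> 5)) (\<phi> 5) + fscale (ip e1 (\<phi> 6)) (\<phi> 6) \<in> ?S"
    "wavelet_h \<phi> 2 + fscale (ip e2 (\<phi> 5)) (\<phi> 5) + fscale (ip e2 (\<phi> 6)) (\<phi> 6) \<in> ?S"
    using 3 4 by (auto intro!: fun_vs.span_add fun_vs.span_scale intro: fun_vs.span_base)
  then have "e1 \<in> ?S" "e2 \<in> ?S"
    by (simp_all add: wavelet_h_eq)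
  then have "fscale (sqrt 2) e1 \<in> ?S" "fscale (sqrt 2) e2 \<in> ?S"
    by (auto intro: fun_vs.span_scale)
  moreover have "fscale (sqrt 2) e1 = D (\<phi> 5)" "fscale (sqrt 2) e2 = D (\<phi> 6)"
    by (simp_all add: e1_def e2_def fun_eq_iff)
  ultimately show ?thesis using assms by auto
qed

section \<open>Supports of the wavelets and orthogonality to the scaling functions\<close>

lemma psi_span:
  "l \<in> {1, 2} \<Longrightarrow> \<psi> l \<in> fun_vs.span (D ` Tset \<phi> 0 2)"
  "l \<in> {1..6} \<Longrightarrow> \<psi> l \<in> fun_vs.span (D ` Tset \<phi> (-2) 2)"
proof -
  show 1: "l \<in> {1, 2} \<Longrightarrow> \<psi> l \<in> fun_vs.span (D ` Tset \<phi> 0 2)" for l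
    by (rule psi_1_2_ip)
  have 2: "\<psi> l \<in> fun_vs.span (D ` Tset \<phi> (-2) 2)" if "l \<in> {3, 4}"
  proof (rule span_trans_subset[OF psi_34_span[OF that]])
    have "\<phi> m \<in> Tset \<phi> (-2) 2" if "m \<in> {5, 6}" for m
      unfolding Tset_def by (rule CollectI, rule exI[of _ 0], rule exI[of _ m]) (use that in auto)
    then show "s \<in> fun_vs.span (D ` Tset \<phi> (-2) 2)" if "s \<in> {D (\<phi> 5), D (\<phi> 6), \<phi> 5, \<phi> 6}" for s
      using that phi_outer_D_Tset by (auto intro: fun_vs.span_base)
  qed
  assume "l \<in> {1..6}"
  then show "\<psi> l \<in> fun_vs.span (D ` Tset \<phi> (-2) 2)"
    unfolding atLeastAtMost_psi
    using 2 psi_5_6_ip(1)[of l] span_superset_mono[OF 1[of l], of "D ` Tset \<phi> (-2) 2"]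
      image_mono[OF Tset_mono[of "-2" 0 2 2 \<phi>], of D] by auto
qed

lemma psi_props:
  assumes "l \<in> {1..6}"
  shows "\<psi> l \<in> tame" "\<psi> l \<in> splines 3" "\<psi> l \<in> supp_in (-1) 1"
  using span_D_Tset[OF psi_span(2)[OF assms]] by auto

lemma psi_12_supp: "l \<in> {1, 2} \<Longrightarrow> \<psi> l \<in> supp_in 0 1"
  using span_D_Tset(3)[OF psi_span(1)] by force

lemma psi_phi:
  assumes "l \<in> {1..6}" "m \<in> {1..6}"
  shows "ip (\<psi> l) (sh k (\<phi> m)) = 0"
proof -
  note lp = psi_props[OF assms(1)]
  have s4: "sh k (\<phi> m) \<in> supp_in (of_int k) (of_int k + 1)" if "m \<in> {1..4}"
    using phi_A1_props(2)[OF that] by (rule supp_in_sh) auto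
  have s6: "sh k (\<phi> m) \<in> supp_in (of_int k - 1) (of_int k + 1)"
    using phi_supp[OF assms(2)] by (rule supp_in_sh) auto
  have m: "m \<in> {1..4} \<or> m \<in> {5, 6}" using assms(2) by auto
  consider "l \<in> {1, 2}" | "l \<in> {3, 4}" | "l \<in> {5, 6}"
    using assms(1) unfolding atLeastAtMost_psi by blast
  then show ?thesis
  proof cases
    case 1
    note s = psi_12_supp[OF 1]
    consider "k \<ge> 2" | "k = 0" | "k = 1" | "k \<le> -1" by linarith
    then show ?thesis
    proof cases
      case 1
      then show ?thesis by (intro ip_disjoint(1)[OF s s6]) auto
    next
      case 2
      then show ?thesis using psi_1_2_ip(2)[OF \<open>l \<in> {1, 2}\<close> assms(2)] by simp
    next
      case 3
      then show ?thesis
        using m psi_1_2_ip(3)[OF \<open>l \<in> {1, 2}\<close>] ip_disjoint(1)[OF s s4] by auto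
    next
      case 4
      then have "of_int k + 1 \<le> (0::real)" by linarith
      then show ?thesis by (intro ip_disjoint(2)[OF s6 s])
    qed
  next
    case 2
    show ?thesis
    proof (cases "k = 0 \<and> m \<in> {5, 6}")
      case True
      then show ?thesis using psi_34_phi[OF 2] by auto
    next
      case False
      \<comment> \<open>Refined to level one, the translate uses only functions on one side of 0,
        and the dilated outer generators centred at 0 are orthogonal to these.\<close>
      obtain a b where ab: "sh k (\<phi> m) \<in> fun_vs.span (D ` Tset \<phi> a b)" "0 \<le> a \<or> b \<le> 0"
      proof (cases "m \<in> {1..4}")
        case True
        show ?thesis
          by (rule that[of "2 * k" "2 * k + 2"]) (use True in \<open>auto intro!: phi_D_Tset\<close>)
      next
        case m: False
        show ?thesis
          by (rule that[of "2 * k - 2" "2 * k + 2"]) (use m False assms(2) in \<open>auto intro!: phi_D_Tset\<close>)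
      qed
      have "ip s (sh k (\<phi> m)) = 0" if "s \<in> {D (\<phi> 5), D (\<phi> 6), \<phi> 5, \<phi> 6}" for s
        using that D_phi_outer_orth_Tset[OF _ ab, of 5] D_phi_outer_orth_Tset[OF _ ab, of 6]
          phi_orthonormal[of 5 m 0 k] phi_orthonormal[of 6 m 0 k] False assms(2) by auto
      then show ?thesis
        using phi_tame assms by (intro ip_span_zero_left[OF psi_34_span[OF 2]]) (auto intro!: tame_sh tame_dil)
    qed
  next
    case 3
    consider "k \<ge> 2" | "k = 1" "m \<in> {1..4}" | "k = 1" "m \<in> {5, 6}" | "k = 0" | "k = -1" | "k \<le> -2"
      using m by linarith
    then show ?thesis
    proof cases
      case 1
      then show ?thesis by (intro ip_disjoint(1)[OF lp(3) s6]) auto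
    next
      case 2
      then show ?thesis using ip_disjoint(1)[OF lp(3) s4] by simp
    next
      case 3
      then show ?thesis using psi_5_6_ip(3)[OF \<open>l \<in> {5, 6}\<close>] by simp
    next
      case 4
      then show ?thesis using m psi_5_6_ip(2,3)[OF \<open>l \<in> {5, 6}\<close>, of m 0] by auto
    next
      case 5
      then show ?thesis using m psi_5_6_ip(2,3)[OF \<open>l \<in> {5, 6}\<close>, of m "-1"] by auto
    next
      case 6
      then have "of_int k + 1 \<le> (-1::real)" by linarith
      then show ?thesis by (intro ip_disjoint(2)[OF s6 lp(3)])
    qed
  qed
qed

lemma psi_Tset: "l \<in> {1..6} \<Longrightarrow> f \<in> fun_vs.span (Tset \<phi> a b) \<Longrightarrow> ip (\<psi> l) f = 0"
  by (rule ip_span_zero_right) (use psi_props Tset_tame Tset_phi psi_phi in \<open>fastforce+\<close>)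

lemma psi_vanishing_moments:
  fixes p :: "real poly"
  assumes "l \<in> {1..6}" "degree p < 4"
  shows "ip (\<psi> l) (poly p) = 0"
proof -
  obtain v where v: "v \<in> fun_vs.span (\<xi> 1 ` {-4..5})" "\<forall>x\<in>{-1..1}. poly p x = v x"
    using cubic_eq_span_xi_1[OF assms(2)] by blast
  have "\<psi> l x * poly p x = \<psi> l x * v x" for x
    using v(2) supp_inD[OF psi_props(3)[OF assms(1)], of x] by (cases "x \<in> {-1..1}") auto
  then have "ip (\<psi> l) (poly p) = ip (\<psi> l) v"
    by (simp only: ip_eq)
  also have "\<dots> = 0"
  proof (rule psi_Tset[OF assms(1) span_trans_subset[OF v(1)]], clarify)
    fix n :: int assume "n \<in> {-4..5}"
    moreover have "n mod 4 \<in> {0, 1} \<union> {2, 3}" by auto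
    ultimately show "\<xi> 1 n \<in> fun_vs.span (Tset \<phi> (-2) 2)"
      by (intro xi_1_Tset) auto
  qed
  finally show ?thesis .
qed


section \<open>Splitting at the origin\<close>

lemma phi_l_in_Tset: "l \<in> {5, 6} \<Longrightarrow> a < 0 \<Longrightarrow> 0 < b \<Longrightarrow> \<phi> l \<in> Tset \<phi> a b"
  unfolding Tset_def by (rule CollectI, rule exI[of _ 0], rule exI[of _ l]) auto

text \<open>Among the level-one functions only the two outer generators centred at 0 reach to both
  sides of it.\<close>

lemma Tset_split:
  assumes "f \<in> fun_vs.span (D ` Tset \<phi> (-2) 2)"
  obtains f1 f2 a b where "f = f1 + f2 + fscale a (D (\<phi> 5)) + fscale b (D (\<phi> 6))"
    "f1 \<in> fun_vs.span (D ` Tset \<phi> (-2) 0)" "f2 \<in> fun_vs.span (D ` Tset \<phi> 0 2)"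
proof -
  have "Tset \<phi> (-2) 2 \<subseteq> Tset \<phi> (-2) 0 \<union> Tset \<phi> 0 2 \<union> {\<phi> 5, \<phi> 6}"
  proof
    fix h assume "h \<in> Tset \<phi> (-2) 2"
    then obtain k l where h: "h = sh k (\<phi> l)" and kl: "(l \<in> {1..4} \<and> -2 \<le> k \<and> k < 2) \<or> (l \<in> {5, 6} \<and> -2 < k \<and> k < 2)"
      by (auto simp: Tset_def)
    show "h \<in> Tset \<phi> (-2) 0 \<union> Tset \<phi> 0 2 \<union> {\<phi> 5, \<phi> 6}"
    proof (cases "l \<in> {5, 6} \<and> k = 0")
      case True
      then show ?thesis by (auto simp: h)
    next
      case False
      then have "(l \<in> {1..4} \<and> -2 \<le> k \<and> k < 0 \<or> l \<in> {5, 6} \<and> -2 < k \<and> k < 0) \<or>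
        (l \<in> {1..4} \<and> 0 \<le> k \<and> k < 2 \<or> l \<in> {5, 6} \<and> 0 < k \<and> k < 2)"
        using kl by auto
      then show ?thesis
        unfolding Tset_def h by blast
    qed
  qed
  then have "D ` Tset \<phi> (-2) 2 \<subseteq> (D ` Tset \<phi> (-2) 0 \<union> D ` Tset \<phi> 0 2) \<union> {D (\<phi> 5), D (\<phi> 6)}"
    by blast
  then have "f \<in> fun_vs.span ((D ` Tset \<phi> (-2) 0 \<union> D ` Tset \<phi> 0 2) \<union> {D (\<phi> 5), D (\<phi> 6)})"
    by (rule span_superset_mono[OF assms])
  then obtain f1 f2 h where "f = (f1 + f2) + h" "f1 \<in> fun_vs.span (D ` Tset \<phi> (-2) 0)"
    "f2 \<in> fun_vs.span (D ` Tset \<phi> 0 2)" "h \<in> fun_vs.span {D (\<phi> 5), D (\<phi> 6)}"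
    unfolding fun_vs.span_Un by blast
  moreover then obtain a b where "h = fscale a (D (\<phi> 5)) + fscale b (D (\<phi> 6))"
    by (auto simp: span2_iff)
  ultimately show ?thesis
    by (intro that[of f1 f2 a b]) (auto simp: add.assoc)
qed

lemma psi_56_D_phi:
  assumes "l \<in> {5, 6}" "m \<in> {5, 6}"
  shows "ip (\<psi> l) (D (\<phi> m)) = 0"
proof (rule ip_span_zero_right[OF D_phi_span_psi[OF assms(2)]])
  show "{\<psi> 3, \<psi> 4, \<phi> 5, \<phi> 6} \<subseteq> tame"
    using psi_props phi_outer_props by auto
  show "\<psi> l \<in> tame" using psi_props assms by auto
  show "ip (\<psi> l) g = 0" if "g \<in> {\<psi> 3, \<psi> 4, \<phi> 5, \<phi> 6}" for g
    using that psi_5_6_ip(3)[OF assms(1), of _ 0] psi_5_6_ip(5)[OF assms(1)] by auto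
qed

text \<open>The coefficients of the straddling functions are the inner products with them, which
  vanish by \<open>psi_56_D_phi\<close>.\<close>

lemma psi_56_split:
  assumes "l \<in> {5, 6}"
  obtains f1 f2 where "\<psi> l = f1 + f2" "f1 \<in> fun_vs.span (D ` Tset \<phi> (-2) 0)" "f2 \<in> fun_vs.span (D ` Tset \<phi> 0 2)"
proof -
  have l: "l \<in> {1..6}" using assms by auto
  obtain f1 f2 a b where f: "\<psi> l = f1 + f2 + fscale a (D (\<phi> 5)) + fscale b (D (\<phi> 6))"
    and f1: "f1 \<in> fun_vs.span (D ` Tset \<phi> (-2) 0)" and f2: "f2 \<in> fun_vs.span (D ` Tset \<phi> 0 2)"
    using Tset_split[OF psi_span(2)[OF l]] .
  have z: "ip f1 (D (\<phi> m)) = 0" "ip f2 (D (\<phi> m)) = 0" if "m \<in> {5, 6}" for m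
    using D_phi_outer_orth_Tset[OF that f1, of 0] D_phi_outer_orth_Tset[OF that f2, of 0]
    by (simp_all add: ip_commute)
  note t = span_D_Tset(1)[OF f1] span_D_Tset(1)[OF f2] phi_outer_props(1) tame_add tame_scale tame_dil
  have "ip (\<psi> l) (D (\<phi> 5)) = a" "ip (\<psi> l) (D (\<phi> 6)) = b"
    unfolding f by (simp_all add: ip_add_left ip_scale_left t z phi_5_6_orthonormal ip_commute[of "\<phi> 6" "\<phi> 5"])
  then have "a = 0" "b = 0"
    using psi_56_D_phi[OF assms] by auto
  then have "\<psi> l = f1 + f2"
    unfolding f by (simp add: fun_eq_iff)
  then show ?thesis using f1 f2 by (rule that)
qed

text \<open>By the second property \<open>u\<close> is the orthogonal projection of
  \<open>\<phi> m\<close> to the span of the level-one functions in \<open>[0, 1]\<close>. It arises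
  by dropping the left half and the straddling part, which are orthogonal to that span and to the
  outer generators centred at 1.\<close>

lemma phi_outer_split:
  assumes "m \<in> {5, 6}"
  obtains u where "u \<in> fun_vs.span (D ` Tset \<phi> 0 2)"
    "\<And>y. y \<in> fun_vs.span (D ` Tset \<phi> 0 2) \<Longrightarrow> ip y u = ip y (\<phi> m)"
    "\<And>l. l \<in> {5, 6} \<Longrightarrow> ip u (sh 1 (\<phi> l)) = 0"
proof -
  obtain f1 u a b where f: "\<phi> m = f1 + u + fscale a (D (\<phi> 5)) + fscale b (D (\<phi> 6))"
    and f1: "f1 \<in> fun_vs.span (D ` Tset \<phi> (-2) 0)" and u: "u \<in> fun_vs.span (D ` Tset \<phi> 0 2)"
    using Tset_split[OF phi_outer_D_Tset[OF assms]] .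
  note t = span_D_Tset(1)[OF f1] span_D_Tset(1)[OF u] phi_outer_props(1) tame_add tame_scale tame_dil
  have 1: "ip y u = ip y (\<phi> m)" if y: "y \<in> fun_vs.span (D ` Tset \<phi> 0 2)" for y
  proof -
    have "ip y (D (\<phi> l)) = 0" if "l \<in> {5, 6}" for l
      using D_phi_outer_orth_Tset[OF that y, of 0] by (simp add: ip_commute)
    moreover have "ip y f1 = 0"
      using ip_disjoint(2)[OF span_D_Tset(3)[OF f1] span_D_Tset(3)[OF y]] by simp
    ultimately show ?thesis
      unfolding f by (simp add: ip_add_right ip_scale_right t span_D_Tset(1)[OF y])
  qed
  have 2: "ip u (sh 1 (\<phi> l)) = 0" if l: "l \<in> {5, 6}" for l
  proof -
    have s: "sh 1 (\<phi> l) \<in> fun_vs.span (D ` Tset \<phi> 0 4)"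
      using l by (intro phi_D_Tset) auto
    have "ip (D (\<phi> i)) (sh 1 (\<phi> l)) = 0" if "i \<in> {5, 6}" for i
      using D_phi_outer_orth_Tset[OF that s, of 0] by simp
    moreover have "ip f1 (sh 1 (\<phi> l)) = 0"
      using ip_disjoint(1)[OF span_D_Tset(3)[OF f1] span_D_Tset(3)[OF s]] by simp
    moreover have "ip (\<phi> m) (sh 1 (\<phi> l)) = 0"
      using phi_outer_shift[OF assms l] .
    ultimately show ?thesis
      unfolding f by (simp add: ip_add_left ip_scale_left t span_D_Tset(1)[OF s])
  qed
  show ?thesis
    using that[OF u 1 2] by simp
qed

text \<open>Let \<open>Y\<close> be the span of the level one scaling functions supported in \<open>[0, 1]\<close>, and let
  \<open>u\<^sub>5\<close>, \<open>u\<^sub>6\<close> be the components in \<open>Y\<close> of \<open>\<phi> 5\<close>, \<open>\<phi> 6\<close>. The right half of \<open>\<psi> 5\<close> or \<open>\<psi> 6\<close>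
  minus its projection to \<open>span {u\<^sub>5, u\<^sub>6}\<close> lies in the space with basis \<open>\<psi> 1\<close>, \<open>\<psi> 2\<close> and is
  orthogonal to it. So the right half lies in \<open>span {u\<^sub>5, u\<^sub>6}\<close>, which is orthogonal to every
  left half shifted by one.\<close>

lemma psi_56_shift:
  assumes "l \<in> {5, 6}" "m \<in> {5, 6}"
  shows "ip (\<psi> l) (sh 1 (\<psi> m)) = 0"
proof -
  let ?Y = "fun_vs.span (D ` Tset \<phi> 0 2)"
  have l6: "l \<in> {1..6}" "m \<in> {1..6}" using assms by auto
  obtain f1 f2 where f: "\<psi> l = f1 + f2" and f1: "f1 \<in> fun_vs.span (D ` Tset \<phi> (-2) 0)" and f2: "f2 \<in> ?Y"
    using psi_56_split[OF assms(1)] .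
  obtain h1 h2 where h: "\<psi> m = h1 + h2" and h1: "h1 \<in> fun_vs.span (D ` Tset \<phi> (-2) 0)" and h2: "h2 \<in> ?Y"
    using psi_56_split[OF assms(2)] .
  obtain u5 where u5: "u5 \<in> ?Y" "\<And>y. y \<in> ?Y \<Longrightarrow> ip y u5 = ip y (\<phi> 5)" "\<And>l. l \<in> {5, 6} \<Longrightarrow> ip u5 (sh 1 (\<phi> l)) = 0"
    using phi_outer_split[of 5] by auto
  obtain u6 where u6: "u6 \<in> ?Y" "\<And>y. y \<in> ?Y \<Longrightarrow> ip y u6 = ip y (\<phi> 6)" "\<And>l. l \<in> {5, 6} \<Longrightarrow> ip u6 (sh 1 (\<phi> l)) = 0"
    using phi_outer_split[of 6] by auto
  note Yt = span_D_Tset(1)[of _ 0 2] and Ys = span_D_Tset(3)[of _ 0 2, simplified]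
  have f1p: "f1 \<in> tame" "f1 \<in> supp_in (-1) 0" and h1p: "h1 \<in> tame" "h1 \<in> supp_in (-1) 0"
    using span_D_Tset[OF f1] span_D_Tset[OF h1] by auto
  have sh_f2: "ip f2 g = ip (\<psi> l) g" if "g \<in> tame" "g \<in> supp_in 0 b" for g b
    using ip_disjoint(1)[OF f1p(2) that(2)] unfolding f
    by (simp add: ip_add_left that(1) f1p(1) Yt[OF f2])
  obtain p where p: "p \<in> fun_vs.span {u5, u6}" "ip (f2 - p) u5 = 0" "ip (f2 - p) u6 = 0"
    by (rule splines_projection2[of u5 3 u6 f2]) (use span_D_Tset(1,2) u5 u6 f2 in auto)
  define r where "r = f2 - p"
  have pY: "p \<in> ?Y"
    using p(1) by (rule span_trans_subset) (use u5 u6 in auto)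
  then have rY: "r \<in> ?Y"
    unfolding r_def by (intro fun_vs.span_diff f2)
  \<comment> \<open>The subtracted part \<open>p\<close> is invisible to functions orthogonal to
    \<open>u5\<close> and \<open>u6\<close>. For those supported in the right half line,
    \<open>sh_f2\<close> replaces \<open>f2\<close> further by the whole wavelet.\<close>
  have rp: "ip r g = ip f2 g" if "g \<in> tame" "ip u5 g = 0" "ip u6 g = 0" for g
  proof -
    have "ip p g = 0"
      by (rule ip_span_zero_left[OF p(1)]) (use that u5 u6 Yt in auto)
    then show ?thesis
      by (simp add: r_def ip_diff_left Yt f2 pY that(1))
  qed
  have "ip r (\<phi> i) = 0" if "i \<in> {1..4}" for i
  proof -
    have iY: "\<phi> i \<in> ?Y"
      using phi_A1_D_Tset[OF phi_A1[OF that]] .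
    have "ip (\<phi> i) (\<phi> 5) = 0" "ip (\<phi> i) (\<phi> 6) = 0"
      using that phi_inner_outer[OF that, of _ 0] by auto
    then have "ip u5 (\<phi> i) = 0" "ip u6 (\<phi> i) = 0"
      using u5(2)[OF iY] u6(2)[OF iY] by (simp_all add: ip_commute)
    then have "ip r (\<phi> i) = ip f2 (\<phi> i)"
      by (intro rp phi_A1_props[OF that])
    also have "\<dots> = ip (\<psi> l) (\<phi> i)"
      by (intro sh_f2[where b = 1] phi_A1_props[OF that])
    finally show ?thesis
      using psi_phi[OF l6(1), of i 0] that by simp
  qed
  moreover have "ip r (\<phi> i) = 0" if "i \<in> {5, 6}" for i
  proof -
    have "ip r (\<phi> 5) = 0" "ip r (\<phi> 6) = 0"
      using p(2,3) unfolding r_def[symmetric] u5(2)[OF rY] u6(2)[OF rY] .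
    then show ?thesis using that by blast
  qed
  moreover have "i \<in> {1..4} \<or> i \<in> {5, 6}" if "i \<in> {1..6}" for i :: nat
    using that by auto
  ultimately have r1: "ip r (\<phi> i) = 0" if "i \<in> {1..6}" for i
    using that by metis
  have r2: "ip r (sh 1 (\<phi> i)) = 0" if "i \<in> {5, 6}" for i
  proof -
    have t: "sh 1 (\<phi> i) \<in> tame" "sh 1 (\<phi> i) \<in> supp_in 0 2"
      using phi_outer_props[OF that] by (auto intro: supp_in_sh)
    have "ip r (sh 1 (\<phi> i)) = ip f2 (sh 1 (\<phi> i))"
      by (intro rp u5(3) u6(3) that t)
    also have "\<dots> = ip (\<psi> l) (sh 1 (\<phi> i))"
      by (intro sh_f2[where b = 2] t)
    also have "\<dots> = 0"
      using that by (intro psi_phi[OF l6(1)]) auto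
    finally show ?thesis .
  qed
  have "r \<in> fun_vs.span {\<psi> 1, \<psi> 2}"
    unfolding orthonormal_basis2D(7)[OF psi_1_2, symmetric] ominus_def
    using rY r1 r2 by auto
  moreover have "ip r (\<psi> i) = 0" if "i \<in> {1, 2}" for i
  proof -
    note iY = psi_1_2_ip(1)[OF that]
    have "ip u5 (\<psi> i) = 0" "ip u6 (\<psi> i) = 0"
      using u5(2)[OF iY] u6(2)[OF iY] psi_1_2_ip(2)[OF that] by (simp_all add: ip_commute)
    then have "ip r (\<psi> i) = ip f2 (\<psi> i)"
      by (intro rp Yt iY)
    also have "\<dots> = ip (\<psi> l) (\<psi> i)"
      by (intro sh_f2[where b = 1] Yt Ys iY)
    finally show ?thesis
      using psi_5_6_ip(5)[OF assms(1), of i] that by auto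
  qed
  ultimately have "ip r r = 0"
    using rY Yt psi_props by (intro ip_span_zero_right[of r]) auto
  then have "r = 0"
    using splines_ip_self_zero span_D_Tset(1,2)[OF rY] by blast
  then have f2p: "f2 = p"
    by (simp add: r_def)
  have s1: "sh 1 h1 \<in> ?Y"
    using sh_D_Tset_span[OF h1, of 1] by simp
  have s2: "sh 1 h2 \<in> supp_in 1 2"
    by (rule supp_in_sh[OF Ys[OF h2]]) auto
  have sm: "sh 1 (\<psi> m) = sh 1 h1 + sh 1 h2"
    unfolding h by (rule sh_add)
  \<comment> \<open>Since \<open>sh 1 h2\<close> begins at 1, where \<open>\<phi> i\<close> ends,
    the relation for the translated wavelet concerns its left half alone. The projection property
    then carries it over to \<open>u5\<close> and \<open>u6\<close>.\<close>
  have o: "ip (sh 1 h1) (\<phi> i) = 0" if "i \<in> {5, 6}" for i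
  proof -
    have "ip (sh 1 (\<psi> m)) (\<phi> i) = 0"
      using psi_phi[OF l6(2), of i "-1"] that by (auto simp: ip_sh_left)
    moreover have "ip (sh 1 h2) (\<phi> i) = 0"
      by (rule ip_disjoint(2)[OF phi_outer_props(3)[OF that] s2]) simp
    ultimately show ?thesis
      unfolding sm by (simp add: ip_add_left Yt s1 h2 tame_sh phi_outer_props[OF that])
  qed
  have "ip (\<psi> l) (sh 1 (\<psi> m)) = ip f2 (sh 1 (\<psi> m))"
    using supp_in_sh[OF psi_props(3)[OF l6(2)], of 0 1 2] psi_props(1)[OF l6(2)]
    by (intro sh_f2[symmetric, of _ 2]) auto
  also have "\<dots> = ip f2 (sh 1 h1)"
    unfolding sm using ip_disjoint(1)[OF Ys[OF f2] s2]
    by (simp add: ip_add_right Yt s1 f2 h2 tame_sh)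
  also have "\<dots> = 0"
    unfolding f2p
    by (rule ip_span_zero_left[OF p(1)])
      (use Yt s1 u5 u6 o u5(2)[OF s1] u6(2)[OF s1] in \<open>auto simp: ip_commute[of _ "sh 1 h1"]\<close>)
  finally show ?thesis .
qed

text \<open>The wavelets \<open>\<psi> 3\<close> and \<open>\<psi> 4\<close> combine outer
  generators of levels zero and one with the same centre. The level-one part is orthogonal to
  everything spanned on one side of that centre; the level-zero part is the last assumption.\<close>

lemma psi_34_orth:
  assumes "l \<in> {3, 4}" "f \<in> fun_vs.span (D ` Tset \<phi> a b)" "2 * k \<le> a \<or> b \<le> 2 * k"
    and "\<And>m. m \<in> {5, 6} \<Longrightarrow> ip f (sh k (\<phi> m)) = 0"
  shows "ip f (sh k (\<psi> l)) = 0"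
proof -
  have "sh k (\<psi> l) \<in> fun_vs.span (sh k ` {D (\<phi> 5), D (\<phi> 6), \<phi> 5, \<phi> 6})"
    by (rule sh_span[OF psi_34_span[OF assms(1)]]) (auto intro: fun_vs.span_base)
  then show ?thesis
  proof (rule ip_span_zero_right)
    show "f \<in> tame" using span_D_Tset(1)[OF assms(2)] .
    show "sh k ` {D (\<phi> 5), D (\<phi> 6), \<phi> 5, \<phi> 6} \<subseteq> tame"
      using phi_outer_props by auto
    show "ip f g = 0" if "g \<in> sh k ` {D (\<phi> 5), D (\<phi> 6), \<phi> 5, \<phi> 6}" for g
      using that assms(4) D_phi_outer_orth_Tset[OF _ assms(2,3)] by (auto simp: sh_D ip_commute[of f])
  qed
qed

lemma psi_orthonormal:
  assumes "l \<in> {1..6}" "m \<in> {1..6}"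
  shows "ip (sh i (\<psi> l)) (sh j (\<psi> m)) = (if i = j \<and> l = m then 1 else 0)"
proof -
  have norm12: "ip (\<psi> 1) (\<psi> 1) = 1" "ip (\<psi> 2) (\<psi> 2) = 1" "ip (\<psi> 1) (\<psi> 2) = 0" "ip (\<psi> 2) (\<psi> 1) = 0"
    using orthonormal_basis2D[OF psi_1_2] by auto
  have norm56: "ip (\<psi> 5) (\<psi> 5) = 1" "ip (\<psi> 6) (\<psi> 6) = 1" "ip (\<psi> 5) (\<psi> 6) = 0" "ip (\<psi> 6) (\<psi> 5) = 0"
    using orthonormal_basis2D[OF psi_5_6] by auto
  have norm43: "ip (\<psi> 4) (\<psi> 3) = 0"
    using psi_34_ip(3) by (simp add: ip_commute)
  \<comment> \<open>Symmetry reduces the nine combinations of types to six.\<close>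
  have swap: "ip (\<psi> l) (sh k (\<psi> m)) = ip (\<psi> m) (sh (- k) (\<psi> l))" for k l m
    using ip_sh_left[of "-k" "\<psi> l" "\<psi> m"] by (simp add: ip_commute)
  have p12_12: "ip (\<psi> l) (sh k (\<psi> m)) = (if k = 0 \<and> l = m then 1 else 0)"
    if "l \<in> {1, 2}" "m \<in> {1, 2}" for k l m
  proof -
    have s: "sh k (\<psi> m) \<in> supp_in (of_int k) (of_int k + 1)"
      using psi_12_supp[OF that(2)] by (rule supp_in_sh) auto
    consider "k = 0" | "k \<ge> 1" | "k \<le> -1" by linarith
    then show ?thesis
    proof cases
      case 1
      then show ?thesis using that norm12 by auto
    next
      case 2
      then show ?thesis by (simp add: ip_disjoint(1)[OF psi_12_supp[OF that(1)] s])
    next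
      case 3
      then have "of_int k + 1 \<le> (0::real)" by linarith
      then show ?thesis using 3 by (simp add: ip_disjoint(2)[OF s psi_12_supp[OF that(1)]])
    qed
  qed
  have p12_34: "ip (\<psi> l) (sh k (\<psi> m)) = 0" if "l \<in> {1, 2}" "m \<in> {3, 4}" for k l m
    by (rule psi_34_orth[OF that(2) psi_span(1)[OF that(1)]]) (use that psi_phi in auto)
  have p56_12: "ip (\<psi> l) (sh k (\<psi> m)) = 0" if "l \<in> {5, 6}" "m \<in> {1, 2}" for k l m
  proof -
    have l: "l \<in> {1..6}" using that by auto
    have s: "sh k (\<psi> m) \<in> supp_in (of_int k) (of_int k + 1)"
      using psi_12_supp[OF that(2)] by (rule supp_in_sh) auto
    consider "k = 0" | "k = -1" | "k \<ge> 1" | "k \<le> -2" by linarith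
    then show ?thesis
    proof cases
      case 1
      then show ?thesis using that psi_5_6_ip(5)[OF that(1), of m] by auto
    next
      case 2
      then show ?thesis using psi_5_6_ip(4)[OF that] by simp
    next
      case 3
      then show ?thesis by (intro ip_disjoint(1)[OF psi_props(3)[OF l] s]) simp
    next
      case 4
      then have "of_int k + 1 \<le> (-1::real)" by linarith
      then show ?thesis by (intro ip_disjoint(2)[OF s psi_props(3)[OF l]])
    qed
  qed
  have p34_34: "ip (\<psi> l) (sh k (\<psi> m)) = (if k = 0 \<and> l = m then 1 else 0)"
    if "l \<in> {3, 4}" "m \<in> {3, 4}" for k l m
  proof (cases "k = 0")
    case True
    then show ?thesis using that psi_34_ip norm43 by auto
  next
    case False
    have "ip (\<psi> l) (sh k (\<psi> m)) = 0"
    proof -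
      have "ip g (sh k (\<psi> m)) = 0" if "g \<in> {D (\<phi> 5), D (\<phi> 6), \<phi> 5, \<phi> 6}" for g
      proof -
        have m: "m \<in> {3, 4}" by fact
        consider i where "i \<in> {5, 6}" "g = D (\<phi> i)" | i where "i \<in> {5, 6}" "g = \<phi> i"
          using \<open>g \<in> _\<close> by blast
        then show ?thesis
        proof cases
          case 1
          have "g \<in> fun_vs.span (D ` Tset \<phi> (-1) 1)"
            unfolding 1 by (intro fun_vs.span_base imageI phi_l_in_Tset 1) auto
          then show ?thesis
          proof (rule psi_34_orth[OF m])
            show "2 * k \<le> -1 \<or> 1 \<le> 2 * k" using False by linarith
            fix m' :: nat assume m': "m' \<in> {5, 6}"
            \<comment> \<open>As \<open>k\<close> is not 0, this translate refines to level-one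
              functions on one side of 0.\<close>
            have "sh k (\<phi> m') \<in> fun_vs.span (D ` Tset \<phi> (2 * k - 2) (2 * k + 2))"
              using m' by (intro phi_D_Tset) auto
            moreover have "0 \<le> 2 * k - 2 \<or> 2 * k + 2 \<le> 0" using False by linarith
            ultimately show "ip g (sh k (\<phi> m')) = 0"
              using D_phi_outer_orth_Tset[OF 1(1), of "sh k (\<phi> m')" _ _ 0] 1 by simp
          qed
        next
          case 2
          have "g \<in> fun_vs.span (D ` Tset \<phi> (-2) 2)"
            unfolding 2 by (rule phi_outer_D_Tset[OF 2(1)])
          then show ?thesis
          proof (rule psi_34_orth[OF m])
            show "2 * k \<le> -2 \<or> 2 \<le> 2 * k" using False by linarith
            fix m' :: nat assume m': "m' \<in> {5, 6}"
            then show "ip g (sh k (\<phi> m')) = 0"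
              using phi_orthonormal[of i m' 0 k] 2 False by auto
          qed
        qed
      qed
      then show ?thesis
        by (intro ip_span_zero_left[OF psi_34_span[OF that(1)]])
          (use that psi_props phi_outer_props in auto)
    qed
    then show ?thesis using False by simp
  qed
  have p56_34: "ip (\<psi> l) (sh k (\<psi> m)) = 0" if "l \<in> {5, 6}" "m \<in> {3, 4}" for k l m
  proof (cases "k = 0")
    case True
    then show ?thesis using that psi_5_6_ip(5)[OF that(1), of m] by auto
  next
    case False
    have l: "l \<in> {1..6}" using that by auto
    show ?thesis
      by (rule psi_34_orth[OF that(2) psi_span(2)[OF l]]) (use that False psi_phi[OF l] in auto)
  qed
  have p56_56: "ip (\<psi> l) (sh k (\<psi> m)) = (if k = 0 \<and> l = m then 1 else 0)"
    if "l \<in> {5, 6}" "m \<in> {5, 6}" for k l m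
  proof -
    have l: "l \<in> {1..6}" "m \<in> {1..6}" using that by auto
    have s: "sh k (\<psi> m) \<in> supp_in (of_int k - 1) (of_int k + 1)"
      using psi_props(3)[OF l(2)] by (rule supp_in_sh) auto
    consider "k = 0" | "k = 1" | "k = -1" | "k \<ge> 2" | "k \<le> -2" by linarith
    then show ?thesis
    proof cases
      case 1
      then show ?thesis using that norm56 by auto
    next
      case 2
      then show ?thesis using psi_56_shift[OF that] by simp
    next
      case 3
      then show ?thesis using psi_56_shift[OF that(2,1)] swap[of l k m] by simp
    next
      case 4
      then show ?thesis by (simp add: ip_disjoint(1)[OF psi_props(3)[OF l(1)] s])
    next
      case 5
      then have "of_int k + 1 \<le> (-1::real)" by linarith
      then show ?thesis using 5 by (simp add: ip_disjoint(2)[OF s psi_props(3)[OF l(1)]])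
    qed
  qed
  have "ip (\<psi> l) (sh k (\<psi> m)) = (if k = 0 \<and> l = m then 1 else 0)" for k
  proof -
    have c: "l \<in> {1, 2} \<or> l \<in> {3, 4} \<or> l \<in> {5, 6}" "m \<in> {1, 2} \<or> m \<in> {3, 4} \<or> m \<in> {5, 6}"
      using assms unfolding atLeastAtMost_psi by blast+
    consider "l \<in> {1, 2}" "m \<in> {1, 2}" | "l \<in> {3, 4}" "m \<in> {3, 4}" | "l \<in> {5, 6}" "m \<in> {5, 6}"
      | "l \<in> {1, 2}" "m \<in> {3, 4}" | "l \<in> {5, 6}" "m \<in> {1, 2}" | "l \<in> {5, 6}" "m \<in> {3, 4}"
      | "m \<in> {1, 2}" "l \<in> {3, 4}" | "m \<in> {5, 6}" "l \<in> {1, 2}" | "m \<in> {5, 6}" "l \<in> {3, 4}"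
      using c by blast
    then show ?thesis
    proof cases
      case 1 then show ?thesis by (rule p12_12)
    next
      case 2 then show ?thesis by (rule p34_34)
    next
      case 3 then show ?thesis by (rule p56_56)
    next
      case 4 then show ?thesis using p12_34[OF 4] by auto
    next
      case 5 then show ?thesis using p56_12[OF 5] by auto
    next
      case 6 then show ?thesis using p56_34[OF 6] by auto
    next
      case 7 then show ?thesis using p12_34[OF 7] swap[of l k m] by auto
    next
      case 8 then show ?thesis using p56_12[OF 8] swap[of l k m] by auto
    next
      case 9 then show ?thesis using p56_34[OF 9] swap[of l k m] by auto
    qed
  qed
  then show ?thesis by (simp add: ip_sh_sh)
qed

end

subsection \<open>The functions on the interval\<close>

lemma ip_cut01_supp:
  assumes "F \<in> supp_in (-1) 1" "H \<in> supp_in 0 b"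
  shows "ip (cut01 F) H = ip F H"
proof -
  have "cut01 F x * H x = F x * H x" for x
    using supp_inD[OF assms(1), of x] supp_inD[OF assms(2), of x]
    by (cases "x < 0"; cases "1 < x"; simp add: cut01_def)
  then show ?thesis by (simp only: ip_eq)
qed

text \<open>At the right end the generators reappear with centre \<open>N\<close>, cut to
  \<open>[N - 1, N]\<close>; a function supported to the left of \<open>N\<close> does not see the
  cut.\<close>

lemma ip_sh_cut01_supp:
  assumes "F \<in> supp_in (-1) 1" "H \<in> supp_in a (of_int N)"
  shows "ip (sh (N - 1) (cut01 (sh 1 F))) H = ip (sh N F) H"
proof -
  have "sh (N - 1) (cut01 (sh 1 F)) x * H x = sh N F x * H x" for x
    using supp_inD[OF assms(1), of "x - of_int N"] supp_inD[OF assms(2), of x]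
    by (cases "x < of_int N - 1"; cases "of_int N < x"; simp add: cut01_def sh_def indicator_def algebra_simps)
  then show ?thesis by (simp only: ip_eq)
qed

lemma orthonormal_independent:
  assumes "finite S" "S \<subseteq> tame" "\<And>f. f \<in> S \<Longrightarrow> ip f f = 1"
    and "\<And>f g. f \<in> S \<Longrightarrow> g \<in> S \<Longrightarrow> f \<noteq> g \<Longrightarrow> ip f g = 0"
  shows "fun_vs.independent S"
proof (rule fun_vs.independent_if_scalars_zero[OF assms(1)])
  fix c g assume s: "(\<Sum>f\<in>S. fscale (c f) f) = 0" and g: "g \<in> S"
  have "ip (\<Sum>f\<in>S. fscale (c f) f) g = (\<Sum>f\<in>S. ip (fscale (c f) f) g)"
    using assms(2) g by (intro ip_sum_left) auto
  also have "\<dots> = (\<Sum>f\<in>S. if f = g then c g else 0)"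
    using assms(3,4) g by (intro sum.cong) (auto simp: ip_scale_left)
  also have "\<dots> = c g"
    using g assms(1) by simp
  finally show "c g = 0"
    unfolding s by simp
qed

text \<open>Otherwise an element of \<open>T\<close> could be adjoined to \<open>S\<close>, giving
  more independent elements in the span of \<open>T\<close> than \<open>T\<close> has.\<close>

lemma span_eq_of_card:
  assumes "finite T" "fun_vs.independent S" "S \<subseteq> fun_vs.span T" "card T \<le> card S"
  shows "T \<subseteq> fun_vs.span S"
proof
  fix f assume f: "f \<in> T"
  show "f \<in> fun_vs.span S"
  proof (rule ccontr)
    assume "f \<notin> fun_vs.span S"
    then have notin: "f \<notin> S"
      using fun_vs.span_base by blast
    have ind: "fun_vs.independent (insert f S)"
      by (rule fun_vs.independent_insertI[OF \<open>f \<notin> fun_vs.span S\<close> assms(2)])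
    have sub: "insert f S \<subseteq> fun_vs.span T"
      using assms(3) fun_vs.span_base[OF f] by blast
    have "finite (insert f S) \<and> card (insert f S) \<le> card T"
      by (rule fun_vs.independent_span_bound[OF assms(1) ind sub])
    then show False
      using notin assms(4) by auto
  qed
qed

section \<open>The boundary functions\<close>

locale interval = wavelets +
  fixes \<psi>L \<psi>Rt :: "nat \<Rightarrow> real \<Rightarrow> real"
  assumes boundary: "boundary_generators \<phi> \<psi> \<psi>L \<psi>Rt"
begin

text \<open>Up to a factor the only combination of the outer generators that vanishes at 0, as
  \<open>\<phi> 5 0\<close> is not 0. Both \<open>\<phi>L\<close> and \<open>\<phi>Rt\<close> are
  cut from it.\<close>

definition F0 :: "real \<Rightarrow> real" where "F0 = fscale (\<phi> 6 0) (\<phi> 5) - fscale (\<phi> 5 0) (\<phi> 6)"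

lemma F0_span: "F0 \<in> fun_vs.span {\<phi> 5, \<phi> 6}"
  unfolding F0_def by (intro fun_vs.span_diff fun_vs.span_scale) (auto intro: fun_vs.span_base)

lemma span_phi_outer:
  assumes "f \<in> fun_vs.span {\<phi> 5, \<phi> 6}"
  shows "f \<in> fun_vs.span (D ` Tset \<phi> (-2) 2)" "f \<in> splines 2"
  by (rule span_trans_subset[OF assms], use phi_outer_D_Tset in auto)
    (rule span_in_subspace[OF assms _ subspace_splines], use phi_outer_props in auto)

lemma F0_props: "F0 \<in> tame" "F0 \<in> splines 2" "F0 \<in> supp_in (-1) 1" "F0 0 = 0"
  using span_D_Tset[OF span_phi_outer(1)[OF F0_span]] span_phi_outer(2)[OF F0_span]
  by (auto simp: F0_def)

text \<open>The derivative at 0 is \<open>- \<phi> 5 0\<close> times that of \<open>\<phi> 6\<close>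
  and hence not 0, so neither half of \<open>F0\<close> is zero and both boundary functions can be
  normalized.\<close>

lemma F0_not_zero:
  assumes "a < b" "0 = a \<or> 0 = b" "\<And>x. x \<in> {a<..<b} \<Longrightarrow> F0 x = 0"
  shows False
proof -
  have eq: "F0 = fscale (\<phi> 6 0) (\<phi> 5) + fscale (- \<phi> 5 0) (\<phi> 6)"
    by (auto simp: F0_def fun_eq_iff)
  have c: "\<phi> 5 \<in> c1" "\<phi> 6 \<in> c1"
    by (rule subsetD[OF splines_c1 phi_splines]; simp)+
  have "F0 \<in> c1"
    using F0_props(2) splines_c1 by blast
  then have "deriv F0 0 = 0"
    by (rule c1_zero_at_end(2)[OF _ assms(1) assms(3) assms(2)])
  then have "\<phi> 6 0 * deriv (\<phi> 5) 0 + - \<phi> 5 0 * deriv (\<phi> 6) 0 = 0"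
    unfolding eq by (simp only: c1_deriv_add c1_deriv_scale c1_scale c)
  then show False
    using phi_5_jet phi_6_jet by simp
qed

lemma cut01_F0_norm: "ip (cut01 F0) (cut01 F0) \<noteq> 0" "ip (cut01 (sh 1 F0)) (cut01 (sh 1 F0)) \<noteq> 0"
proof -
  have c: "continuous_on S F0" "continuous_on S (sh 1 F0)" for S
    using F0_props(2) splines_sh[OF F0_props(2), of 1] splines_c1 c1_continuous by blast+
  have eq: "cut01 f x = f x" if "x \<in> {0<..<1}" for f x
    using that by (simp add: cut01_def)
  have cc: "continuous_on {0<..<1} (cut01 F0)" "continuous_on {0<..<1} (cut01 (sh 1 F0))"
    by (rule continuous_on_eq[OF c(1)], simp add: eq, rule continuous_on_eq[OF c(2)], simp add: eq)
  show "ip (cut01 F0) (cut01 F0) \<noteq> 0"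
  proof
    assume z: "ip (cut01 F0) (cut01 F0) = 0"
    have "F0 x = 0" if "x \<in> {0<..<1}" for x
      using ip_self_zero_open[OF tame_cut01[OF F0_props(1)] z open_greaterThanLessThan cc(1) that] eq[OF that] by simp
    then show False by (rule F0_not_zero[of 0 1, rotated 2]) auto
  qed
  show "ip (cut01 (sh 1 F0)) (cut01 (sh 1 F0)) \<noteq> 0"
  proof
    assume z: "ip (cut01 (sh 1 F0)) (cut01 (sh 1 F0)) = 0"
    have "F0 x = 0" if "x \<in> {-1<..<0}" for x
    proof -
      have x: "x + 1 \<in> {0<..<1}" using that by auto
      show ?thesis
        using ip_self_zero_open[OF tame_cut01[OF tame_sh[OF F0_props(1)]] z open_greaterThanLessThan cc(2) x] eq[OF x, of "sh 1 F0"]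
        by (simp add: sh_def)
    qed
    then show False by (rule F0_not_zero[of "-1" 0, rotated 2]) auto
  qed
qed

lemma phiL_eq: "\<phi>L \<phi> = normalize_fun (cut01 F0)"
  unfolding \<phi>L_def by (rule arg_cong[of _ _ "\<lambda>f. normalize_fun (cut01 f)"]) (simp add: F0_def fun_eq_iff)

lemma phiRt_eq: "\<phi>Rt \<phi> = normalize_fun (cut01 (sh 1 F0))"
  unfolding \<phi>Rt_def by (rule arg_cong[of _ _ "\<lambda>f. normalize_fun (cut01 f)"]) (simp add: F0_def sh_def fun_eq_iff)

lemma phiL:
  obtains F where "F \<in> fun_vs.span {\<phi> 5, \<phi> 6}" "F 0 = 0" "\<phi>L \<phi> = cut01 F"
proof (rule that[of "fscale (1 / sqrt (ip (cut01 F0) (cut01 F0))) F0"])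
  show "\<phi>L \<phi> = cut01 (fscale (1 / sqrt (ip (cut01 F0) (cut01 F0))) F0)"
    unfolding phiL_eq normalize_fun_eq cut01_scale ..
qed (use F0_props(4) in \<open>auto intro: fun_vs.span_scale F0_span\<close>)

lemma phiRt:
  obtains F where "F \<in> fun_vs.span {\<phi> 5, \<phi> 6}" "F 0 = 0" "\<phi>Rt \<phi> = cut01 (sh 1 F)"
proof (rule that[of "fscale (1 / sqrt (ip (cut01 (sh 1 F0)) (cut01 (sh 1 F0)))) F0"])
  show "\<phi>Rt \<phi> = cut01 (sh 1 (fscale (1 / sqrt (ip (cut01 (sh 1 F0)) (cut01 (sh 1 F0)))) F0))"
    unfolding phiRt_eq normalize_fun_eq cut01_scale sh_scale ..
qed (use F0_props(4) in \<open>auto intro: fun_vs.span_scale F0_span\<close>)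

lemma phiL_norm: "ip (\<phi>L \<phi>) (\<phi>L \<phi>) = 1" and phiRt_norm: "ip (\<phi>Rt \<phi>) (\<phi>Rt \<phi>) = 1"
  unfolding phiL_eq phiRt_eq by (intro ip_normalize_fun cut01_F0_norm)+

lemma psiL_basis: "ip (\<psi>L 1) (\<psi>L 1) = 1" "ip (\<psi>L 2) (\<psi>L 2) = 1" "ip (\<psi>L 1) (\<psi>L 2) = 0" "ip (\<psi>L 2) (\<psi>L 1) = 0"
  and psiRt_basis: "ip (\<psi>Rt 1) (\<psi>Rt 1) = 1" "ip (\<psi>Rt 2) (\<psi>Rt 2) = 1" "ip (\<psi>Rt 1) (\<psi>Rt 2) = 0" "ip (\<psi>Rt 2) (\<psi>Rt 1) = 0"
  using boundary orthonormal_basis2D(1-4) unfolding boundary_generators_def by blast+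

lemma sum_psi_span: "(\<Sum>j=1..4::nat. fscale (b j) (\<psi> (j + 2))) \<in> fun_vs.span (\<psi> ` {3..6})"
  by (intro fun_vs.span_sum fun_vs.span_scale fun_vs.span_base) auto

lemma psiL:
  assumes "i \<in> {1, 2}"
  obtains G where "G \<in> fun_vs.span (\<psi> ` {3..6})" "G 0 = 0" "\<psi>L i = cut01 G" "ip (\<phi>L \<phi>) (\<psi>L i) = 0"
proof -
  have "\<psi>L i \<in> {g. \<exists>b :: nat \<Rightarrow> real. g = cut01 (\<lambda>x. \<Sum>j=1..4. b j * \<psi> (j + 2) x) \<and>
          (\<Sum>j=1..4. b j * \<psi> (j + 2) 0) = 0 \<and> ip (\<phi>L \<phi>) g = 0}"
    using boundary assms orthonormal_basis2D(5,6) unfolding boundary_generators_def by blast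
  then obtain b :: "nat \<Rightarrow> real" where b: "\<psi>L i = cut01 (\<lambda>x. \<Sum>j=1..4. b j * \<psi> (j + 2) x)"
    "(\<Sum>j=1..4. b j * \<psi> (j + 2) 0) = 0" "ip (\<phi>L \<phi>) (\<psi>L i) = 0"
    by blast
  have eq: "(\<lambda>x. \<Sum>j=1..4. b j * \<psi> (j + 2) x) = (\<Sum>j=1..4::nat. fscale (b j) (\<psi> (j + 2)))"
    by (simp add: fun_eq_iff sum_fun_apply)
  show ?thesis
    by (rule that[OF sum_psi_span[of b] _ b(1)[unfolded eq] b(3)]) (use b(2) in \<open>simp add: sum_fun_apply\<close>)
qed

lemma psiRt:
  assumes "i \<in> {1, 2}"
  obtains G where "G \<in> fun_vs.span (\<psi> ` {3..6})" "G 0 = 0" "\<psi>Rt i = cut01 (sh 1 G)" "ip (\<phi>Rt \<phi>) (\<psi>Rt i) = 0"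
proof -
  have "\<psi>Rt i \<in> {g. \<exists>b :: nat \<Rightarrow> real. g = cut01 (\<lambda>x. \<Sum>j=1..4. b j * \<psi> (j + 2) (x - 1)) \<and>
          (\<Sum>j=1..4. b j * \<psi> (j + 2) 0) = 0 \<and> ip (\<phi>Rt \<phi>) g = 0}"
    using boundary assms orthonormal_basis2D(5,6) unfolding boundary_generators_def by blast
  then obtain b :: "nat \<Rightarrow> real" where b: "\<psi>Rt i = cut01 (\<lambda>x. \<Sum>j=1..4. b j * \<psi> (j + 2) (x - 1))"
    "(\<Sum>j=1..4. b j * \<psi> (j + 2) 0) = 0" "ip (\<phi>Rt \<phi>) (\<psi>Rt i) = 0"
    by blast
  have eq: "(\<lambda>x. \<Sum>j=1..4. b j * \<psi> (j + 2) (x - 1)) = sh 1 (\<Sum>j=1..4::nat. fscale (b j) (\<psi> (j + 2)))"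
    by (simp add: fun_eq_iff sum_fun_apply sh_def)
  show ?thesis
    by (rule that[OF sum_psi_span[of b] _ b(1)[unfolded eq] b(3)]) (use b(2) in \<open>simp add: sum_fun_apply\<close>)
qed

lemma span_psi_outer:
  assumes "f \<in> fun_vs.span (\<psi> ` {3..6})"
  shows "f \<in> fun_vs.span (D ` Tset \<phi> (-2) 2)"
  by (rule span_trans_subset[OF assms]) (use psi_span(2) in auto)

text \<open>The scaling functions of level \<open>j\<close>, rescaled to \<open>[0, N]\<close> with
  \<open>N = 2^j\<close>: \<open>4 * N\<close> inner ones, \<open>2 * (N - 1)\<close> straddling an
  interior integer and one at each end, \<open>6 * N\<close> together.\<close>

definition Vint :: "int \<Rightarrow> (real \<Rightarrow> real) set" where
  "Vint N = {\<phi>L \<phi>, sh (N - 1) (\<phi>Rt \<phi>)} \<union> Tset \<phi> 0 N"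

text \<open>The functions \<open>\<psi>I j\<close> rescaled to the interval \<open>[0, N]\<close> for \<open>N = 2\<^sup>j\<close>; the index of the
  wavelet is kept in the set in order to recover it from shift and type.\<close>

definition Wint :: "int \<Rightarrow> (int \<times> (real \<Rightarrow> real)) set" where
  "Wint N = {(int i, \<psi>L i) | i. i \<in> {1, 2}} \<union>
     {(2 + 6 * (if l \<le> 2 then q else q - 1) + int l, sh q (\<psi> l)) | q l.
        l \<in> {1, 2} \<and> 0 \<le> q \<and> q < N \<or> l \<in> {3..6} \<and> 0 < q \<and> q < N} \<union>
     {(6 * N - 2 + int i, sh (N - 1) (\<psi>Rt i)) | i. i \<in> {1, 2}}"

lemma psiI_Wint:
  assumes "k \<in> {1..6 * 2 ^ j}"
  obtains w where "(int k, w) \<in> Wint (2 ^ j)" "\<psi>I \<psi> \<psi>L \<psi>Rt j k = dil j 0 w"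
proof -
  consider "k \<in> {1, 2}" | "3 \<le> k" "k \<le> 6 * 2 ^ j - 2" | "6 * 2 ^ j - 2 < k" "3 \<le> k"
    using assms by fastforce
  then show ?thesis
  proof cases
    case 1
    then show ?thesis
      by (intro that[of "\<psi>L k"]) (auto simp: Wint_def \<psi>I_def)
  next
    case 2
    obtain q l where ql: "int k - 2 = 6 * q + int l" "l \<in> {1..6}" by (rule index_6)
    let ?q = "if l \<le> 2 then q else q + 1"
    have k: "int k \<le> 6 * 2 ^ j - 2" "3 \<le> int k"
    proof -
      have "k + 2 \<le> 6 * 2 ^ j" using 2 by linarith
      then have "int (k + 2) \<le> int (6 * 2 ^ j)" by (simp only: of_nat_le_iff)
      then show "int k \<le> 6 * 2 ^ j - 2" by simp
      show "3 \<le> int k" using 2 by simp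
    qed
    have "\<psi>I \<psi> \<psi>L \<psi>Rt j k = \<psi>R \<psi> j (int k - 2)"
      using 2 by (simp add: \<psi>I_def)
    also have "\<dots> = dil j 0 (sh ?q (\<psi> l))"
      unfolding ql(1) \<psi>R_eq[OF ql(2)] by (rule dil_eq)
    finally have eq: "\<psi>I \<psi> \<psi>L \<psi>Rt j k = dil j 0 (sh ?q (\<psi> l))" .
    have "l \<in> {1, 2} \<and> 0 \<le> ?q \<and> ?q < 2 ^ j \<or> l \<in> {3..6} \<and> 0 < ?q \<and> ?q < 2 ^ j"
      using k ql by (cases "l \<le> 2") auto
    moreover have "int k = 2 + 6 * (if l \<le> 2 then ?q else ?q - 1) + int l"
      using ql by auto
    ultimately have "(int k, sh ?q (\<psi> l)) \<in> Wint (2 ^ j)"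
      unfolding Wint_def by blast
    then show ?thesis using eq by (rule that)
  next
    case 3
    define i where "i = k + 2 - 6 * 2 ^ j"
    have i: "i \<in> {1, 2}"
      using 3 assms by (auto simp: i_def)
    have "\<psi>I \<psi> \<psi>L \<psi>Rt j k = dil j (2 ^ j - 1) (\<psi>Rt i)"
      using 3 by (simp add: \<psi>I_def i_def)
    also have "\<dots> = dil j 0 (sh (2 ^ j - 1) (\<psi>Rt i))"
      by (rule dil_eq)
    finally have eq: "\<psi>I \<psi> \<psi>L \<psi>Rt j k = dil j 0 (sh (2 ^ j - 1) (\<psi>Rt i))" .
    have "k + 2 = 6 * 2 ^ j + i"
      using 3 assms by (auto simp: i_def)
    then have "int (k + 2) = int (6 * 2 ^ j + i)" by (simp only:)
    then have "int k = 6 * 2 ^ j - 2 + int i" by simp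
    then have "(int k, sh (2 ^ j - 1) (\<psi>Rt i)) \<in> Wint (2 ^ j)"
      unfolding Wint_def using i by blast
    then show ?thesis using eq by (rule that)
  qed
qed

lemma WintE:
  assumes "(n, w) \<in> Wint N"
  obtains (left) i where "n = int i" "w = \<psi>L i" "i \<in> {1, 2}"
    | (inner) q l where "n = 2 + 6 * (if l \<le> 2 then q else q - 1) + int l" "w = sh q (\<psi> l)"
        "l \<in> {1, 2} \<and> 0 \<le> q \<and> q < N \<or> l \<in> {3..6} \<and> 0 < q \<and> q < N" "l \<in> {1..6}"
    | (right) i where "n = 6 * N - 2 + int i" "w = sh (N - 1) (\<psi>Rt i)" "i \<in> {1, 2}"
  using assms unfolding Wint_def by fastforce

lemma VintE:
  assumes "v \<in> Vint N"
  obtains (left) "v = \<phi>L \<phi>"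
    | (inner) k l where "v = sh k (\<phi> l)" "l \<in> {1..4} \<and> 0 \<le> k \<and> k < N \<or> l \<in> {5, 6} \<and> 0 < k \<and> k < N" "l \<in> {1..6}"
    | (right) "v = sh (N - 1) (\<phi>Rt \<phi>)"
  using assms unfolding Vint_def Tset_def by fastforce

section \<open>Orthogonality relations on the interval from 0 to \<open>N\<close>\<close>

lemma sh_phi_supp:
  assumes "l \<in> {1..4} \<and> 0 \<le> k \<and> k < N \<or> l \<in> {5, 6} \<and> 0 < k \<and> k < N"
  shows "sh k (\<phi> l) \<in> supp_in 0 (of_int N)"
proof -
  have "sh k (\<phi> l) \<in> Tset \<phi> 0 N"
    unfolding Tset_def using assms by blast
  then show ?thesis using Tset_supp[of 0 N] by auto
qed

lemma sh_psi_supp: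
  assumes "l \<in> {1, 2} \<and> 0 \<le> k \<and> k < N \<or> l \<in> {3..6} \<and> 0 < k \<and> k < N"
  shows "sh k (\<psi> l) \<in> supp_in 0 (of_int N)"
  using assms
proof
  assume *: "l \<in> {1, 2} \<and> 0 \<le> k \<and> k < N"
  then have "0 \<le> real_of_int k" "real_of_int k + 1 \<le> of_int N" by linarith+
  then show ?thesis using * by (intro supp_in_sh[OF psi_12_supp]) auto
next
  assume *: "l \<in> {3..6} \<and> 0 < k \<and> k < N"
  then have "0 \<le> -1 + real_of_int k" "real_of_int k + 1 \<le> of_int N" by linarith+
  then show ?thesis using * by (intro supp_in_sh[OF psi_props(3)]) auto
qed

lemma right_supp: "1 \<le> N \<Longrightarrow> f = cut01 g \<Longrightarrow> sh (N - 1) f \<in> supp_in 0 (of_int N)"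
  by (auto intro!: supp_in_sh[of _ 0 1])

lemma left_supp: "1 \<le> N \<Longrightarrow> f = cut01 g \<Longrightarrow> f \<in> supp_in 0 (of_int N)"
  using supp_in_mono[OF supp_in_cut01, of 0 "of_int N" g] by simp

lemma span_psi_outer_props:
  assumes "G \<in> fun_vs.span (\<psi> ` {3..6})"
  shows "G \<in> tame" "G \<in> splines 3" "G \<in> supp_in (-1) 1"
  using span_D_Tset[OF span_psi_outer[OF assms]] by auto

lemma span_phi_outer_props:
  assumes "F \<in> fun_vs.span {\<phi> 5, \<phi> 6}"
  shows "F \<in> tame" "F \<in> splines 3" "F \<in> supp_in (-1) 1"
  using span_D_Tset[OF span_phi_outer(1)[OF assms]] by auto

lemma span_psi_phi_orth:
  assumes "G \<in> fun_vs.span (\<psi> ` {3..6})"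
  shows "l \<in> {1..6} \<Longrightarrow> ip (sh i G) (sh j (\<phi> l)) = 0"
    "F \<in> fun_vs.span {\<phi> 5, \<phi> 6} \<Longrightarrow> ip (sh i G) (sh j F) = 0"
proof -
  have 1: "ip G (sh k (\<phi> l)) = 0" if "l \<in> {1..6}" for k l
    by (rule ip_span_zero_left[OF assms]) (use that psi_phi psi_props phi_tame in auto)
  then show "l \<in> {1..6} \<Longrightarrow> ip (sh i G) (sh j (\<phi> l)) = 0"
    by (simp add: ip_sh_sh)
  assume F: "F \<in> fun_vs.span {\<phi> 5, \<phi> 6}"
  have "ip (sh k G) F = 0" for k
    by (rule ip_span_zero_right[OF F]) (use 1 span_psi_outer_props(1)[OF assms] phi_outer_props in \<open>auto simp: ip_sh_left\<close>)
  from this[of "i - j"] show "ip (sh i G) (sh j F) = 0"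
    using ip_sh[of j "sh (i - j) G" F] by simp
qed

lemma span_phi_psi_orth:
  assumes "F \<in> fun_vs.span {\<phi> 5, \<phi> 6}" "l \<in> {1..6}"
  shows "ip (sh i F) (sh j (\<psi> l)) = 0"
proof -
  have "ip F (sh k (\<psi> l)) = 0" for k
    by (rule ip_span_zero_left[OF assms(1)])
      (use assms(2) psi_phi[OF assms(2), of 5 "- k"] psi_phi[OF assms(2), of 6 "- k"] psi_props phi_outer_props
        in \<open>auto simp: ip_commute[of _ "sh k (\<psi> l)"] ip_sh_left\<close>)
  then show ?thesis by (simp add: ip_sh_sh)
qed

text \<open>For \<open>l\<close> in \<open>{3..6}\<close> different positions are required, since
  \<open>G\<close> is itself a combination of these wavelets.\<close>

lemma span_psi_psi_orth:
  assumes "G \<in> fun_vs.span (\<psi> ` {3..6})" "l \<in> {1..6}" "l \<in> {1, 2} \<or> i \<noteq> j"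
  shows "ip (sh i G) (sh j (\<psi> l)) = 0"
proof -
  have "ip G (sh (j - i) (\<psi> l)) = 0"
  proof (rule ip_span_zero_left[OF assms(1)])
    fix g assume "g \<in> \<psi> ` {3..6}"
    then obtain m where "m \<in> {3..6}" "g = \<psi> m" by blast
    then show "ip g (sh (j - i) (\<psi> l)) = 0"
      using psi_orthonormal[of m l 0 "j - i"] assms(2,3) by auto
  qed (use assms(2) psi_props in auto)
  then show ?thesis by (simp add: ip_sh_sh)
qed

lemma span_psi_span_psi_orth:
  assumes "G \<in> fun_vs.span (\<psi> ` {3..6})" "G' \<in> fun_vs.span (\<psi> ` {3..6})" "j \<noteq> 0"
  shows "ip G (sh j G') = 0"
proof -
  have "sh j G' \<in> fun_vs.span (sh j ` \<psi> ` {3..6})"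
    by (rule sh_span[OF assms(2)]) (auto intro: fun_vs.span_base)
  then show ?thesis
  proof (rule ip_span_zero_right)
    fix g assume "g \<in> sh j ` \<psi> ` {3..6}"
    then show "ip G g = 0"
      using span_psi_psi_orth[OF assms(1), of _ 0 j] assms(3) by auto
  qed (use span_psi_outer_props[OF assms(1)] psi_props in auto)
qed

lemma Wint_Vint_orth:
  assumes "(n, w) \<in> Wint N" "v \<in> Vint N" "1 \<le> N"
  shows "ip w v = 0"
proof -
  obtain FL where FL: "FL \<in> fun_vs.span {\<phi> 5, \<phi> 6}" "\<phi>L \<phi> = cut01 FL" using phiL by metis
  obtain FR where FR: "FR \<in> fun_vs.span {\<phi> 5, \<phi> 6}" "\<phi>Rt \<phi> = cut01 (sh 1 FR)" using phiRt by metis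
  note FLs = span_phi_outer_props(3)[OF FL(1)] and FRs = span_phi_outer_props(3)[OF FR(1)]
  from assms(1) show ?thesis
  proof (cases rule: WintE)
    case (left i)
    obtain G where G: "G \<in> fun_vs.span (\<psi> ` {3..6})" "\<psi>L i = cut01 G" "ip (\<phi>L \<phi>) (\<psi>L i) = 0"
      using psiL[OF left(3)] by metis
    note Gs = span_psi_outer_props(3)[OF G(1)]
    from assms(2) show ?thesis
    proof (cases rule: VintE)
      case left
      then show ?thesis using G(3) \<open>w = \<psi>L i\<close> by (simp add: ip_commute)
    next
      case (inner k l)
      then show ?thesis
        unfolding \<open>w = \<psi>L i\<close> G(2) using ip_cut01_supp[OF Gs sh_phi_supp[OF inner(2)]]
          span_psi_phi_orth(1)[OF G(1) inner(3), of 0 k] by simp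
    next
      case right
      \<comment> \<open>For \<open>N = 1\<close> both functions are cut to the same interval from
        generators at its opposite ends. The cuts are removed one at a time: the left one because
        \<open>v\<close> is supported in \<open>[0, N]\<close>, the right one because
        \<open>G\<close> vanishes beyond \<open>N\<close>.\<close>
      have "ip w v = ip (cut01 G) v" by (simp add: \<open>w = \<psi>L i\<close> G(2))
      also have "\<dots> = ip G v"
        unfolding right by (rule ip_cut01_supp[OF Gs right_supp[OF assms(3) FR(2)]])
      also have "\<dots> = ip (sh N FR) G"
        unfolding right FR(2) ip_commute[of G] using Gs assms(3)
        by (intro ip_sh_cut01_supp[OF FRs, of _ "-1"]) (auto elim!: supp_in_mono)
      also have "\<dots> = 0"
        using span_psi_phi_orth(2)[OF G(1) FR(1), of 0 N] by (simp add: ip_commute)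
      finally show ?thesis .
    qed
  next
    case (inner q m)
    note ms = sh_psi_supp[OF inner(3)]
    from assms(2) show ?thesis
    proof (cases rule: VintE)
      case left
      then show ?thesis
        unfolding \<open>w = _\<close> left FL(2) ip_commute[of "sh q (\<psi> m)"]
        using ip_cut01_supp[OF FLs ms] span_phi_psi_orth[OF FL(1) inner(4), of 0 q] by simp
    next
      case (inner k l)
      then show ?thesis
        using psi_phi[OF \<open>m \<in> {1..6}\<close> inner(3), of "k - q"] by (simp add: \<open>w = _\<close> ip_sh_sh)
    next
      case right
      then show ?thesis
        unfolding \<open>w = _\<close> right FR(2) ip_commute[of "sh q (\<psi> m)"]
        using ip_sh_cut01_supp[OF FRs ms] span_phi_psi_orth[OF FR(1) inner(4), of N q] by simp
    qed
  next
    case (right i)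
    obtain G where G: "G \<in> fun_vs.span (\<psi> ` {3..6})" "\<psi>Rt i = cut01 (sh 1 G)" "ip (\<phi>Rt \<phi>) (\<psi>Rt i) = 0"
      using psiRt[OF right(3)] by metis
    note Gs = span_psi_outer_props(3)[OF G(1)]
    from assms(2) show ?thesis
    proof (cases rule: VintE)
      case left
      have "ip w v = ip (cut01 FL) w" by (simp add: left FL(2) ip_commute)
      also have "\<dots> = ip FL w"
        unfolding \<open>w = _\<close> by (rule ip_cut01_supp[OF FLs right_supp[OF assms(3) G(2)]])
      also have "\<dots> = ip (sh N G) FL"
        unfolding \<open>w = _\<close> G(2) ip_commute[of FL] using FLs assms(3)
        by (intro ip_sh_cut01_supp[OF Gs, of _ "-1"]) (auto elim!: supp_in_mono)
      also have "\<dots> = 0"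
        using span_psi_phi_orth(2)[OF G(1) FL(1), of N 0] by simp
      finally show ?thesis .
    next
      case (inner k l)
      then show ?thesis
        unfolding \<open>w = _\<close> G(2) using ip_sh_cut01_supp[OF Gs sh_phi_supp[OF inner(2)]]
          span_psi_phi_orth(1)[OF G(1) inner(3), of N k] by simp
    next
      case right
      then show ?thesis using G(3) \<open>w = _\<close> by (simp add: ip_commute)
    qed
  qed
qed

lemma Wint_orthonormal:
  assumes "(n, w) \<in> Wint N" "(n', w') \<in> Wint N" "1 \<le> N"
  shows "ip w w' = (if n = n' then 1 else 0)"
proof -
  have LI: "ip (\<psi>L i) (sh q (\<psi> l)) = 0"
    if i: "i \<in> {1, 2}" and that: "l \<in> {1, 2} \<and> 0 \<le> q \<and> q < N \<or> l \<in> {3..6} \<and> 0 < q \<and> q < N" "l \<in> {1..6}" for i q l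
  proof -
    obtain G where G: "G \<in> fun_vs.span (\<psi> ` {3..6})" "\<psi>L i = cut01 G"
      using psiL[OF i] by metis
    show ?thesis
      unfolding G(2) ip_cut01_supp[OF span_psi_outer_props(3)[OF G(1)] sh_psi_supp[OF that(1)]]
      using span_psi_psi_orth[OF G(1) that(2), of 0 q] that(1) by auto
  qed
  have RI: "ip (sh (N - 1) (\<psi>Rt i)) (sh q (\<psi> l)) = 0"
    if i: "i \<in> {1, 2}" and that: "l \<in> {1, 2} \<and> 0 \<le> q \<and> q < N \<or> l \<in> {3..6} \<and> 0 < q \<and> q < N" "l \<in> {1..6}" for i q l
  proof -
    obtain G where G: "G \<in> fun_vs.span (\<psi> ` {3..6})" "\<psi>Rt i = cut01 (sh 1 G)"
      using psiRt[OF i] by metis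
    show ?thesis
      unfolding G(2) ip_sh_cut01_supp[OF span_psi_outer_props(3)[OF G(1)] sh_psi_supp[OF that(1)]]
      using span_psi_psi_orth[OF G(1) that(2), of N q] that(1) by auto
  qed
  have LR: "ip (\<psi>L i) (sh (N - 1) (\<psi>Rt i')) = 0" if i: "i \<in> {1, 2}" and i': "i' \<in> {1, 2}" for i i'
  proof -
    obtain G where G: "G \<in> fun_vs.span (\<psi> ` {3..6})" "\<psi>L i = cut01 G"
      using psiL[OF i] by metis
    obtain G' where G': "G' \<in> fun_vs.span (\<psi> ` {3..6})" "\<psi>Rt i' = cut01 (sh 1 G')"
      using psiRt[OF i'] by metis
    note Gs = span_psi_outer_props(3)[OF G(1)] and Gs' = span_psi_outer_props(3)[OF G'(1)]
    have "ip (\<psi>L i) (sh (N - 1) (\<psi>Rt i')) = ip G (sh (N - 1) (\<psi>Rt i'))"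
      unfolding G(2) by (rule ip_cut01_supp[OF Gs right_supp[OF assms(3) G'(2)]])
    also have "\<dots> = ip (sh N G') G"
      unfolding G'(2) ip_commute[of G] using Gs assms(3)
      by (intro ip_sh_cut01_supp[OF Gs', of _ "-1"]) (auto elim!: supp_in_mono)
    also have "\<dots> = 0"
      using span_psi_span_psi_orth[OF G(1) G'(1), of N] assms(3) by (simp add: ip_commute)
    finally show ?thesis .
  qed
  from assms(1) show ?thesis
  proof (cases rule: WintE)
    case (left i)
    note l = left
    from assms(2) show ?thesis
    proof (cases rule: WintE)
      case (left i')
      then show ?thesis using l psiL_basis by auto
    next
      case (inner q m)
      have "3 \<le> n'" using inner by (cases "m \<le> 2") auto
      then have "n \<noteq> n'" using l by auto
      then show ?thesis using LI[OF l(3) inner(3,4)] by (simp add: l inner(2))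
    next
      case (right i')
      have "n \<le> 2" using l by auto
      moreover have "5 \<le> n'" using right assms(3) by auto
      ultimately have "n \<noteq> n'" by simp
      then show ?thesis using LR[OF l(3) right(3)] by (simp add: l(2) right(2))
    qed
  next
    case (inner q m)
    note l = inner
    from assms(2) show ?thesis
    proof (cases rule: WintE)
      case (left i')
      have "3 \<le> n" using l by (cases "m \<le> 2") auto
      then have "n \<noteq> n'" using left by auto
      then show ?thesis using LI[OF left(3) l(3,4)] by (simp add: l(2) left(2) ip_commute)
    next
      case (inner q' m')
      \<comment> \<open>This undoes the different position conventions of the two kinds of wavelets.
        The index becomes \<open>2 + 6 * a + m\<close> with \<open>m\<close> in
        \<open>{1..6}\<close>, which determines \<open>a\<close> and \<open>m\<close>.\<close>
      define a a' where "a = (if m \<le> 2 then q else q - 1)" and "a' = (if m' \<le> 2 then q' else q' - 1)"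
      have n: "n = 2 + 6 * a + int m" "n' = 2 + 6 * a' + int m'"
        using l(1) inner(1) by (simp_all add: a_def a'_def)
      have "a = a' \<and> m = m'" if "n = n'"
      proof -
        have "\<not> a < a'" "\<not> a' < a"
          using that n l(4) inner(4) by auto
        then show ?thesis using that n by auto
      qed
      then have "q = q' \<and> m = m' \<longleftrightarrow> n = n'"
        using n by (auto simp: a_def a'_def split: if_splits)
      then show ?thesis using psi_orthonormal[OF l(4) inner(4), of q q'] by (simp add: l(2) inner(2))
    next
      case (right i')
      have "n < 6 * N - 1"
        using l by (cases "m \<le> 2") auto
      then have "n \<noteq> n'" using right by auto
      then show ?thesis using RI[OF right(3) l(3,4)] by (simp add: l(2) right(2) ip_commute)
    qed
  next
    case (right i)
    note l = right
    from assms(2) show ?thesis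
    proof (cases rule: WintE)
      case (left i')
      have "n' \<le> 2" using left by auto
      moreover have "5 \<le> n" using l assms(3) by auto
      ultimately have "n \<noteq> n'" by simp
      then show ?thesis using LR[OF left(3) l(3)] by (simp add: l(2) left(2) ip_commute)
    next
      case (inner q m)
      have "n' < 6 * N - 1"
        using inner by (cases "m \<le> 2") auto
      then have "n \<noteq> n'" using l by auto
      then show ?thesis using RI[OF l(3) inner(3,4)] by (simp add: l(2) inner(2))
    next
      case (right i')
      then show ?thesis using l psiRt_basis by auto
    qed
  qed
qed

end

section \<open>From the line to the open unit interval\<close>

lemma inner_on_01:
  assumes "f \<in> supp_in 0 1" "f \<in> borel_measurable borel" "g \<in> borel_measurable borel"
  shows "inner_on {0<..<1} f g = ip f g"
proof -
  have "AE x in lborel. indicator {0<..<1} x *\<^sub>R (f x * g x) = f x * g x"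
    using AE_lborel_singleton[of 0] AE_lborel_singleton[of 1]
  proof eventually_elim
    case (elim x)
    then show ?case
      using supp_inD[OF assms(1), of x] by (cases "x < 0"; cases "1 < x"; simp)
  qed
  moreover have "(\<lambda>x. indicator {0<..<1} x *\<^sub>R (f x * g x)) \<in> borel_measurable lborel"
    "(\<lambda>x. f x * g x) \<in> borel_measurable lborel"
    using assms(2,3) by simp_all
  ultimately have "inner_on {0<..<1} f g = (\<integral>x. f x * g x \<partial>lborel)"
    unfolding inner_on_def set_lebesgue_integral_def by (intro integral_cong_AE)
  then show ?thesis
    by (simp only: ip_eq)
qed

lemma inner_on_01_tame: "f \<in> supp_in 0 1 \<Longrightarrow> f \<in> tame \<Longrightarrow> g \<in> tame \<Longrightarrow> inner_on {0<..<1} f g = ip f g"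
  by (rule inner_on_01) (auto elim: tameE)

lemma tame_L2_on:
  assumes "f \<in> tame" "S \<in> sets borel"
  shows "f \<in> L2_on S"
proof -
  have "f \<in> borel_measurable borel"
    using assms(1) by (auto elim: tameE)
  then have "set_borel_measurable lborel S f"
    unfolding set_borel_measurable_def using assms(2) by measurable
  moreover have "set_integrable lborel S (\<lambda>x. (f x)\<^sup>2)"
    unfolding power2_eq_square set_integrable_def
    by (rule integrable_mult_indicator) (use assms tame_mult_integrable in auto)
  ultimately show ?thesis
    by (simp add: L2_on_def)
qed

lemma diameter_supp01_le:
  assumes "f \<in> supp_in a b" "a \<le> b"
  shows "diameter (supp01 f) \<le> b - a"
proof -
  have "{x \<in> {0..1}. f x \<noteq> 0} \<subseteq> {a..b}"
    using assms(1) by (force simp: supp_in_def not_less)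
  then have "supp01 f \<subseteq> {a..b}"
    unfolding supp01_def by (rule closure_minimal) auto
  then have "diameter (supp01 f) \<le> diameter {a..b}"
    by (rule diameter_subset) auto
  then show ?thesis using assms(2) by simp
qed

lemma supp_in_dil_level: "f \<in> supp_in a b \<Longrightarrow> dil j 0 f \<in> supp_in (a / 2 ^ j) (b / 2 ^ j)"
  using supp_in_dil[of f a b j 0] by simp

context interval
begin

section \<open>Refinement at the end points\<close>

lemma D_cut01_F0:
  "cut01 (D F0) = D (cut01 F0)" "cut01 (sh 1 (D F0)) = D (sh 1 (cut01 (sh 1 F0)))"
proof -
  note s = supp_inD[OF F0_props(3)]
  \<comment> \<open>The support of \<open>D F0\<close> lies in \<open>[-1/2, 1/2]\<close>, so it
    makes no difference whether the function is cut at 1/2 or at 1.\<close>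
  show "cut01 (D F0) = D (cut01 F0)"
  proof
    fix x show "cut01 (D F0) x = D (cut01 F0) x"
      using s[of "2 * x"] by (cases "x < 0"; cases "1 < 2 * x"; simp add: cut01_def dil_def)
  qed
  show "cut01 (sh 1 (D F0)) = D (sh 1 (cut01 (sh 1 F0)))"
  proof
    fix x :: real
    have "2 * x - 2 < -1 \<or> 1 < x \<or> 1 \<le> 2 * x \<and> x \<le> 1" by linarith
    then show "cut01 (sh 1 (D F0)) x = D (sh 1 (cut01 (sh 1 F0))) x"
      using s[of "2 * x - 2"] by (auto simp: cut01_def dil_def sh_def algebra_simps)
  qed
qed

lemma F0_normalized:
  "cut01 F0 = fscale (sqrt (ip (cut01 F0) (cut01 F0))) (\<phi>L \<phi>)"
  "cut01 (sh 1 F0) = fscale (sqrt (ip (cut01 (sh 1 F0)) (cut01 (sh 1 F0)))) (\<phi>Rt \<phi>)"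
  unfolding phiL_eq phiRt_eq by (rule span_normalize_fun[OF cut01_F0_norm(1)] span_normalize_fun[OF cut01_F0_norm(2)])+

lemma left_half_zero:
  assumes "f \<in> fun_vs.span (D ` Tset \<phi> (-2) 0)" "0 \<le> x"
  shows "f x = 0"
proof -
  note f = span_D_Tset[OF assms(1)]
  have "f 0 = 0"
    by (rule c1_zero_at_end(1)[of f 0 1]) (use f(2) splines_c1 supp_inD[OF f(3)] in auto)
  then show ?thesis using supp_inD[OF f(3), of x] assms(2) by (cases "x = 0") auto
qed

lemma right_half_zero:
  assumes "f \<in> fun_vs.span (D ` Tset \<phi> 0 2)" "x \<le> 0"
  shows "f x = 0"
proof -
  note f = span_D_Tset[OF assms(1)]
  have "f 0 = 0"
    by (rule c1_zero_at_end(1)[of f "-1" 0]) (use f(2) splines_c1 supp_inD[OF f(3)] in auto)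
  then show ?thesis using supp_inD[OF f(3), of x] assms(2) by (cases "x = 0") auto
qed

text \<open>Both halves vanish at 0, so \<open>F 0 = 0\<close> leaves just one combination of the
  two straddling functions, a multiple of the dilated \<open>F0\<close>. This is the effect of the
  conditions at 0 in the boundary construction.\<close>

lemma outer_split:
  assumes "F \<in> fun_vs.span (D ` Tset \<phi> (-2) 2)" "F 0 = 0"
  obtains f1 f2 t where "F = f1 + f2 + fscale t (D F0)"
    "f1 \<in> fun_vs.span (D ` Tset \<phi> (-2) 0)" "f2 \<in> fun_vs.span (D ` Tset \<phi> 0 2)"
proof -
  obtain f1 f2 a b where F: "F = f1 + f2 + fscale a (D (\<phi> 5)) + fscale b (D (\<phi> 6))"
    and f1: "f1 \<in> fun_vs.span (D ` Tset \<phi> (-2) 0)" and f2: "f2 \<in> fun_vs.span (D ` Tset \<phi> 0 2)"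
    using Tset_split[OF assms(1)] .
  have "2 powr (1/2) * (a * \<phi> 5 0 + b * \<phi> 6 0) = 0"
    using assms(2) left_half_zero[OF f1, of 0] right_half_zero[OF f2, of 0]
    unfolding F by (simp add: dil_def algebra_simps)
  then have "a * \<phi> 5 0 + b * \<phi> 6 0 = 0" by simp
  then have ab: "b = - (- b / \<phi> 5 0) * \<phi> 5 0" "a = (- b / \<phi> 5 0) * \<phi> 6 0"
    using phi_5_jet(1) by (simp_all add: field_simps add_eq_0_iff2)
  define t where "t = - b / \<phi> 5 0"
  have "fscale a (D (\<phi> 5)) + fscale b (D (\<phi> 6)) = fscale t (D F0)"
    unfolding ab(1)[folded t_def] ab(2)[folded t_def] by (simp add: fun_eq_iff F0_def dil_def algebra_simps)
  then have "F = f1 + f2 + fscale t (D F0)"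
    unfolding F by (simp only: add.assoc)
  then show ?thesis using f1 f2 by (rule that)
qed

text \<open>Cutting removes the left half, keeps the right half and turns \<open>D F0\<close> into a
  multiple of \<open>D (\<phi>L \<phi>)\<close>.\<close>

lemma cut01_left_span:
  assumes "F \<in> fun_vs.span (D ` Tset \<phi> (-2) 2)" "F 0 = 0"
  shows "cut01 F \<in> fun_vs.span (insert (D (\<phi>L \<phi>)) (D ` Tset \<phi> 0 2))"
proof -
  obtain f1 f2 t where F: "F = f1 + f2 + fscale t (D F0)"
    and f1: "f1 \<in> fun_vs.span (D ` Tset \<phi> (-2) 0)" and f2: "f2 \<in> fun_vs.span (D ` Tset \<phi> 0 2)"
    using outer_split[OF assms] .
  have "cut01 f1 = 0"
    using left_half_zero[OF f1] by (auto simp: cut01_def fun_eq_iff indicator_def)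
  moreover have "cut01 f2 = f2"
  proof
    show "cut01 f2 x = f2 x" for x
      using supp_inD[OF span_D_Tset(3)[OF f2], of x] by (cases "x < 0"; cases "1 < x"; simp add: cut01_def)
  qed
  moreover have "D (cut01 F0) = fscale (sqrt (ip (cut01 F0) (cut01 F0))) (D (\<phi>L \<phi>))"
    by (subst F0_normalized(1)) (rule dil_scale)
  ultimately have "cut01 F = f2 + fscale t (fscale (sqrt (ip (cut01 F0) (cut01 F0))) (D (\<phi>L \<phi>)))"
    unfolding F cut01_add cut01_scale D_cut01_F0 by simp
  moreover have "f2 \<in> fun_vs.span (insert (D (\<phi>L \<phi>)) (D ` Tset \<phi> 0 2))"
    using f2 by (rule span_superset_mono) auto
  ultimately show ?thesis
    by (auto intro!: fun_vs.span_add fun_vs.span_scale intro: fun_vs.span_base)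
qed

lemma cut01_right_span:
  assumes "F \<in> fun_vs.span (D ` Tset \<phi> (-2) 2)" "F 0 = 0"
  shows "cut01 (sh 1 F) \<in> fun_vs.span (insert (D (sh 1 (\<phi>Rt \<phi>))) (D ` Tset \<phi> 0 2))"
proof -
  obtain f1 f2 t where F: "F = f1 + f2 + fscale t (D F0)"
    and f1: "f1 \<in> fun_vs.span (D ` Tset \<phi> (-2) 0)" and f2: "f2 \<in> fun_vs.span (D ` Tset \<phi> 0 2)"
    using outer_split[OF assms] .
  have f1s: "sh 1 f1 \<in> fun_vs.span (D ` Tset \<phi> 0 2)"
    using sh_D_Tset_span[OF f1, of 1] by simp
  have "cut01 (sh 1 f2) = 0"
    using right_half_zero[OF f2] by (auto simp: cut01_def sh_def fun_eq_iff indicator_def)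
  moreover have "cut01 (sh 1 f1) = sh 1 f1"
  proof
    show "cut01 (sh 1 f1) x = sh 1 f1 x" for x
      using supp_inD[OF span_D_Tset(3)[OF f1s], of x] by (cases "x < 0"; cases "1 < x"; simp add: cut01_def)
  qed
  moreover have "D (sh 1 (cut01 (sh 1 F0))) = fscale (sqrt (ip (cut01 (sh 1 F0)) (cut01 (sh 1 F0)))) (D (sh 1 (\<phi>Rt \<phi>)))"
    by (subst F0_normalized(2)) (simp only: sh_scale dil_scale)
  ultimately have "cut01 (sh 1 F) = sh 1 f1 + fscale t (fscale (sqrt (ip (cut01 (sh 1 F0)) (cut01 (sh 1 F0)))) (D (sh 1 (\<phi>Rt \<phi>))))"
    unfolding F sh_add sh_scale cut01_add cut01_scale D_cut01_F0 by simp
  moreover have "sh 1 f1 \<in> fun_vs.span (insert (D (sh 1 (\<phi>Rt \<phi>))) (D ` Tset \<phi> 0 2))"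
    using f1s by (rule span_superset_mono) auto
  ultimately show ?thesis
    by (auto intro!: fun_vs.span_add fun_vs.span_scale intro: fun_vs.span_base)
qed

lemma left_Vint:
  assumes "F \<in> fun_vs.span (D ` Tset \<phi> (-2) 2)" "F 0 = 0" "1 \<le> N"
  shows "cut01 F \<in> fun_vs.span (D ` Vint (2 * N))"
proof (rule span_superset_mono[OF cut01_left_span[OF assms(1,2)]])
  have "Tset \<phi> 0 2 \<subseteq> Tset \<phi> 0 (2 * N)"
    using assms(3) by (intro Tset_mono) auto
  then show "insert (D (\<phi>L \<phi>)) (D ` Tset \<phi> 0 2) \<subseteq> D ` Vint (2 * N)"
    by (auto simp: Vint_def)
qed

lemma right_Vint:
  assumes "F \<in> fun_vs.span (D ` Tset \<phi> (-2) 2)" "F 0 = 0" "1 \<le> N"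
  shows "sh (N - 1) (cut01 (sh 1 F)) \<in> fun_vs.span (D ` Vint (2 * N))"
proof (rule sh_span[OF cut01_right_span[OF assms(1,2)]])
  fix s assume "s \<in> insert (D (sh 1 (\<phi>Rt \<phi>))) (D ` Tset \<phi> 0 2)"
  then consider "s = D (sh 1 (\<phi>Rt \<phi>))" | h where "s = D h" "h \<in> Tset \<phi> 0 2" by blast
  then have "sh (N - 1) s \<in> D ` Vint (2 * N)"
  proof cases
    case 1
    \<comment> \<open>The right boundary function of \<open>[0, 2 * N]\<close> is translated by
      \<open>2 * N - 1\<close>.\<close>
    have "2 * (N - 1) + 1 = 2 * N - 1" by simp
    then have "sh (N - 1) s = D (sh (2 * N - 1) (\<phi>Rt \<phi>))"
      by (simp only: 1 sh_D sh_sh)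
    then show ?thesis
      by (auto simp: Vint_def)
  next
    case 2
    have "sh (2 * (N - 1)) h \<in> Tset \<phi> (0 + 2 * (N - 1)) (2 + 2 * (N - 1))"
      by (rule sh_Tset[OF 2(2)])
    then have "sh (2 * (N - 1)) h \<in> Tset \<phi> 0 (2 * N)"
      using Tset_mono[of 0 "0 + 2 * (N - 1)" "2 + 2 * (N - 1)" "2 * N" \<phi>] assms(3) by auto
    then show ?thesis
      by (auto simp: 2 sh_D Vint_def)
  qed
  then show "sh (N - 1) s \<in> fun_vs.span (D ` Vint (2 * N))"
    by (rule fun_vs.span_base)
qed

lemma Vint_refine:
  assumes "v \<in> Vint N" "1 \<le> N"
  shows "v \<in> fun_vs.span (D ` Vint (2 * N))"
  using assms(1)
proof (cases rule: VintE)
  case left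
  obtain F where "F \<in> fun_vs.span {\<phi> 5, \<phi> 6}" "F 0 = 0" "\<phi>L \<phi> = cut01 F" by (rule phiL)
  then show ?thesis
    using left_Vint[OF span_phi_outer(1) _ assms(2)] left by simp
next
  case (inner k l)
  have "v \<in> fun_vs.span (D ` Tset \<phi> 0 (2 * N))"
    unfolding inner(1) using inner(2) by (intro phi_D_Tset) auto
  then show ?thesis
    by (rule span_superset_mono) (auto simp: Vint_def)
next
  case right
  obtain F where "F \<in> fun_vs.span {\<phi> 5, \<phi> 6}" "F 0 = 0" "\<phi>Rt \<phi> = cut01 (sh 1 F)" by (rule phiRt)
  then show ?thesis
    using right_Vint[OF span_phi_outer(1) _ assms(2)] right by simp
qed

lemma Wint_refine:
  assumes "(n, w) \<in> Wint N" "1 \<le> N"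
  shows "w \<in> fun_vs.span (D ` Vint (2 * N))"
  using assms(1)
proof (cases rule: WintE)
  case (left i)
  obtain G where "G \<in> fun_vs.span (\<psi> ` {3..6})" "G 0 = 0" "\<psi>L i = cut01 G" by (rule psiL[OF left(3)])
  then show ?thesis
    using left_Vint[OF span_psi_outer _ assms(2)] left by simp
next
  case (inner q l)
  have "w \<in> fun_vs.span (D ` Tset \<phi> 0 (2 * N))"
  proof (cases "l \<in> {1, 2}")
    case True
    have "w \<in> fun_vs.span (D ` Tset \<phi> (0 + 2 * q) (2 + 2 * q))"
      unfolding inner(2) by (rule sh_D_Tset_span[OF psi_span(1)[OF True]])
    then show ?thesis
      by (rule span_superset_mono) (intro image_mono Tset_mono; use inner(3) in auto)
  next
    case False
    have "w \<in> fun_vs.span (D ` Tset \<phi> (-2 + 2 * q) (2 + 2 * q))"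
      unfolding inner(2) by (rule sh_D_Tset_span[OF psi_span(2)[OF inner(4)]])
    then show ?thesis
      by (rule span_superset_mono) (intro image_mono Tset_mono; use inner(3) False in auto)
  qed
  then show ?thesis
    by (rule span_superset_mono) (auto simp: Vint_def)
next
  case (right i)
  obtain G where "G \<in> fun_vs.span (\<psi> ` {3..6})" "G 0 = 0" "\<psi>Rt i = cut01 (sh 1 G)" by (rule psiRt[OF right(3)])
  then show ?thesis
    using right_Vint[OF span_psi_outer _ assms(2)] right by simp
qed

definition V :: "nat \<Rightarrow> (real \<Rightarrow> real) set" where
  "V j = dil j 0 ` Vint (2 ^ j)"

lemma level_refine: "f \<in> fun_vs.span (D ` Vint (2 * 2 ^ j)) \<Longrightarrow> dil j 0 f \<in> fun_vs.span (V (Suc j))"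
proof (erule dil_span)
  fix s assume "s \<in> D ` Vint (2 * 2 ^ j)"
  then obtain h where h: "s = D h" "h \<in> Vint (2 ^ Suc j)" by auto
  have "dil j 0 s = dil (Suc j) 0 h"
    unfolding h(1) dil_D by (simp only: Suc_eq_plus1)
  then show "dil j 0 s \<in> fun_vs.span (V (Suc j))"
    unfolding V_def using h(2) by (auto intro: fun_vs.span_base)
qed

lemma V_mono: "i \<le> j \<Longrightarrow> fun_vs.span (V i) \<subseteq> fun_vs.span (V j)"
proof (rule lift_Suc_mono_le[of "\<lambda>j. fun_vs.span (V j)"])
  fix j
  have "V j \<subseteq> fun_vs.span (V (Suc j))"
    using Vint_refine by (auto simp: V_def[of j] intro!: level_refine)
  then show "fun_vs.span (V j) \<subseteq> fun_vs.span (V (Suc j))"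
    by (intro fun_vs.span_minimal) auto
qed

abbreviation Psi :: "(real \<Rightarrow> real) set" where "Psi \<equiv> \<Psi>I \<phi> \<psi> \<psi>L \<psi>Rt"

abbreviation psiI :: "nat \<Rightarrow> nat \<Rightarrow> real \<Rightarrow> real" where "psiI \<equiv> \<psi>I \<psi> \<psi>L \<psi>Rt"

lemma psiI_V: "k \<in> {1..6 * 2 ^ j} \<Longrightarrow> psiI j k \<in> fun_vs.span (V (Suc j))"
  by (erule psiI_Wint) (auto intro!: level_refine Wint_refine)

lemma phiI_V: "k \<in> {1..6} \<Longrightarrow> \<phi>I \<phi> k \<in> V 0"
proof -
  assume k: "k \<in> {1..6}"
  have "\<phi> (k - 1) \<in> Tset \<phi> 0 1" if "k \<noteq> 1" "k \<noteq> 6"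
    unfolding Tset_def by (rule CollectI, rule exI[of _ 0], rule exI[of _ "k - 1"]) (use k that in auto)
  then have "\<phi>I \<phi> k \<in> Vint 1"
    by (auto simp: \<phi>I_def Vint_def)
  then show ?thesis
    by (simp add: V_def dil_0)
qed

lemma psiI_V_orth:
  assumes "k \<in> {1..6 * 2 ^ j}" "v \<in> V j"
  shows "ip (psiI j k) v = 0"
proof -
  obtain w where w: "(int k, w) \<in> Wint (2 ^ j)" "psiI j k = dil j 0 w"
    using psiI_Wint[OF assms(1)] .
  obtain u where "v = dil j 0 u" "u \<in> Vint (2 ^ j)"
    using assms(2) by (auto simp: V_def)
  then show ?thesis
    using Wint_Vint_orth[OF w(1)] w(2) by simp
qed

section \<open>Regularity, supports and orthonormality of the system\<close>

lemma left_agree: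
  assumes "F \<in> supp_in (-1) 1" "0 \<le> x"
  shows "cut01 F x = F x"
  using supp_inD[OF assms(1), of x] assms(2) by (cases "1 < x") (auto simp: cut01_def)

lemma right_agree:
  assumes "F \<in> supp_in (-1) 1" "x \<le> of_int N"
  shows "sh (N - 1) (cut01 (sh 1 F)) x = sh N F x"
  using supp_inD[OF assms(1), of "x - of_int N"] assms(2)
  by (cases "x < of_int N - 1") (auto simp: cut01_def sh_def algebra_simps)

lemma Vint_props:
  assumes "v \<in> Vint N" "1 \<le> N"
  shows "v \<in> tame" "v \<in> supp_in 0 (of_int N)" "\<exists>g\<in>splines 3. \<forall>x\<in>{0..of_int N}. v x = g x"
proof -
  have "v \<in> tame \<and> v \<in> supp_in 0 (of_int N) \<and> (\<exists>g\<in>splines 3. \<forall>x\<in>{0..of_int N}. v x = g x)"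
    using assms(1)
  proof (cases rule: VintE)
    case left
    obtain F where F: "F \<in> fun_vs.span {\<phi> 5, \<phi> 6}" "\<phi>L \<phi> = cut01 F" using phiL by metis
    note Fp = span_phi_outer_props[OF F(1)]
    show ?thesis
      unfolding left using left_supp[OF assms(2) F(2)] Fp left_agree[OF Fp(3)] F(2) by auto
  next
    case (inner k l)
    have 3: "\<phi> l \<in> splines 3"
    proof (cases "l \<le> 4")
      case True
      then show ?thesis
        using inner(3) span_D_Tset(2)[OF phi_A1_D_Tset[OF phi_A1, of l]] by auto
    next
      case False
      then have "l \<in> {5, 6}" using inner(3) by auto
      then show ?thesis by (rule phi_56_splines3)
    qed
    show ?thesis
      unfolding inner(1) using sh_phi_supp[OF inner(2)] splines_sh[OF 3] phi_tame[OF inner(3)] by auto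
  next
    case right
    obtain F where F: "F \<in> fun_vs.span {\<phi> 5, \<phi> 6}" "\<phi>Rt \<phi> = cut01 (sh 1 F)" using phiRt by metis
    note Fp = span_phi_outer_props[OF F(1)]
    have "\<forall>x\<in>{0..of_int N}. sh (N - 1) (\<phi>Rt \<phi>) x = sh N F x"
      unfolding F(2) using right_agree[OF Fp(3)] by auto
    then show ?thesis
      unfolding right using right_supp[OF assms(2) F(2)] Fp splines_sh[OF Fp(2), of N] F(2) by auto
  qed
  then show "v \<in> tame" "v \<in> supp_in 0 (of_int N)" "\<exists>g\<in>splines 3. \<forall>x\<in>{0..of_int N}. v x = g x"
    by auto
qed

lemma Wint_props:
  assumes "(n, w) \<in> Wint N" "1 \<le> N"
  shows "w \<in> tame" "w \<in> supp_in 0 (of_int N)" "\<exists>g\<in>splines 3. \<forall>x\<in>{0..of_int N}. w x = g x"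
    "\<exists>c. w \<in> supp_in c (c + 2)"
proof -
  have "w \<in> tame \<and> w \<in> supp_in 0 (of_int N) \<and> (\<exists>g\<in>splines 3. \<forall>x\<in>{0..of_int N}. w x = g x)
      \<and> (\<exists>c. w \<in> supp_in c (c + 2))"
    using assms(1)
  proof (cases rule: WintE)
    case (left i)
    obtain F where F: "F \<in> fun_vs.span (\<psi> ` {3..6})" "\<psi>L i = cut01 F" using psiL[OF left(3)] by metis
    note Fp = span_psi_outer_props[OF F(1)]
    have "cut01 F \<in> supp_in 0 (0 + 2)"
      by (rule supp_in_mono[OF supp_in_cut01]) auto
    then have "\<exists>c. cut01 F \<in> supp_in c (c + 2)" by (rule exI)
    then show ?thesis
      unfolding left using left_supp[OF assms(2) F(2)] Fp left_agree[OF Fp(3)] F(2) by auto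
  next
    case (inner q l)
    note p = psi_props[OF inner(4)]
    have "sh q (\<psi> l) \<in> supp_in (of_int q - 1) (of_int q - 1 + 2)"
      by (rule supp_in_sh[OF p(3)]) auto
    then have "\<exists>c. sh q (\<psi> l) \<in> supp_in c (c + 2)" by (rule exI)
    then show ?thesis
      unfolding inner(2) using sh_psi_supp[OF inner(3)] splines_sh[OF p(2)] p(1) by auto
  next
    case (right i)
    obtain F where F: "F \<in> fun_vs.span (\<psi> ` {3..6})" "\<psi>Rt i = cut01 (sh 1 F)" using psiRt[OF right(3)] by metis
    note Fp = span_psi_outer_props[OF F(1)]
    have "sh (N - 1) (\<psi>Rt i) \<in> supp_in (of_int N - 1) (of_int N - 1 + 2)"
      unfolding F(2) by (rule supp_in_sh[OF supp_in_cut01]) auto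
    then have "\<exists>c. sh (N - 1) (\<psi>Rt i) \<in> supp_in c (c + 2)" by (rule exI)
    moreover have "\<forall>x\<in>{0..of_int N}. sh (N - 1) (\<psi>Rt i) x = sh N F x"
      unfolding F(2) using right_agree[OF Fp(3)] by auto
    ultimately show ?thesis
      unfolding right using right_supp[OF assms(2) F(2)] Fp splines_sh[OF Fp(2), of N] F(2) by auto
  qed
  then show "w \<in> tame" "w \<in> supp_in 0 (of_int N)" "\<exists>g\<in>splines 3. \<forall>x\<in>{0..of_int N}. w x = g x"
    "\<exists>c. w \<in> supp_in c (c + 2)"
    by auto
qed

lemma V_tame: "V j \<subseteq> tame"
  unfolding V_def by (auto intro!: tame_dil Vint_props)

lemma dil_level_supp:
  assumes "w \<in> supp_in 0 (of_int (2 ^ j))"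
  shows "dil j 0 w \<in> supp_in 0 1"
  using supp_in_dil_level[OF assms, of j] by simp

lemma dil_level_splines:
  assumes "\<exists>g\<in>splines 3. \<forall>x\<in>{0..of_int (2 ^ j)}. w x = g x"
  shows "cubic_spline_on 0 1 (dil j 0 w)" "dil j 0 w C1_differentiable_on {0<..<1}"
proof -
  obtain g where g: "g \<in> splines 3" "\<And>x. x \<in> {0..of_int (2 ^ j)} \<Longrightarrow> w x = g x"
    using assms by blast
  have eq: "dil j 0 w x = dil j 0 g x" if "x \<in> {0..1}" for x
  proof -
    have "2 ^ j * x \<in> {0..of_int (2 ^ j)}" using that by (auto simp: mult_left_le)
    then show ?thesis
      unfolding dil_def by (simp add: g(2))
  qed
  show "cubic_spline_on 0 1 (dil j 0 w)" "dil j 0 w C1_differentiable_on {0<..<1}"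
    by (rule splines_imp_cubic_spline_on[OF splines_dil[OF g(1)] eq]; assumption)+
qed

lemma psiI_props:
  assumes "k \<in> {1..6 * 2 ^ j}"
  shows "psiI j k \<in> tame" "psiI j k \<in> supp_in 0 1"
    "cubic_spline_on 0 1 (psiI j k)" "psiI j k C1_differentiable_on {0<..<1}"
    "diameter (supp01 (psiI j k)) \<le> 2 powr (1 - real j)"
proof -
  obtain w where w: "(int k, w) \<in> Wint (2 ^ j)" "psiI j k = dil j 0 w"
    using psiI_Wint[OF assms] .
  have N: "(1::int) \<le> 2 ^ j" by simp
  note p = Wint_props[OF w(1) N]
  show "psiI j k \<in> tame" "psiI j k \<in> supp_in 0 1"
    "cubic_spline_on 0 1 (psiI j k)" "psiI j k C1_differentiable_on {0<..<1}"
    unfolding w(2) using p dil_level_supp dil_level_splines by auto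
  obtain c where "w \<in> supp_in c (c + 2)" using p(4) by blast
  then have "diameter (supp01 (dil j 0 w)) \<le> (c + 2) / 2 ^ j - c / 2 ^ j"
    by (intro diameter_supp01_le supp_in_dil_level) (auto simp: divide_right_mono)
  also have "\<dots> = 2 powr (1 - real j)"
    by (simp add: powr_diff powr_realpow diff_divide_distrib[symmetric])
  finally show "diameter (supp01 (psiI j k)) \<le> 2 powr (1 - real j)"
    unfolding w(2) .
qed

lemma phiI_props:
  assumes "k \<in> {1..6}"
  shows "\<phi>I \<phi> k \<in> tame" "\<phi>I \<phi> k \<in> supp_in 0 1"
    "cubic_spline_on 0 1 (\<phi>I \<phi> k)" "\<phi>I \<phi> k C1_differentiable_on {0<..<1}"
    "diameter (supp01 (\<phi>I \<phi> k)) \<le> 2"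
proof -
  have k: "\<phi>I \<phi> k \<in> Vint 1"
    using phiI_V[OF assms] by (simp add: V_def dil_0)
  note p = Vint_props[OF k order_refl]
  have d: "dil 0 0 (\<phi>I \<phi> k) = \<phi>I \<phi> k" by (simp add: dil_0)
  show "\<phi>I \<phi> k \<in> tame" "\<phi>I \<phi> k \<in> supp_in 0 1"
    "cubic_spline_on 0 1 (\<phi>I \<phi> k)" "\<phi>I \<phi> k C1_differentiable_on {0<..<1}"
    using p dil_level_splines[of 0 "\<phi>I \<phi> k"] unfolding d by auto
  then show "diameter (supp01 (\<phi>I \<phi> k)) \<le> 2"
    using diameter_supp01_le[of "\<phi>I \<phi> k" 0 1] by simp
qed

lemma phiI_orthonormal:
  assumes "k \<in> {1..6}" "l \<in> {1..6}"
  shows "ip (\<phi>I \<phi> k) (\<phi>I \<phi> l) = (if k = l then 1 else 0)"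
proof -
  obtain FL where FL: "FL \<in> fun_vs.span {\<phi> 5, \<phi> 6}" "\<phi>L \<phi> = cut01 FL" using phiL by metis
  obtain FR where FR: "FR \<in> fun_vs.span {\<phi> 5, \<phi> 6}" "\<phi>Rt \<phi> = cut01 (sh 1 FR)" using phiRt by metis
  have z: "ip F (\<phi> i) = 0" "ip (sh 1 F) (\<phi> i) = 0" if "i \<in> {1..4}" "F \<in> fun_vs.span {\<phi> 5, \<phi> 6}" for i F
  proof -
    show "ip F (\<phi> i) = 0"
      by (rule ip_span_zero_left[OF that(2)])
        (use phi_inner_outer[OF that(1), of _ 0] phi_A1_props[OF that(1)] phi_outer_props in \<open>auto simp: ip_commute[of _ "\<phi> i"]\<close>)
    have "ip F (sh (-1) (\<phi> i)) = 0"
      by (rule ip_span_zero_left[OF that(2)])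
        (use phi_inner_outer[OF that(1), of _ 1] phi_A1_props[OF that(1)] phi_outer_props
          in \<open>auto simp: ip_commute[of _ "sh (-1) (\<phi> i)"] ip_sh_left\<close>)
    then show "ip (sh 1 F) (\<phi> i) = 0"
      by (simp add: ip_sh_left)
  qed
  have L: "ip (\<phi>L \<phi>) (\<phi> i) = 0" "ip (\<phi>Rt \<phi>) (\<phi> i) = 0" if "i \<in> {1..4}" for i
    unfolding FL(2) FR(2) using ip_cut01_left[OF phi_A1_props(2)[OF that]] z[OF that] FL(1) FR(1) by simp_all
  have "sh 1 FR \<in> fun_vs.span (sh 1 ` {\<phi> 5, \<phi> 6})"
    by (rule sh_span[OF FR(1)]) (auto intro: fun_vs.span_base)
  then have "ip FL (sh 1 FR) = 0"
    by (rule ip_span_zero[OF FL(1)]) (use phi_outer_shift phi_outer_props in auto)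
  moreover have "ip (cut01 FL) (cut01 (sh 1 FR)) = ip FL (sh 1 FR)"
    by (rule ip_cut01_both[OF span_phi_outer_props(3)[OF FL(1)] supp_in_sh[OF span_phi_outer_props(3)[OF FR(1)], of _ _ 2]]) auto
  ultimately have LR: "ip (\<phi>L \<phi>) (\<phi>Rt \<phi>) = 0" "ip (\<phi>Rt \<phi>) (\<phi>L \<phi>) = 0"
    by (simp_all add: FL FR ip_commute)
  have inner: "i - 1 \<in> {1..4}" if "i \<in> {1..6}" "i \<noteq> 1" "i \<noteq> 6" for i :: nat
    using that by auto
  have eq: "(k - 1 = l - 1) = (k = l)"
    using assms by auto
  show ?thesis
    using LR phiL_norm phiRt_norm L[OF inner[OF assms(1)]] L[OF inner[OF assms(2)]]
      phi_orthonormal_A1[OF inner[OF assms(1)] inner[OF assms(2)]] eq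
    by (cases "k = 1"; cases "k = 6"; cases "l = 1"; cases "l = 6"; simp add: \<phi>I_def ip_commute)
qed

text \<open>A wavelet of level \<open>i\<close> lies in the scaling space of level
  \<open>i + 1\<close>, hence in that of every higher level \<open>j\<close>, to which the wavelets
  of level \<open>j\<close> are orthogonal. Within one level the relation comes from
  \<open>Wint_orthonormal\<close>.\<close>

lemma psiI_orthonormal:
  assumes "k \<in> {1..6 * 2 ^ i}" "l \<in> {1..6 * 2 ^ j}"
  shows "ip (psiI i k) (psiI j l) = (if i = j \<and> k = l then 1 else 0)"
proof -
  have lt: "ip (psiI j l) (psiI i k) = 0" if "i < j" "k \<in> {1..6 * 2 ^ i}" "l \<in> {1..6 * 2 ^ j}" for i j k l
  proof -
    have "psiI i k \<in> fun_vs.span (V j)"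
      using psiI_V[OF that(2)] V_mono[of "Suc i" j] that(1) by auto
    then show ?thesis
      by (rule ip_span_zero_right) (use V_tame psiI_V_orth[OF that(3)] psiI_props(1)[OF that(3)] in auto)
  qed
  consider "i < j" | "j < i" | "i = j" by linarith
  then show ?thesis
  proof cases
    case 1
    then show ?thesis using lt[OF 1 assms] by (simp add: ip_commute)
  next
    case 2
    then show ?thesis using lt[OF 2 assms(2,1)] by simp
  next
    case 3
    obtain w where w: "(int k, w) \<in> Wint (2 ^ i)" "psiI i k = dil i 0 w"
      using psiI_Wint[OF assms(1)] .
    obtain w' where w': "(int l, w') \<in> Wint (2 ^ i)" "psiI i l = dil i 0 w'"
      using psiI_Wint[OF assms(2)[folded 3]] .
    show ?thesis
      using Wint_orthonormal[OF w(1) w'(1)] w(2) w'(2) 3 by simp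
  qed
qed

lemma phiI_psiI_orth:
  assumes "k \<in> {1..6}" "l \<in> {1..6 * 2 ^ j}"
  shows "ip (\<phi>I \<phi> k) (psiI j l) = 0"
proof -
  have "\<phi>I \<phi> k \<in> fun_vs.span (V j)"
    using fun_vs.span_base[OF phiI_V[OF assms(1)]] V_mono[of 0 j] by auto
  then have "ip (psiI j l) (\<phi>I \<phi> k) = 0"
    by (rule ip_span_zero_right) (use V_tame psiI_V_orth[OF assms(2)] psiI_props(1)[OF assms(2)] in auto)
  then show ?thesis by (simp add: ip_commute)
qed

lemma psiI_moments:
  fixes p :: "real poly"
  assumes "k \<in> {3..6 * 2 ^ j - 2}" "degree p < 4"
  shows "ip (psiI j k) (poly p) = 0"
proof -
  have k: "k \<in> {1..6 * 2 ^ j}" "k + 2 \<le> 6 * 2 ^ j" using assms(1) by auto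
  then have "int (k + 2) \<le> int (6 * 2 ^ j)" by (simp only: of_nat_le_iff)
  then have k2: "int k < 6 * 2 ^ j - 1" by simp
  obtain w where w: "(int k, w) \<in> Wint (2 ^ j)" "psiI j k = dil j 0 w"
    using psiI_Wint[OF k(1)] .
  \<comment> \<open>In this range of indices only the inner alternative of \<open>Wint\<close> is
    possible.\<close>
  from w(1) obtain q l where ql: "w = sh q (\<psi> l)" "l \<in> {1..6}"
    by (cases rule: WintE) (use assms(1) k2 in auto)
  \<comment> \<open>The polynomial whose dilated translate is \<open>p\<close>; its degree is again
    less than 4.\<close>
  let ?r = "smult (1 / 2 powr (real j / 2)) (pcompose p [: of_int q / 2 ^ j, 1 / 2 ^ j :])"
  have "dil j q (poly ?r) x = poly p x" for x
  proof -
    have "of_int q / 2 ^ j + (2 ^ j * x - of_int q) * (1 / 2 ^ j) = x"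
      by (simp add: field_simps)
    then show ?thesis
      by (simp add: dil_def poly_pcompose)
  qed
  then have "poly p = dil j q (poly ?r)" by auto
  then have "ip (psiI j k) (poly p) = ip (\<psi> l) (poly ?r)"
    unfolding w(2) ql(1) dil_eq[symmetric] by simp
  also have "\<dots> = 0"
    by (rule psi_vanishing_moments[OF ql(2)])
      (use assms(2) in \<open>auto simp: degree_pcompose intro: le_less_trans[OF degree_smult_le]\<close>)
  finally show ?thesis .
qed

section \<open>The dimension count\<close>

lemma card_Vint:
  assumes "1 \<le> N"
  shows "finite (Vint N)" "card (Vint N) \<le> nat (6 * N)"
proof -
  let ?I = "{0..<N} \<times> {1..4::nat} \<union> {1..<N} \<times> {5, 6::nat}"
  have T: "Tset \<phi> 0 N = (\<lambda>(k, l). sh k (\<phi> l)) ` ?I"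
  proof (intro subset_antisym subsetI)
    fix f assume "f \<in> Tset \<phi> 0 N"
    then obtain k l where "f = sh k (\<phi> l)" "(l \<in> {1..4} \<and> 0 \<le> k \<and> k < N) \<or> (l \<in> {5, 6} \<and> 0 < k \<and> k < N)"
      unfolding Tset_def by blast
    then show "f \<in> (\<lambda>(k, l). sh k (\<phi> l)) ` ?I"
      by (intro image_eqI[of _ _ "(k, l)"]) auto
  next
    fix f assume "f \<in> (\<lambda>(k, l). sh k (\<phi> l)) ` ?I"
    then obtain z where "z \<in> ?I" "f = (\<lambda>(k, l). sh k (\<phi> l)) z" by blast
    then obtain k l where "f = sh k (\<phi> l)" "(k, l) \<in> ?I" by (cases z) auto
    then show "f \<in> Tset \<phi> 0 N"
      unfolding Tset_def by (intro CollectI exI[of _ k] exI[of _ l]) auto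
  qed
  have fin: "finite ?I" by simp
  have "card ?I \<le> card ({0..<N} \<times> {1..4::nat}) + card ({1..<N} \<times> {5, 6::nat})"
    by (rule card_Un_le)
  also have "\<dots> = nat N * 4 + nat (N - 1) * 2"
    by (simp add: card_cartesian_product)
  finally have c: "card (Tset \<phi> 0 N) \<le> nat N * 4 + nat (N - 1) * 2"
    unfolding T using card_image_le[OF fin] le_trans by blast
  show "finite (Vint N)"
    unfolding Vint_def T by simp
  have "card (Vint N) \<le> card {\<phi>L \<phi>, sh (N - 1) (\<phi>Rt \<phi>)} + card (Tset \<phi> 0 N)"
    unfolding Vint_def by (rule card_Un_le)
  moreover have "card {\<phi>L \<phi>, sh (N - 1) (\<phi>Rt \<phi>)} \<le> 2"
    by (simp add: card_insert_if)
  ultimately have "card (Vint N) \<le> 2 + (nat N * 4 + nat (N - 1) * 2)"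
    using c by linarith
  also have "\<dots> = nat (6 * N)"
    using assms by (simp add: nat_mult_distrib nat_diff_distrib)
  finally show "card (Vint N) \<le> nat (6 * N)" .
qed

text \<open>The system below level \<open>j\<close>. The number of its indices is 6 plus the sum of
  the \<open>6 * 2^i\<close> for \<open>i < j\<close>, that is \<open>6 * 2^j\<close>, the same as
  for the scaling functions of level \<open>j\<close>.\<close>

definition B :: "nat \<Rightarrow> (real \<Rightarrow> real) set" where
  "B j = \<phi>I \<phi> ` {1..6} \<union> (\<Union>i<j. psiI i ` {1..6 * 2 ^ i})"

lemma B_cases:
  assumes "f \<in> B j"
  obtains k where "k \<in> {1..6}" "f = \<phi>I \<phi> k" | i k where "i < j" "k \<in> {1..6 * 2 ^ i}" "f = psiI i k"
  using assms unfolding B_def by blast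

text \<open>Stated for functions instead of indices: functions with different indices are
  orthogonal, and each has norm 1, so equality of functions decides the value.\<close>

lemma B_ip:
  assumes "f \<in> B j" "g \<in> B j"
  shows "ip f g = (if f = g then 1 else 0)"
  using assms(1)
proof (cases rule: B_cases)
  case (1 k)
  note f = 1
  from assms(2) show ?thesis
  proof (cases rule: B_cases)
    case (1 l)
    have "ip f g \<in> {0, 1}" "k = l \<or> ip f g = 0" "ip f f = 1"
      using phiI_orthonormal[OF f(1) 1(1)] phiI_orthonormal[OF f(1) f(1)] by (auto simp: f(2) 1(2))
    then show ?thesis using f(2) 1(2) by auto
  next
    case (2 i l)
    have "ip f g = 0" "ip f f = 1"
      using phiI_psiI_orth[OF f(1) 2(2)] phiI_orthonormal[OF f(1) f(1)] by (auto simp: f(2) 2(3))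
    then show ?thesis by auto
  qed
next
  case (2 i k)
  note f = 2
  from assms(2) show ?thesis
  proof (cases rule: B_cases)
    case (1 l)
    have "ip f g = 0" "ip f f = 1"
      using phiI_psiI_orth[OF 1(1) f(2)] psiI_orthonormal[OF f(2) f(2)] by (auto simp: f(3) 1(2) ip_commute)
    then show ?thesis by auto
  next
    case (2 i' l)
    have "i = i' \<and> k = l \<or> ip f g = 0" "ip f f = 1"
      using psiI_orthonormal[OF f(2) 2(2)] psiI_orthonormal[OF f(2) f(2)] by (auto simp: f(3) 2(3))
    then show ?thesis using f(3) 2(3) by auto
  qed
qed

lemma B_tame: "B j \<subseteq> tame"
  using phiI_props(1) psiI_props(1) by (auto elim!: B_cases)

lemma B_V: "B j \<subseteq> fun_vs.span (V j)"
proof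
  fix f assume "f \<in> B j"
  then show "f \<in> fun_vs.span (V j)"
  proof (cases rule: B_cases)
    case (1 k)
    then show ?thesis using fun_vs.span_base[OF phiI_V[OF 1(1)]] V_mono[of 0 j] by auto
  next
    case (2 i k)
    then show ?thesis using psiI_V[OF 2(2)] V_mono[of "Suc i" j] by auto
  qed
qed

text \<open>Distinct indices give distinct functions, since equal ones would have inner product 0
  and norm 1 at once.\<close>

lemma card_B: "finite (B j) \<and> card (B j) = 6 * 2 ^ j"
proof (induction j)
  case 0
  have "inj_on (\<phi>I \<phi>) {1..6}"
  proof (rule inj_onI)
    fix k l :: nat assume "k \<in> {1..6}" "l \<in> {1..6}" "\<phi>I \<phi> k = \<phi>I \<phi> l"
    then show "k = l"
      using phiI_orthonormal[of k l] phiI_orthonormal[of k k] by (auto split: if_splits)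
  qed
  then show ?case
    by (simp add: B_def card_image)
next
  case (Suc j)
  have eq: "B (Suc j) = B j \<union> psiI j ` {1..6 * 2 ^ j}"
    by (auto simp: B_def lessThan_Suc)
  have "inj_on (psiI j) {1..6 * 2 ^ j}"
  proof (rule inj_onI)
    fix k l assume "k \<in> {1..6 * 2 ^ j}" "l \<in> {1..6 * 2 ^ j}" "psiI j k = psiI j l"
    then show "k = l"
      using psiI_orthonormal[of k j l j] psiI_orthonormal[of k j k j] by (auto split: if_splits)
  qed
  then have c: "card (psiI j ` {1..6 * 2 ^ j}) = 6 * 2 ^ j"
    by (simp add: card_image)
  have "B j \<inter> psiI j ` {1..6 * 2 ^ j} = {}"
  proof (rule ccontr)
    assume "B j \<inter> psiI j ` {1..6 * 2 ^ j} \<noteq> {}"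
    then obtain k where k: "k \<in> {1..6 * 2 ^ j}" "psiI j k \<in> B j" by blast
    from k(2) have "ip (psiI j k) (psiI j k) = 0"
    proof (cases rule: B_cases)
      case (1 l)
      then show ?thesis using phiI_psiI_orth[OF 1(1) k(1)] by (simp add: 1(2))
    next
      case (2 i l)
      then show ?thesis using psiI_orthonormal[OF 2(2) k(1)] by simp
    qed
    then show False
      using psiI_orthonormal[OF k(1) k(1)] by simp
  qed
  then show ?case
    using Suc.IH c unfolding eq by (simp add: card_Un_disjoint)
qed

lemma V_span_B: "V j \<subseteq> fun_vs.span (B j)"
proof (rule span_eq_of_card)
  show "finite (V j)"
    unfolding V_def using card_Vint(1)[of "2 ^ j"] by simp
  show "fun_vs.independent (B j)"
    by (rule orthonormal_independent) (use card_B B_tame B_ip in auto)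
  show "B j \<subseteq> fun_vs.span (V j)" by (rule B_V)
  have "card (V j) \<le> card (Vint (2 ^ j))"
    unfolding V_def using card_Vint(1)[of "2 ^ j"] by (simp add: card_image_le)
  also have "\<dots> \<le> nat (6 * 2 ^ j)"
    using card_Vint(2)[of "2 ^ j"] by simp
  also have "\<dots> = card (B j)"
    using card_B by (simp add: nat_mult_distrib nat_power_eq)
  finally show "card (V j) \<le> card (B j)" .
qed

lemma B_Psi: "B j \<subseteq> Psi"
  unfolding B_def \<Psi>I_def by blast

lemma hermite_span_Psi:
  assumes "0 < m" "m < 2 * 2 ^ j"
  shows "(\<lambda>x. \<xi>\<^sub>1 (2 * 2 ^ j * x - of_int m)) \<in> fun_vs.span Psi"
proof -
  have "\<xi> 1 (2 * m) \<in> fun_vs.span (Tset \<phi> 0 (2 ^ j))"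
  proof (rule xi_1_Tset)
    \<comment> \<open>Odd \<open>m\<close> correspond to half-integer knots of level one, even
      \<open>m\<close> to integer knots. The strict bounds on \<open>m\<close> keep the latter away
      from the end points.\<close>
    have "2 * m mod 4 = 2 * (m mod 2)" "2 * m div 4 = m div 2"
      by presburger+
    then show "2 * m mod 4 \<in> {2, 3} \<and> 0 \<le> 2 * m div 4 \<and> 2 * m div 4 < 2 ^ j \<or>
      2 * m mod 4 \<in> {0, 1} \<and> 0 < 2 * m div 4 \<and> 2 * m div 4 < 2 ^ j"
      using assms by (cases "even m") (auto elim!: evenE oddE)
  qed
  then have "dil j 0 (\<xi> 1 (2 * m)) \<in> fun_vs.span (V j)"
    by (rule dil_span) (auto simp: V_def Vint_def intro!: fun_vs.span_base)
  moreover have "fun_vs.span (V j) \<subseteq> fun_vs.span Psi"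
    using V_span_B[of j] fun_vs.span_mono[OF B_Psi[of j]] by (intro fun_vs.span_minimal) auto
  ultimately have "dil j 0 (\<xi> 1 (2 * m)) \<in> fun_vs.span Psi"
    by blast
  then have "fscale (1 / 2 powr (real j / 2) / 2 powr (1/2)) (dil j 0 (\<xi> 1 (2 * m))) \<in> fun_vs.span Psi"
    by (rule fun_vs.span_scale)
  moreover have "fscale (1 / 2 powr (real j / 2) / 2 powr (1/2)) (dil j 0 (\<xi> 1 (2 * m))) = (\<lambda>x. \<xi>\<^sub>1 (2 * 2 ^ j * x - of_int m))"
    by (simp add: fun_eq_iff \<xi>_def dil_def mult.assoc)
  ultimately show ?thesis by simp
qed

end

subsection \<open>Density\<close>

definition sq_integrable :: "(real \<Rightarrow> real) \<Rightarrow> bool" where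
  "sq_integrable f \<longleftrightarrow> f \<in> borel_measurable borel \<and> integrable lborel (\<lambda>x. (f x)\<^sup>2)"

text \<open>The bound by twice the sum of the squares replaces the triangle inequality. It is the
  reason why errors are later kept below a quarter of \<open>e\<close>.\<close>

lemma sq_integrable_add:
  assumes "sq_integrable f" "sq_integrable g"
  shows "sq_integrable (\<lambda>x. f x + g x)"
    "(\<integral>x. (f x + g x)\<^sup>2 \<partial>lborel) \<le> 2 * (\<integral>x. (f x)\<^sup>2 \<partial>lborel) + 2 * (\<integral>x. (g x)\<^sup>2 \<partial>lborel)"
proof -
  have [measurable]: "f \<in> borel_measurable borel" "g \<in> borel_measurable borel"
    and int: "integrable lborel (\<lambda>x. (f x)\<^sup>2)" "integrable lborel (\<lambda>x. (g x)\<^sup>2)"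
    using assms by (auto simp: sq_integrable_def)
  have le: "(f x + g x)\<^sup>2 \<le> 2 * (f x)\<^sup>2 + 2 * (g x)\<^sup>2" for x
    using zero_le_power2[of "f x - g x"] by (simp add: power2_eq_square algebra_simps)
  have i2: "integrable lborel (\<lambda>x. 2 * (f x)\<^sup>2 + 2 * (g x)\<^sup>2)"
    using int by simp
  have i1: "integrable lborel (\<lambda>x. (f x + g x)\<^sup>2)"
    by (rule Bochner_Integration.integrable_bound[OF i2]) (use le in \<open>auto intro: order_trans\<close>)
  then show "sq_integrable (\<lambda>x. f x + g x)"
    by (simp add: sq_integrable_def)
  have "(\<integral>x. (f x + g x)\<^sup>2 \<partial>lborel) \<le> (\<integral>x. 2 * (f x)\<^sup>2 + 2 * (g x)\<^sup>2 \<partial>lborel)"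
    using le by (intro integral_mono i1 i2) auto
  then show "(\<integral>x. (f x + g x)\<^sup>2 \<partial>lborel) \<le> 2 * (\<integral>x. (f x)\<^sup>2 \<partial>lborel) + 2 * (\<integral>x. (g x)\<^sup>2 \<partial>lborel)"
    using int by simp
qed

lemma sq_integrable_scale: "sq_integrable f \<Longrightarrow> sq_integrable (\<lambda>x. c * f x)"
  by (auto simp: sq_integrable_def power_mult_distrib)

lemma sq_integrable_diff: "sq_integrable f \<Longrightarrow> sq_integrable g \<Longrightarrow> sq_integrable (\<lambda>x. f x - g x)"
  using sq_integrable_add(1)[OF _ sq_integrable_scale[of g "-1"], of f] by simp

lemma sq_integrable_dominated:
  assumes "sq_integrable g" "f \<in> borel_measurable borel" "\<And>x. \<bar>f x\<bar> \<le> \<bar>g x\<bar>"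
  shows "sq_integrable f"
  unfolding sq_integrable_def
proof
  show "integrable lborel (\<lambda>x. (f x)\<^sup>2)"
    by (rule Bochner_Integration.integrable_bound[of _ "\<lambda>x. (g x)\<^sup>2"])
      (use assms in \<open>auto simp: sq_integrable_def abs_le_square_iff\<close>)
qed fact

lemma sq_integrable_tame:
  assumes f: "f \<in> tame" and [measurable]: "S \<in> sets borel"
  shows "sq_integrable (\<lambda>x. indicator S x * f x)"
proof (rule sq_integrable_dominated)
  have [measurable]: "f \<in> borel_measurable borel" using f by (auto elim: tameE)
  then show "sq_integrable f"
    using tame_mult_integrable[OF f f] by (simp add: sq_integrable_def power2_eq_square)
  show "(\<lambda>x. indicator S x * f x) \<in> borel_measurable borel"
    by measurable
qed (auto simp: indicator_def)

lemma sq_dominated_convergence: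
  assumes "\<And>i. U i \<in> borel_measurable borel" "sq_integrable u" "\<And>i x. \<bar>U i x\<bar> \<le> \<bar>u x\<bar>"
    and "\<And>x. (\<lambda>i. U i x) \<longlonglongrightarrow> u x" "0 < e"
  shows "\<exists>i::nat. (\<integral>x. (u x - U i x)\<^sup>2 \<partial>lborel) < e"
proof -
  have [measurable]: "u \<in> borel_measurable borel" and int: "integrable lborel (\<lambda>x. (u x)\<^sup>2)"
    using assms(2) by (auto simp: sq_integrable_def)
  note [measurable] = assms(1)
  have "(\<lambda>i. \<integral>x. (u x - U i x)\<^sup>2 \<partial>lborel) \<longlonglongrightarrow> integral\<^sup>L lborel (\<lambda>x::real. 0 :: real)"
  \<comment> \<open>As \<open>U i\<close> is dominated by \<open>u\<close>, the difference is
    dominated by \<open>2 * u\<close>.\<close>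
  proof (rule integral_dominated_convergence[where w = "\<lambda>x. 4 * (u x)\<^sup>2"])
    show "AE x in lborel. (\<lambda>i. (u x - U i x)\<^sup>2) \<longlonglongrightarrow> 0"
    proof (rule AE_I2)
      fix x
      have "(\<lambda>i. (u x - U i x)\<^sup>2) \<longlonglongrightarrow> (u x - u x)\<^sup>2"
        by (intro tendsto_intros assms(4))
      then show "(\<lambda>i. (u x - U i x)\<^sup>2) \<longlonglongrightarrow> 0" by simp
    qed
    show "AE x in lborel. norm ((u x - U i x)\<^sup>2) \<le> 4 * (u x)\<^sup>2" for i
    proof (rule AE_I2)
      fix x
      have "\<bar>u x - U i x\<bar> \<le> \<bar>2 * u x\<bar>"
        using assms(3)[of i x] by linarith
      then have "(u x - U i x)\<^sup>2 \<le> (2 * u x)\<^sup>2"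
        by (simp only: abs_le_square_iff)
      then show "norm ((u x - U i x)\<^sup>2) \<le> 4 * (u x)\<^sup>2"
        by (simp add: power_mult_distrib)
    qed
  qed (use int in auto)
  then have "\<forall>\<^sub>F i in sequentially. (\<integral>x. (u x - U i x)\<^sup>2 \<partial>lborel) < e"
    using assms(5) by (intro order_tendstoD(2)) auto
  then show ?thesis
    by (auto simp: eventually_sequentially)
qed

text \<open>Elements of \<open>L\<^sup>2(S)\<close> are extended by zero.\<close>

definition approximable :: "real set \<Rightarrow> (real \<Rightarrow> real) set \<Rightarrow> (real \<Rightarrow> real) \<Rightarrow> bool" where
  "approximable S G f \<longleftrightarrow> sq_integrable f \<and>
     (\<forall>e>0. \<exists>g\<in>G. (\<integral>x. (f x - indicator S x * g x)\<^sup>2 \<partial>lborel) < e)"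

locale approximation =
  fixes S :: "real set" and G :: "(real \<Rightarrow> real) set"
  assumes S: "S \<in> sets borel" and G_tame: "G \<subseteq> tame" and G_subspace: "fun_vs.subspace G"
begin

lemma sq_integrable_residual:
  "sq_integrable f \<Longrightarrow> g \<in> G \<Longrightarrow> sq_integrable (\<lambda>x. f x - indicator S x * g x)"
  using G_tame S by (intro sq_integrable_diff sq_integrable_tame) auto

lemma approximable_add:
  assumes "approximable S G f" "approximable S G h"
  shows "approximable S G (\<lambda>x. f x + h x)"
  unfolding approximable_def
proof (intro conjI allI impI)
  have f: "sq_integrable f" and h: "sq_integrable h"
    using assms by (auto simp: approximable_def)
  show "sq_integrable (\<lambda>x. f x + h x)"
    by (rule sq_integrable_add[OF f h])
  fix e :: real assume e: "0 < e"
  obtain g where g: "g \<in> G" "(\<integral>x. (f x - indicator S x * g x)\<^sup>2 \<partial>lborel) < e / 4"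
    using assms(1) e unfolding approximable_def by (metis divide_pos_pos zero_less_numeral)
  obtain k where k: "k \<in> G" "(\<integral>x. (h x - indicator S x * k x)\<^sup>2 \<partial>lborel) < e / 4"
    using assms(2) e unfolding approximable_def by (metis divide_pos_pos zero_less_numeral)
  have "(\<integral>x. (f x + h x - indicator S x * (g + k) x)\<^sup>2 \<partial>lborel) =
      (\<integral>x. ((f x - indicator S x * g x) + (h x - indicator S x * k x))\<^sup>2 \<partial>lborel)"
    by (intro Bochner_Integration.integral_cong) (auto simp: algebra_simps)
  also have "\<dots> < e"
    using sq_integrable_add(2)[OF sq_integrable_residual[OF f g(1)] sq_integrable_residual[OF h k(1)]] g(2) k(2)
    by linarith
  finally show "\<exists>g\<in>G. (\<integral>x. (f x + h x - indicator S x * g x)\<^sup>2 \<partial>lborel) < e"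
    using fun_vs.subspace_add[OF G_subspace g(1) k(1)] by blast
qed

text \<open>Closedness in the mean, on which all later limit arguments rest.\<close>

lemma approximable_close:
  assumes "sq_integrable f" "\<And>e. 0 < e \<Longrightarrow> \<exists>h. approximable S G h \<and> (\<integral>x. (f x - h x)\<^sup>2 \<partial>lborel) < e"
  shows "approximable S G f"
  unfolding approximable_def
proof (intro conjI allI impI assms(1))
  fix e :: real assume e: "0 < e"
  obtain h where h: "approximable S G h" "(\<integral>x. (f x - h x)\<^sup>2 \<partial>lborel) < e / 4"
    using assms(2)[of "e / 4"] e by auto
  obtain g where g: "g \<in> G" "(\<integral>x. (h x - indicator S x * g x)\<^sup>2 \<partial>lborel) < e / 4"
    using h(1) e unfolding approximable_def by (metis divide_pos_pos zero_less_numeral)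
  have hs: "sq_integrable h" using h(1) by (simp add: approximable_def)
  have "(\<integral>x. (f x - indicator S x * g x)\<^sup>2 \<partial>lborel) =
      (\<integral>x. ((f x - h x) + (h x - indicator S x * g x))\<^sup>2 \<partial>lborel)"
    by simp
  also have "\<dots> < e"
    using sq_integrable_add(2)[OF sq_integrable_diff[OF assms(1) hs] sq_integrable_residual[OF hs g(1)]] g(2) h(2)
    by linarith
  finally show "\<exists>g\<in>G. (\<integral>x. (f x - indicator S x * g x)\<^sup>2 \<partial>lborel) < e"
    using g(1) by blast
qed

lemma approximable_zero: "approximable S G (\<lambda>x. 0)"
  unfolding approximable_def sq_integrable_def
  using fun_vs.subspace_0[OF G_subspace] by (auto intro!: bexI[of _ 0])

lemma approximable_scale:
  assumes "approximable S G f"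
  shows "approximable S G (\<lambda>x. c * f x)"
proof (cases "c = 0")
  case True
  then show ?thesis using approximable_zero by simp
next
  case False
  show ?thesis
    unfolding approximable_def
  proof (intro conjI allI impI)
    show "sq_integrable (\<lambda>x. c * f x)"
      using assms by (auto simp: approximable_def intro: sq_integrable_scale)
    fix e :: real assume e: "0 < e"
    obtain g where g: "g \<in> G" "(\<integral>x. (f x - indicator S x * g x)\<^sup>2 \<partial>lborel) < e / c\<^sup>2"
      using assms e False unfolding approximable_def by (metis divide_pos_pos zero_less_power2)
    have "(\<integral>x. (c * f x - indicator S x * fscale c g x)\<^sup>2 \<partial>lborel) =
        (\<integral>x. c\<^sup>2 * (f x - indicator S x * g x)\<^sup>2 \<partial>lborel)"
      by (intro Bochner_Integration.integral_cong) (auto simp: power2_eq_square algebra_simps)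
    also have "\<dots> = c\<^sup>2 * (\<integral>x. (f x - indicator S x * g x)\<^sup>2 \<partial>lborel)"
      by simp
    also have "\<dots> < e"
      using g(2) False by (simp add: field_simps)
    finally show "\<exists>g\<in>G. (\<integral>x. (c * f x - indicator S x * g x)\<^sup>2 \<partial>lborel) < e"
      using fun_vs.subspace_scale[OF G_subspace g(1)] by blast
  qed
qed

lemma approximable_sum:
  "(\<And>i. i \<in> I \<Longrightarrow> approximable S G (f i)) \<Longrightarrow> approximable S G (\<lambda>x. \<Sum>i\<in>I. f i x)"
  by (induction I rule: infinite_finite_induct) (auto simp: approximable_zero approximable_add)

lemma approximable_limit:
  assumes "sq_integrable u" "\<And>i::nat. approximable S G (U i)" "\<And>i x. \<bar>U i x\<bar> \<le> \<bar>u x\<bar>"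
    and "\<And>x. (\<lambda>i. U i x) \<longlonglongrightarrow> u x"
  shows "approximable S G u"
proof (rule approximable_close[OF assms(1)])
  fix e :: real assume "0 < e"
  have "U i \<in> borel_measurable borel" for i
    using assms(2) by (simp add: approximable_def sq_integrable_def)
  then obtain i where "(\<integral>x. (u x - U i x)\<^sup>2 \<partial>lborel) < e"
    using sq_dominated_convergence[OF _ assms(1,3,4) \<open>0 < e\<close>] by blast
  then show "\<exists>h. approximable S G h \<and> (\<integral>x. (u x - h x)\<^sup>2 \<partial>lborel) < e"
    using assms(2) by blast
qed

text \<open>The half-lines are stable under intersection and generate the Borel sets. The sets with
  approximable indicator contain them and are closed under complements and disjoint countable
  unions, so the Dynkin argument applies.\<close>

lemma approximable_borel_set:
  assumes top: "approximable S G (indicator S)"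
    and atMost: "\<And>a. approximable S G (\<lambda>x. indicator S x * indicator {..a} x)"
    and A: "A \<in> sets borel"
  shows "approximable S G (\<lambda>x. indicator S x * indicator A x)"
proof -
  have sq: "sq_integrable (\<lambda>x. indicator S x * indicator A x)" if "A \<in> sets borel" for A :: "real set"
  proof (rule sq_integrable_dominated)
    show "sq_integrable (indicator S)"
      using top unfolding approximable_def by (rule conjunct1)
  qed (use that S in \<open>auto simp: indicator_def\<close>)
  have "Int_stable (range (atMost :: real \<Rightarrow> real set))"
    by (auto simp: Int_stable_def)
  moreover have "range (atMost :: real \<Rightarrow> real set) \<subseteq> Pow UNIV"
    by simp
  moreover have "A \<in> sigma_sets UNIV (range atMost)"
    using A by (simp add: borel_eq_atMost)
  ultimately show ?thesis
  proof (induction rule: sigma_sets_induct_disjoint[consumes 3, case_names basic empty compl union])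
    case (basic A)
    then show ?case using atMost by auto
  next
    case empty
    then show ?case by (simp add: approximable_zero)
  next
    case (compl A)
    have "approximable S G (\<lambda>x. indicator S x + (-1) * (indicator S x * indicator A x))"
      by (intro approximable_add approximable_scale top compl)
    moreover have "(\<lambda>x. indicator S x + (-1) * (indicator S x * indicator A x)) = (\<lambda>x. indicator S x * indicator (UNIV - A) x :: real)"
      by (auto simp: fun_eq_iff indicator_def)
    ultimately show ?case by simp
  next
    case (union A)
    have disj: "disjoint_family A"
      using union by auto
    have Ab: "A i \<in> sets borel" for i
      using union by (auto simp: borel_eq_atMost)
    have part: "(\<Sum>i<n. indicator S x * indicator (A i) x) = indicator S x * (indicator (\<Union>i<n. A i) x :: real)" for n x
      by (subst indicator_UN_disjoint) (use disj in \<open>auto simp: sum_distrib_left disjoint_family_on_def\<close>)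
    show ?case
    proof (rule approximable_limit[where U = "\<lambda>n x. \<Sum>i<n. indicator S x * indicator (A i) x"])
      show "sq_integrable (\<lambda>x. indicator S x * indicator (\<Union> (range A)) x)"
        using Ab by (intro sq) auto
      show "approximable S G (\<lambda>x. \<Sum>i<n. indicator S x * indicator (A i) x)" for n
        using union by (intro approximable_sum) auto
      show "\<bar>\<Sum>i<n. indicator S x * indicator (A i) x\<bar> \<le> \<bar>indicator S x * indicator (\<Union> (range A)) x :: real\<bar>" for n x
        unfolding part by (auto simp: indicator_def)
      show "(\<lambda>n. \<Sum>i<n. indicator S x * indicator (A i) x) \<longlonglongrightarrow> (indicator S x * indicator (\<Union> (range A)) x :: real)" for x
        unfolding part by (intro tendsto_intros LIMSEQ_indicator_UN)
    qed
  qed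
qed

text \<open>Nonnegative Borel functions are built from indicators by sums, multiples and increasing
  limits; the general case follows by positive and negative parts. Square integrability accompanies
  the induction because it is inherited by every smaller nonnegative function.\<close>

lemma approximable_sq_integrable:
  assumes sets: "\<And>A. A \<in> sets borel \<Longrightarrow> approximable S G (\<lambda>x. indicator S x * indicator A x)"
    and "f \<in> borel_measurable borel" "sq_integrable (\<lambda>x. indicator S x * f x)"
  shows "approximable S G (\<lambda>x. indicator S x * f x)"
proof -
  have nonneg: "approximable S G (\<lambda>x. indicator S x * u x)"
    if u: "u \<in> borel_measurable borel" "\<And>x. 0 \<le> u x" and "sq_integrable (\<lambda>x. indicator S x * u x)" for u
    using u that(3)
  proof (induction rule: borel_measurable_induct_real)
    case (set A)
    then show ?case using sets by simp
  next
    case (mult u c)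
    show ?case
    proof (cases "c = 0")
      case True
      then show ?thesis using approximable_zero by simp
    next
      case False
      have eq: "(\<lambda>x. indicator S x * (c * u x)) = (\<lambda>x. c * (indicator S x * u x))"
        by (auto simp: fun_eq_iff)
      have "sq_integrable (\<lambda>x. (1 / c) * (indicator S x * (c * u x)))"
        by (rule sq_integrable_scale[OF mult.prems])
      then have "sq_integrable (\<lambda>x. indicator S x * u x)"
        using False by (simp add: field_simps)
      then show ?thesis
        unfolding eq by (intro approximable_scale mult.IH)
    qed
  next
    case (add u v)
    have eq: "(\<lambda>x. indicator S x * (v x + u x)) = (\<lambda>x. indicator S x * v x + indicator S x * u x)"
      by (auto simp: fun_eq_iff algebra_simps)
    have "sq_integrable (\<lambda>x. indicator S x * v x)" "sq_integrable (\<lambda>x. indicator S x * u x)"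
      by (rule sq_integrable_dominated[OF add.prems]; use add S in \<open>auto simp: indicator_def\<close>)+
    then show ?case
      unfolding eq using add by (intro approximable_add) auto
  next
    case (seq U)
    have le: "U i x \<le> u x" for i x
      using seq by (intro incseq_le[of "\<lambda>i. U i x"]) (auto simp: incseq_def le_fun_def)
    show ?case
    proof (rule approximable_limit[where U = "\<lambda>i x. indicator S x * U i x"])
      show "approximable S G (\<lambda>x. indicator S x * U i x)" for i
      proof (rule seq)
        show "sq_integrable (\<lambda>x. indicator S x * U i x)"
          by (rule sq_integrable_dominated[OF seq.prems]; use seq S order_trans[OF le abs_ge_self] in \<open>auto simp: indicator_def\<close>)
      qed
      show "\<bar>indicator S x * U i x\<bar> \<le> \<bar>indicator S x * u x\<bar>" for i x
        using seq(2) le[of i x] order_trans[OF le[of i x] abs_ge_self] by (auto simp: indicator_def)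
      show "(\<lambda>i. indicator S x * U i x) \<longlonglongrightarrow> indicator S x * u x" for x
        using seq by (intro tendsto_intros) auto
    qed (rule seq.prems)
  qed
  have m: "(\<lambda>x. max 0 (f x)) \<in> borel_measurable borel" "(\<lambda>x. max 0 (- f x)) \<in> borel_measurable borel"
    using assms(2) by measurable
  have "approximable S G (\<lambda>x. indicator S x * max 0 (f x))" "approximable S G (\<lambda>x. indicator S x * max 0 (- f x))"
    by (intro nonneg m sq_integrable_dominated[OF assms(3)]; use m S in \<open>auto simp: indicator_def\<close>)+
  then have "approximable S G (\<lambda>x. indicator S x * max 0 (f x) + (-1) * (indicator S x * max 0 (- f x)))"
    by (intro approximable_add approximable_scale)
  moreover have "(\<lambda>x. indicator S x * max 0 (f x) + (-1) * (indicator S x * max 0 (- f x))) = (\<lambda>x. indicator S x * f x)"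
    by (auto simp: fun_eq_iff indicator_def max_def)
  ultimately show ?thesis by simp
qed

end

section \<open>Plateau functions made of Hermite translates\<close>

lemma xi1_sum:
  fixes M :: int and y :: real
  defines "k \<equiv> \<lfloor>y\<rfloor>"
  shows "(\<Sum>m\<in>{1..M}. \<xi>\<^sub>1 (y - of_int m)) =
    (if 1 \<le> k \<and> k \<le> M then \<xi>\<^sub>1 (y - of_int k) else 0) + (if 0 \<le> k \<and> k < M then \<xi>\<^sub>1 (y - of_int k - 1) else 0)"
proof -
  have "(\<Sum>m\<in>{1..M}. \<xi>\<^sub>1 (y - of_int m)) = (\<Sum>m\<in>{1..M} \<inter> {k, k + 1}. \<xi>\<^sub>1 (y - of_int m))"
  proof (rule sum.mono_neutral_right)
    show "\<forall>m\<in>{1..M} - {1..M} \<inter> {k, k + 1}. \<xi>\<^sub>1 (y - of_int m) = 0"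
    proof
      fix m assume "m \<in> {1..M} - {1..M} \<inter> {k, k + 1}"
      then have "m \<le> k - 1 \<or> k + 2 \<le> m" by auto
      moreover have "of_int k \<le> y" "y < of_int k + 1"
        by (auto simp: k_def)
      ultimately have "y - of_int m \<le> -1 \<or> 1 \<le> y - of_int m"
        by linarith
      then show "\<xi>\<^sub>1 (y - of_int m) = 0" by (rule xi_out)
    qed
  qed auto
  also have "{1..M} \<inter> {k, k + 1} = (if 1 \<le> k \<and> k \<le> M then {k} else {}) \<union> (if 0 \<le> k \<and> k < M then {k + 1} else {})"
    by auto
  also have "(\<Sum>m\<in>\<dots>. \<xi>\<^sub>1 (y - of_int m)) = (if 1 \<le> k \<and> k \<le> M then \<xi>\<^sub>1 (y - of_int k) else 0) + (if 0 \<le> k \<and> k < M then \<xi>\<^sub>1 (y - of_int k - 1) else 0)"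
    by (auto simp: algebra_simps)
  finally show ?thesis .
qed

text \<open>Neighbouring translates add up to one where both belong to the sum, so for
  \<open>1 \<le> M\<close> it is a plateau over \<open>[1, M]\<close> with a ramp of length one on
  either side.\<close>

lemma xi1_sum_values:
  fixes M :: int and y :: real
  shows "0 \<le> (\<Sum>m\<in>{1..M}. \<xi>\<^sub>1 (y - of_int m))" "(\<Sum>m\<in>{1..M}. \<xi>\<^sub>1 (y - of_int m)) \<le> 1"
    "1 \<le> y \<Longrightarrow> y \<le> of_int M \<Longrightarrow> (\<Sum>m\<in>{1..M}. \<xi>\<^sub>1 (y - of_int m)) = 1"
    "of_int M + 1 \<le> y \<Longrightarrow> (\<Sum>m\<in>{1..M}. \<xi>\<^sub>1 (y - of_int m)) = 0"
proof -
  let ?k = "\<lfloor>y\<rfloor>"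
  have k: "of_int ?k \<le> y" "y < of_int ?k + 1" by auto
  have pu: "\<xi>\<^sub>1 (y - of_int ?k) + \<xi>\<^sub>1 (y - of_int ?k - 1) = 1"
    by (rule xi_partition_of_unity) (use k in linarith)+
  note nn = xi1_nonneg[of "y - of_int ?k"] xi1_nonneg[of "y - of_int ?k - 1"]
  show "0 \<le> (\<Sum>m\<in>{1..M}. \<xi>\<^sub>1 (y - of_int m))"
    by (intro sum_nonneg xi1_nonneg)
  show "(\<Sum>m\<in>{1..M}. \<xi>\<^sub>1 (y - of_int m)) \<le> 1"
    unfolding xi1_sum using pu nn by (auto split: if_splits)
  show "(\<Sum>m\<in>{1..M}. \<xi>\<^sub>1 (y - of_int m)) = 1" if y: "1 \<le> y" "y \<le> of_int M"
  proof (cases "?k < M")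
    case True
    have "1 \<le> ?k" using y by (simp add: le_floor_iff)
    then show ?thesis unfolding xi1_sum using pu True by simp
  next
    case False
    then have "y = of_int M" using k y by linarith
    moreover have "\<xi>\<^sub>1 0 = 1" by (simp add: \<xi>\<^sub>1_def)
    moreover have "1 \<le> M" using y by linarith
    ultimately show ?thesis unfolding xi1_sum by simp
  qed
  show "(\<Sum>m\<in>{1..M}. \<xi>\<^sub>1 (y - of_int m)) = 0" if "of_int M + 1 \<le> y"
  proof -
    have "M + 1 \<le> ?k" using that by (simp add: le_floor_iff)
    then show ?thesis unfolding xi1_sum by simp
  qed
qed

context interval
begin

lemma Psi_tame: "Psi \<subseteq> tame"
  unfolding \<Psi>I_def using phiI_props(1) psiI_props(1) by blast

lemma span_Psi_tame: "fun_vs.span Psi \<subseteq> tame"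
  by (rule fun_vs.span_minimal[OF Psi_tame subspace_tame])

sublocale approximation "{0<..<1}" "fun_vs.span Psi"
  by unfold_locales (use span_Psi_tame in auto)

text \<open>A plateau of mesh \<open>1 / K\<close> differs from the indicator inside the interval
  only on two ramps of length \<open>1 / K\<close>, and there by at most one.\<close>

lemma approximable_atMost:
  "approximable {0<..<1} (fun_vs.span Psi) (\<lambda>x. indicator {0<..<1} x * indicator {..a} x)"
  unfolding approximable_def
proof (intro conjI allI impI)
  have bnd: "sq_integrable (indicator {c..d} :: real \<Rightarrow> real)" for c d :: real
  proof -
    have "(\<lambda>x. (indicator {c..d} x :: real)\<^sup>2) = indicator {c..d}"
      by (auto simp: indicator_def fun_eq_iff)
    then show ?thesis
      unfolding sq_integrable_def by (simp add: integrable_indicator_iff emeasure_lborel_Icc_eq)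
  qed
  show "sq_integrable (\<lambda>x. indicator {0<..<1} x * indicator {..a} x)"
    by (rule sq_integrable_dominated[OF bnd[of 0 1]]) (auto simp: indicator_def)
  fix e :: real assume e: "0 < e"
  obtain j :: nat where j: "1 / 2 ^ j < e"
    using real_arch_pow_inv[OF e, of "1 / 2"] by (auto simp: power_one_over)
  define K :: real where "K = 2 * 2 ^ j"
  have K: "0 < K" by (simp add: K_def)
  \<comment> \<open>The last knot not beyond \<open>a\<close>, clipped so that only translates
    supported in \<open>[0, 1]\<close> enter the sum.\<close>
  define M where "M = max 0 (min \<lfloor>K * a\<rfloor> (2 * 2 ^ j - 1))"
  define g where "g = (\<Sum>m\<in>{1..M}. (\<lambda>x. \<xi>\<^sub>1 (K * x - of_int m)))"
  have g: "g \<in> fun_vs.span Psi"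
    unfolding g_def K_def by (intro fun_vs.span_sum hermite_span_Psi) (auto simp: M_def)
  have gx: "g x = (\<Sum>m\<in>{1..M}. \<xi>\<^sub>1 (K * x - of_int m))" for x
    by (simp add: g_def sum_fun_apply)
  let ?d = "\<lambda>x. indicator {0<..<1} x * indicator {..a} x - indicator {0<..<1} x * g x"
  let ?b = "\<lambda>x. indicator {0..1 / K} x + indicator {of_int M / K..of_int (M + 1) / K} x :: real"
  have le: "(?d x)\<^sup>2 \<le> ?b x" for x
  proof (cases "x \<in> {0<..<1}")
    case True
    consider "K * x < 1" | "1 \<le> K * x" "K * x \<le> of_int M" | "of_int M < K * x" "K * x < of_int M + 1" | "of_int M + 1 \<le> K * x"
      by linarith
    then show ?thesis
    proof cases
      case 2
      then have "1 \<le> M" by linarith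
      then have "M \<le> \<lfloor>K * a\<rfloor>" unfolding M_def max_def min_def by presburger
      then have "K * x \<le> K * a" using 2 by linarith
      then have "x \<le> a" using K by simp
      then have "?d x = 0"
        using xi1_sum_values(3)[OF 2] by (simp add: gx)
      then show ?thesis by (simp add: indicator_def)
    next
      case 4
      \<comment> \<open>The point \<open>x < 1\<close> lies beyond the falling ramp, so the upper
        clip is inactive and \<open>M\<close> is not less than the floor of
        \<open>K * a\<close>.\<close>
      have "K * x < K" using True K by simp
      then have "of_int M + 1 < K" using 4 by linarith
      then have "real_of_int (M + 1) < real_of_int (2 * 2 ^ j)" by (simp add: K_def)
      then have "M < 2 * 2 ^ j - 1" by linarith
      then have "\<lfloor>K * a\<rfloor> \<le> M" unfolding M_def max_def min_def by presburger
      then have "K * a < K * x" using 4 by linarith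
      then have "a < x" using K by simp
      then have "?d x = 0"
        using xi1_sum_values(4)[OF 4] by (simp add: gx)
      then show ?thesis by (simp add: indicator_def)
    next
      case 1
      have "\<bar>?d x\<bar> \<le> 1"
        using xi1_sum_values(1,2)[where M = M and y = "K * x"] by (auto simp: gx indicator_def)
      then have "(?d x)\<^sup>2 \<le> 1" by (simp add: abs_square_le_1)
      moreover have "x \<in> {0..1 / K}" using 1 True K by (simp add: field_simps)
      ultimately show ?thesis by (simp add: indicator_def)
    next
      case 3
      have "\<bar>?d x\<bar> \<le> 1"
        using xi1_sum_values(1,2)[where M = M and y = "K * x"] by (auto simp: gx indicator_def)
      then have "(?d x)\<^sup>2 \<le> 1" by (simp add: abs_square_le_1)
      moreover have "x \<in> {of_int M / K..of_int (M + 1) / K}" using 3 K by (simp add: field_simps)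
      ultimately show ?thesis by (simp add: indicator_def)
    qed
  next
    case False
    then have "?d x = 0" by simp
    then show ?thesis by (simp only:) simp
  qed
  have ib: "integrable lborel (\<lambda>x. indicator {c..d} x :: real)" for c d :: real
    by (simp add: integrable_indicator_iff emeasure_lborel_Icc_eq)
  have "sq_integrable ?d"
    by (rule sq_integrable_residual[OF sq_integrable_dominated[OF bnd[of 0 1]] g]) (auto simp: indicator_def)
  then have "(\<integral>x. (?d x)\<^sup>2 \<partial>lborel) \<le> (\<integral>x. ?b x \<partial>lborel)"
    using le ib by (intro integral_mono) (auto simp: sq_integrable_def)
  also have "\<dots> = 1 / K + 1 / K"
    using K ib by (simp add: divide_right_mono diff_divide_distrib[symmetric])
  also have "\<dots> < e"
    using j by (simp add: K_def)
  finally show "\<exists>g\<in>fun_vs.span Psi.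
      (\<integral>x. (indicator {0<..<1} x * indicator {..a} x - indicator {0<..<1} x * g x)\<^sup>2 \<partial>lborel) < e"
    using g by blast
qed

lemma span_Psi_dense:
  assumes f: "f \<in> L2_on {0<..<1}" and e: "0 < e"
  shows "\<exists>g\<in>fun_vs.span Psi. norm_on {0<..<1} (f - g) < e"
proof -
  let ?S = "{0<..<1::real}" and ?G = "fun_vs.span Psi"
  define u where "u = (\<lambda>x. indicator ?S x * f x)"
  have m: "u \<in> borel_measurable borel"
    using f by (simp add: L2_on_def set_borel_measurable_def u_def)
  have uu: "(\<lambda>x. indicator ?S x * u x) = u"
    by (auto simp: u_def fun_eq_iff indicator_def)
  have sq: "sq_integrable u"
  proof -
    have "integrable lborel (\<lambda>x. indicator ?S x *\<^sub>R (f x)\<^sup>2)"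
      using f by (simp add: L2_on_def set_integrable_def)
    moreover have "(\<lambda>x. indicator ?S x *\<^sub>R (f x)\<^sup>2) = (\<lambda>x. (u x)\<^sup>2)"
      by (auto simp: u_def fun_eq_iff indicator_def)
    ultimately show ?thesis using m by (simp add: sq_integrable_def)
  qed
  have top: "approximable ?S ?G (indicator ?S)"
  proof -
    have "(\<lambda>x. indicator ?S x * indicator {..1} x) = (indicator ?S :: real \<Rightarrow> real)"
      by (auto simp: fun_eq_iff indicator_def)
    then show ?thesis using approximable_atMost[of 1] by simp
  qed
  have "approximable ?S ?G (\<lambda>x. indicator ?S x * u x)"
  proof (rule approximable_sq_integrable)
    show "approximable ?S ?G (\<lambda>x. indicator ?S x * indicator A x)" if "A \<in> sets borel" for A
      by (rule approximable_borel_set[OF top approximable_atMost that])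
    show "sq_integrable (\<lambda>x. indicator ?S x * u x)"
      unfolding uu by (rule sq)
  qed (rule m)
  then obtain g where g: "g \<in> ?G" "(\<integral>x. (u x - indicator ?S x * g x)\<^sup>2 \<partial>lborel) < e\<^sup>2"
    using e unfolding uu approximable_def by (meson zero_less_power)
  have "inner_on ?S (f - g) (f - g) = (\<integral>x. (u x - indicator ?S x * g x)\<^sup>2 \<partial>lborel)"
    unfolding inner_on_def set_lebesgue_integral_def
    by (intro Bochner_Integration.integral_cong) (auto simp: u_def indicator_def power2_eq_square)
  then have "norm_on ?S (f - g) < e"
    unfolding norm_on_def using g(2) e by (intro real_less_lsqrt) auto
  then show ?thesis using g(1) by blast
qed

section \<open>The orthogonal basis\<close>

lemma Psi_ip:
  assumes "f \<in> Psi" "g \<in> Psi"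
  shows "inner_on {0<..<1} f g = (if f = g then 1 else 0)"
proof -
  \<comment> \<open>Every function belongs to all later stages \<open>B k\<close>, so any two have a
    common stage.\<close>
  have B: "\<exists>j. h \<in> B j \<and> (\<forall>k\<ge>j. h \<in> B k)" if "h \<in> Psi" for h
    using that unfolding \<Psi>I_def
  proof
    assume "h \<in> \<phi>I \<phi> ` {1..6}"
    then show ?thesis by (auto simp: B_def)
  next
    assume "h \<in> (\<Union>j. psiI j ` {1..6 * 2 ^ j})"
    then obtain i k where "k \<in> {1..6 * 2 ^ i}" "h = psiI i k" by blast
    then have "h \<in> B j" if "Suc i \<le> j" for j
      unfolding B_def using that by (intro UnI2 UN_I[of i]) auto
    then show ?thesis by blast
  qed
  obtain i j where "\<forall>k\<ge>i. f \<in> B k" "\<forall>k\<ge>j. g \<in> B k"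
    using B[OF assms(1)] B[OF assms(2)] by blast
  then have fg: "f \<in> B (max i j)" "g \<in> B (max i j)" by auto
  have "f \<in> supp_in 0 1"
    using assms(1) phiI_props(2) psiI_props(2) unfolding \<Psi>I_def by blast
  then have "inner_on {0<..<1} f g = ip f g"
    using assms Psi_tame by (intro inner_on_01_tame) auto
  then show ?thesis using B_ip[OF fg] by simp
qed

lemma Psi_orthogonal_basis: "orthogonal_basis_on {0<..<1} (Psi)"
  unfolding orthogonal_basis_on_def
proof (intro conjI ballI allI impI)
  show "Psi \<subseteq> L2_on {0<..<1}"
    using Psi_tame tame_L2_on by auto
  show "norm_on {0<..<1} f \<noteq> 0" if "f \<in> Psi" for f
    using Psi_ip[OF that that] by (simp add: norm_on_def)
  show "inner_on {0<..<1} f g = 0" if "f \<in> Psi" "g \<in> Psi" "f \<noteq> g" for f g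
    using Psi_ip[OF that(1,2)] that(3) by simp
qed (rule span_Psi_dense)

end

theorem theorem7:
  fixes \<phi> \<psi> \<psi>L \<psi>Rt :: "nat \<Rightarrow> real \<Rightarrow> real"
  assumes "scaling_generators \<phi>"
    and "wavelet_generators \<phi> \<psi>"
    and "boundary_generators \<phi> \<psi> \<psi>L \<psi>Rt"
  shows
    "(\<forall>f\<in>\<Psi>I \<phi> \<psi> \<psi>L \<psi>Rt. cubic_spline_on 0 1 f \<and> f C1_differentiable_on {0<..<1}) \<and>
     ((\<forall>k\<in>{1..6}. \<forall>l\<in>{1..6}.
         inner_on {0<..<1} (\<phi>I \<phi> k) (\<phi>I \<phi> l) = (if k = l then 1 else 0)) \<and>
      (\<forall>i j. \<forall>k\<in>{1..6 * 2 ^ i}. \<forall>l\<in>{1..6 * 2 ^ j}.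
         inner_on {0<..<1} (\<psi>I \<psi> \<psi>L \<psi>Rt i k) (\<psi>I \<psi> \<psi>L \<psi>Rt j l) =
           (if i = j \<and> k = l then 1 else 0)) \<and>
      (\<forall>k\<in>{1..6}. \<forall>j. \<forall>l\<in>{1..6 * 2 ^ j}.
         inner_on {0<..<1} (\<phi>I \<phi> k) (\<psi>I \<psi> \<psi>L \<psi>Rt j l) = 0)) \<and>
     (\<forall>j. \<forall>k\<in>{3..6 * 2 ^ j - 2}. \<forall>p :: real poly. degree p < 4 \<longrightarrow>
         inner_on {0<..<1} (\<psi>I \<psi> \<psi>L \<psi>Rt j k) (poly p) = 0) \<and>
     orthogonal_basis_on {0<..<1} (\<Psi>I \<phi> \<psi> \<psi>L \<psi>Rt) \<and>
     ((\<forall>k\<in>{1..6}. diameter (supp01 (\<phi>I \<phi> k)) \<le> 2) \<and>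
      (\<forall>j. \<forall>k\<in>{1..6 * 2 ^ j}.
         diameter (supp01 (\<psi>I \<psi> \<psi>L \<psi>Rt j k)) \<le> 2 powr (1 - real j)))"
proof -
  interpret interval \<phi> \<psi> \<psi>L \<psi>Rt
    using assms by unfold_locales
  show ?thesis
  proof (intro conjI ballI allI impI)
    fix f assume "f \<in> \<Psi>I \<phi> \<psi> \<psi>L \<psi>Rt"
    then show "cubic_spline_on 0 1 f" "f C1_differentiable_on {0<..<1}"
      unfolding \<Psi>I_def using phiI_props(3,4) psiI_props(3,4) by blast+
  next
    fix k l :: nat assume "k \<in> {1..6}" "l \<in> {1..6}"
    then show "inner_on {0<..<1} (\<phi>I \<phi> k) (\<phi>I \<phi> l) = (if k = l then 1 else 0)"
      using phiI_orthonormal phiI_props(1,2) inner_on_01_tame by simp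
  next
    fix i j k l :: nat assume "k \<in> {1..6 * 2 ^ i}" "l \<in> {1..6 * 2 ^ j}"
    then show "inner_on {0<..<1} (psiI i k) (psiI j l) = (if i = j \<and> k = l then 1 else 0)"
      using psiI_orthonormal[of k i l j] psiI_props(1,2) inner_on_01_tame by simp
  next
    fix j k l :: nat assume "k \<in> {1..6}" "l \<in> {1..6 * 2 ^ j}"
    then show "inner_on {0<..<1} (\<phi>I \<phi> k) (psiI j l) = 0"
      using phiI_psiI_orth phiI_props(1,2) psiI_props(1) inner_on_01_tame by simp
  next
    fix j k :: nat and p :: "real poly"
    assume k: "k \<in> {3..6 * 2 ^ j - 2}" and p: "degree p < 4"
    then have "k \<in> {1..6 * 2 ^ j}" by auto
    note psi = psiI_props(1,2)[OF this]
    have "psiI j k \<in> borel_measurable borel"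
      using psi(1) by (auto elim: tameE)
    moreover have "poly p \<in> borel_measurable borel"
      by (intro borel_measurable_continuous_onI continuous_intros)
    ultimately show "inner_on {0<..<1} (psiI j k) (poly p) = 0"
      using inner_on_01[OF psi(2)] psiI_moments[OF k p] by simp
  next
    show "orthogonal_basis_on {0<..<1} (\<Psi>I \<phi> \<psi> \<psi>L \<psi>Rt)"
      by (rule Psi_orthogonal_basis)
  next
    fix k :: nat assume "k \<in> {1..6}"
    then show "diameter (supp01 (\<phi>I \<phi> k)) \<le> 2" by (rule phiI_props)
  next
    fix j k :: nat assume "k \<in> {1..6 * 2 ^ j}"
    then show "diameter (supp01 (psiI j k)) \<le> 2 powr (1 - real j)" by (rule psiI_props)
  qed
qed

end
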